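(* Let $\mathcal M=(M,<,+,0,\ldots)$ be a definably complete locally o-minimal expansion of an ordered group and let $(\Omega,\preceq)$ be a definable directed set. Then there exists a definable downward cofinal map $\gamma:(M^{>0}\times M^{>0},\unlhd)\to(\Omega,\preceq)$.
   Context: "Definable" means definable in $\mathcal M$ with parameters. $\mathcal M$ is an expansion of an ordered group with dense order without endpoints; locally o-minimal: for every definable $X\subseteq M$ and $a\in M$ there is an open interval $I\ni a$ with $X\cap I$ a finite union of points and open intervals; definably complete: every definable subset of $M$ has sup and inf in $M\cup\{\pm\infty\}$. $M^{>0}=\{x\in M: x>0\}$. A preorder is a reflexive transitive relation. A (downward) directed set $(\Omega,\preceq)$ is a nonempty set with a preorder such that every finite subset has an element $v$ with $v\preceq u$ for all $u$ in it; it is definable if $\Omega\subseteq M^n$ and $\preceq$ are definable. On $M^{>0}\times M^{>0}$, $(s,t)\unlhd(s',t')$ iff $s\le s'$ and $t\ge t'$. A map $\gamma:(\Omega',\preceq')\to(\Omega,\preceq)$ is downward cofinal if for every $u\in\Omega$ there is $v\in\Omega'$ such that $w\preceq' v$ implies $\gamma(w)\preceq u$. *)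

theory Defs
  imports Main
begin

definition tuples :: "nat \<Rightarrow> 'a list set" where
  "tuples n = {xs. length xs = n}"

text \<open>A family D, where D n is the collection of definable (with parameters) subsets of M^n,
  of an expansion of (M,<,+). This is the standard axiomatisation of a "structure" on M
  (van den Dries): boolean algebras, closed under products, containing diagonals, closed
  under projections; in addition containing the order, the graph of +, and all singletons
  (parameters).\<close>

definition expansion_structure ::
  "(nat \<Rightarrow> ('a::{linordered_ab_group_add}) list set set) \<Rightarrow> bool" where
  "expansion_structure D \<longleftrightarrow>
     (\<forall>n. D n \<subseteq> Pow (tuples n)) \<and>
     (\<forall>n. {} \<in> D n) \<and>
     (\<forall>n A. A \<in> D n \<longrightarrow> tuples n - A \<in> D n) \<and>
     (\<forall>n A B. A \<in> D n \<longrightarrow> B \<in> D n \<longrightarrow> A \<union> B \<in> D n) \<and>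
     (\<forall>m n A B. A \<in> D m \<longrightarrow> B \<in> D n \<longrightarrow> {xs @ ys | xs ys. xs \<in> A \<and> ys \<in> B} \<in> D (m + n)) \<and>
     (\<forall>n i j. i < n \<longrightarrow> j < n \<longrightarrow> {xs \<in> tuples n. xs ! i = xs ! j} \<in> D n) \<and>
     (\<forall>n A. A \<in> D (Suc n) \<longrightarrow> butlast ` A \<in> D n) \<and>
     {[x, y] | x y. x < y} \<in> D 2 \<and>
     {[x, y, z] | x y z. z = x + y} \<in> D 3 \<and>
     (\<forall>a. {[a]} \<in> D 1)"

definition locally_o_minimal :: "(nat \<Rightarrow> ('a::linorder) list set set) \<Rightarrow> bool" where
  "locally_o_minimal D \<longleftrightarrow>
     (\<forall>X \<in> D 1. \<forall>a. \<exists>l u. l < a \<and> a < u \<and>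
        (\<exists>P J. finite P \<and> finite J \<and>
           {x. [x] \<in> X} \<inter> {l<..<u} = P \<union> (\<Union>(p, q)\<in>J. {p<..<q})))"

definition definably_complete :: "(nat \<Rightarrow> ('a::linorder) list set set) \<Rightarrow> bool" where
  "definably_complete D \<longleftrightarrow>
     (\<forall>X \<in> D 1. let S = {x. [x] \<in> X} in
        (S \<noteq> {} \<and> (\<exists>b. \<forall>x\<in>S. x \<le> b) \<longrightarrow>
           (\<exists>s. (\<forall>x\<in>S. x \<le> s) \<and> (\<forall>b. (\<forall>x\<in>S. x \<le> b) \<longrightarrow> s \<le> b))) \<and>
        (S \<noteq> {} \<and> (\<exists>b. \<forall>x\<in>S. b \<le> x) \<longrightarrow>
           (\<exists>s. (\<forall>x\<in>S. s \<le> x) \<and> (\<forall>b. (\<forall>x\<in>S. b \<le> x) \<longrightarrow> b \<le> s))))"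

definition definable_directed_set ::
  "(nat \<Rightarrow> 'a list set set) \<Rightarrow> nat \<Rightarrow> 'a list set \<Rightarrow> ('a list \<Rightarrow> 'a list \<Rightarrow> bool) \<Rightarrow> bool" where
  "definable_directed_set D n \<Omega> R \<longleftrightarrow>
     \<Omega> \<in> D n \<and>
     {xs @ ys | xs ys. xs \<in> \<Omega> \<and> ys \<in> \<Omega> \<and> R xs ys} \<in> D (n + n) \<and>
     \<Omega> \<noteq> {} \<and>
     (\<forall>u\<in>\<Omega>. R u u) \<and>
     (\<forall>u\<in>\<Omega>. \<forall>v\<in>\<Omega>. \<forall>w\<in>\<Omega>. R u v \<longrightarrow> R v w \<longrightarrow> R u w) \<and>
     (\<forall>F. finite F \<longrightarrow> F \<subseteq> \<Omega> \<longrightarrow> (\<exists>v\<in>\<Omega>. \<forall>u\<in>F. R v u))"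

definition tri_le :: "('a::linorder) \<times> 'a \<Rightarrow> 'a \<times> 'a \<Rightarrow> bool" where
  "tri_le w v \<longleftrightarrow> fst w \<le> fst v \<and> snd w \<ge> snd v"

end

theory Submission
  imports Defs
begin

text \<open>
  Every definable set gets a dimension, computed coordinate by coordinate: a fibre direction counts
  when it contains an interval. Local o-minimality and definable completeness yield a Baire-type
  statement for families indexed by a positive parameter, hence a monotonicity theorem, hence
  invariance of the dimension under permutations of coordinates, its additivity, and the fact that
  the frontier of a definable set has smaller dimension than the set.

  Replace \<open>\<Omega>\<close> by a cone \<open>L = {v. v \<preceq> u\<^sub>0}\<close> of minimal dimension \<open>d\<close>, so that all cones
  below elements of \<open>L\<close> have dimension \<open>d\<close>. Computing the dimension of
  \<open>{(v, u). v \<preceq> u, u \<in> B}\<close> in both orders shows that, for definable \<open>B \<subseteq> L\<close>, some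
  \<open>{u \<in> B. v \<preceq> u}\<close> has the full dimension of \<open>B\<close>. By the frontier inequality the points of \<open>B\<close>
  having no neighbourhood in \<open>B\<close> with a lower bound form a set of smaller dimension.
  The remaining points are exhausted by the sets \<open>K(s, t)\<close> of those \<open>x\<close> with coordinates in
  \<open>[-t, t]\<close> whose box of radius \<open>s\<close> has a lower bound, and definable compactness gives a lower
  bound of the whole of \<open>K(s, t)\<close>. Induction on the dimension covers \<open>L\<close>, and definable choice of
  a lower bound is the required map.
\<close>

subsection \<open>Definability of first-order conditions\<close>


text \<open>A definable set of dimension 0 is closed and discrete but may be infinite, and no
  decomposition into finitely many cells is at hand. Finiteness and continuity arguments of the
  o-minimal case are therefore replaced by passing to a subinterval on which a radius is uniform and
  a selected point nearly constant. This also shapes the dimension: a recursion over fibres that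
  asks only for intervals is first-order, hence definable in families, at the price that its
  invariance under reordering the coordinates has to be proved.

  The choice of \<open>d\<close> enters one count from both sides: every cone has dimension at least
  \<open>d\<close>, while a set of lower bounds inside \<open>L\<close> has dimension at most
  \<open>d\<close>, so the rest of the dimension of the pairs must sit in a fibre over some
  \<open>v\<close>.

  Two parameters appear because two things are controlled independently: the radius \<open>s\<close>
  on which a common lower bound exists and the size \<open>t\<close> of the coordinates that
  compactness needs. An ordered group offers in general no definable order-reversing bijection of
  the positive elements that would merge them.\<close>

definition block :: "(nat \<Rightarrow> 'a) \<Rightarrow> nat \<Rightarrow> 'a list" where
  "block f n = map f [0..<n]"

lemma length_block [simp]: "length (block f n) = n"
  by (simp add: block_def)

lemma nth_block [simp]: "i < n \<Longrightarrow> block f n ! i = f i"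
  by (simp add: block_def)

lemma block_nth: "length y = n \<Longrightarrow> block ((!) y) n = y"
  by (auto simp: block_def map_nth)

definition vals :: "(nat \<Rightarrow> nat \<Rightarrow> 'a) \<Rightarrow> (nat \<times> nat) list \<Rightarrow> 'a list" where
  "vals \<rho> vs = map (\<lambda>(i, j). \<rho> i j) vs"

lemma length_vals [simp]: "length (vals \<rho> vs) = length vs"
  by (simp add: vals_def)

lemma vals_append: "vals \<rho> (us @ ws) = vals \<rho> us @ vals \<rho> ws"
  by (simp add: vals_def)

lemma vals_cong: "(\<And>i j. (i, j) \<in> set vs \<Longrightarrow> \<rho> i j = \<rho>' i j) \<Longrightarrow> vals \<rho> vs = vals \<rho>' vs"
  by (auto simp: vals_def)

locale definable_structure =
  fixes D :: "nat \<Rightarrow> ('a::linordered_ab_group_add) list set set"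
  assumes expansion: "expansion_structure D"
begin

section \<open>Closure properties of the definable sets\<close>

lemma D_length: "A \<in> D n \<Longrightarrow> xs \<in> A \<Longrightarrow> length xs = n"
  using expansion by (auto simp: expansion_structure_def tuples_def)

lemma D_empty: "{} \<in> D n"
  using expansion by (simp add: expansion_structure_def)

lemma D_compl: "A \<in> D n \<Longrightarrow> {xs. length xs = n \<and> xs \<notin> A} \<in> D n"
proof -
  assume "A \<in> D n"
  then have "tuples n - A \<in> D n" using expansion by (simp add: expansion_structure_def)
  then show ?thesis by (simp add: tuples_def set_diff_eq)
qed

lemma D_tuples: "{xs. length xs = n} \<in> D n"
  using D_compl[OF D_empty] by simp

lemma D_Un: "A \<in> D n \<Longrightarrow> B \<in> D n \<Longrightarrow> A \<union> B \<in> D n"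
  using expansion by (simp add: expansion_structure_def)

lemma D_Int: assumes "A \<in> D n" "B \<in> D n" shows "A \<inter> B \<in> D n"
proof -
  have eq: "A \<inter> B = {xs. length xs = n \<and> xs \<notin> {xs. length xs = n \<and> xs \<notin> A} \<union> {xs. length xs = n \<and> xs \<notin> B}}"
    using assms D_length by auto
  show ?thesis unfolding eq by (intro D_compl D_Un assms)
qed

lemma D_prod:
  assumes "A \<in> D m" "B \<in> D n"
  shows "{zs. length zs = m + n \<and> take m zs \<in> A \<and> drop m zs \<in> B} \<in> D (m + n)"
proof -
  have "{xs @ ys | xs ys. xs \<in> A \<and> ys \<in> B} \<in> D (m + n)"
    using expansion assms by (simp add: expansion_structure_def)
  also have "{xs @ ys | xs ys. xs \<in> A \<and> ys \<in> B} = {zs. length zs = m + n \<and> take m zs \<in> A \<and> drop m zs \<in> B}"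
    (is "?L = ?R")
  proof
    show "?L \<subseteq> ?R" using D_length[OF assms(1)] D_length[OF assms(2)] by auto
    show "?R \<subseteq> ?L" by (auto) (metis append_take_drop_id)
  qed
  finally show ?thesis .
qed

lemma D_diag: "i < n \<Longrightarrow> j < n \<Longrightarrow> {xs. length xs = n \<and> xs ! i = xs ! j} \<in> D n"
  using expansion by (simp add: expansion_structure_def tuples_def)

lemma D_proj:
  "A \<in> D (m + k) \<Longrightarrow> {xs. \<exists>ys. length ys = k \<and> xs @ ys \<in> A} \<in> D m"
proof (induction k arbitrary: A)
  case 0
  then show ?case by simp
next
  case (Suc k)
  have "butlast ` A \<in> D (m + k)"
    using expansion Suc.prems by (simp add: expansion_structure_def)
  from Suc.IH[OF this] have "{xs. \<exists>ys. length ys = k \<and> xs @ ys \<in> butlast ` A} \<in> D m" .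
  also have "{xs. \<exists>ys. length ys = k \<and> xs @ ys \<in> butlast ` A} = {xs. \<exists>ys. length ys = Suc k \<and> xs @ ys \<in> A}"
  proof (intro set_eqI iffI; clarsimp)
    fix xs ys z assume *: "k = length ys" "xs @ ys = butlast z" "z \<in> A"
    then have "z \<noteq> []" using D_length[OF Suc.prems] by fastforce
    then have "xs @ (ys @ [last z]) = z" using * by (metis append_assoc append_butlast_last_id)
    then show "\<exists>zs. length zs = Suc (length ys) \<and> xs @ zs \<in> A" using * by (intro exI[of _ "ys @ [last z]"]) auto
  next
    fix xs ys assume *: "length ys = Suc k" "xs @ ys \<in> A"
    then have "ys \<noteq> []" by auto
    then show "\<exists>zs. length zs = k \<and> xs @ zs \<in> butlast ` A"
      using * by (intro exI[of _ "butlast ys"]) (auto simp: image_iff butlast_append intro!: bexI[of _ "xs @ ys"])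
  qed
  finally show ?case .
qed

lemma D_ball:
  assumes "\<And>j. j < (k::nat) \<Longrightarrow> {xs. length xs = n \<and> P j xs} \<in> D n"
  shows "{xs. length xs = n \<and> (\<forall>j<k. P j xs)} \<in> D n"
  using assms
proof (induction k)
  case 0
  then show ?case by (simp add: D_tuples)
next
  case (Suc k)
  have "{xs. length xs = n \<and> (\<forall>j<Suc k. P j xs)}
      = {xs. length xs = n \<and> (\<forall>j<k. P j xs)} \<inter> {xs. length xs = n \<and> P k xs}"
    by (auto simp: less_Suc_eq)
  then show ?case using Suc by (simp add: D_Int)
qed

text \<open>The set is a projection of the product of M^m with \<open>A\<close>, cut by the
  diagonals \<open>zs ! (is ! j) = zs ! (m + j)\<close>. As \<open>is\<close> may repeat, permute or
  omit positions, this covers all substitutions of variables for variables.\<close>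

lemma D_reindex:
  assumes A: "A \<in> D n" and l: "length is = n" and s: "set is \<subseteq> {..<m}"
  shows "{xs. length xs = m \<and> map ((!) xs) is \<in> A} \<in> D m"
proof -
  let ?E = "{zs. length zs = m + n \<and> take m zs \<in> {xs. length xs = m} \<and> drop m zs \<in> A}
     \<inter> {zs. length zs = m + n \<and> (\<forall>j<n. zs ! (is ! j) = zs ! (m + j))}"
  have lt: "is ! j < m" if "j < n" for j using s l that by (metis lessThan_iff nth_mem subsetD)
  have "?E \<in> D (m + n)"
    by (intro D_Int D_prod D_tuples A D_ball D_diag) (use lt in \<open>auto intro: trans_less_add1\<close>)
  from D_proj[OF this] have "{xs. \<exists>ys. length ys = n \<and> xs @ ys \<in> ?E} \<in> D m" .
  also have "{xs. \<exists>ys. length ys = n \<and> xs @ ys \<in> ?E} = {xs. length xs = m \<and> map ((!) xs) is \<in> A}"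
  proof (intro set_eqI iffI)
    fix xs assume "xs \<in> {xs. \<exists>ys. length ys = n \<and> xs @ ys \<in> ?E}"
    then obtain ys where ys: "length ys = n" "length xs = m" "ys \<in> A"
      "\<forall>j<n. (xs @ ys) ! (is ! j) = (xs @ ys) ! (m + j)" by auto
    have "map ((!) xs) is = ys"
      by (rule nth_equalityI) (use ys l lt in \<open>auto simp: nth_append\<close>)
    then show "xs \<in> {xs. length xs = m \<and> map ((!) xs) is \<in> A}" using ys by simp
  next
    fix xs assume "xs \<in> {xs. length xs = m \<and> map ((!) xs) is \<in> A}"
    then show "xs \<in> {xs. \<exists>ys. length ys = n \<and> xs @ ys \<in> ?E}"
      using l lt by (auto intro!: exI[of _ "map ((!) xs) is"] simp: nth_append)
  qed
  finally show ?thesis .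
qed

text \<open>
  An environment \<open>\<rho>\<close> assigns to the variable \<open>i\<close> the block of coordinates \<open>\<rho> i 0, \<rho> i 1, \<dots>\<close>; a
  variable ranging over \<open>M\<close> is \<open>\<rho> i 0\<close>, one ranging over \<open>M\<^sup>n\<close> is \<open>block (\<rho> i) n\<close>. Quantifiers
  bind variable 0 and shift the others (de Bruijn indices), so no freshness conditions arise.
\<close>

definition definable :: "((nat \<Rightarrow> nat \<Rightarrow> 'a) \<Rightarrow> bool) \<Rightarrow> bool" where
  "definable P \<longleftrightarrow> (\<exists>vs. \<exists>A\<in>D (length vs). \<forall>\<rho>. P \<rho> \<longleftrightarrow> vals \<rho> vs \<in> A)"

section \<open>Conditions on environments: normal forms and quantifiers\<close>

lemma definable_cong: "definable P \<Longrightarrow> (\<And>\<rho>. P \<rho> \<longleftrightarrow> Q \<rho>) \<Longrightarrow> definable Q"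
  by (simp add: definable_def)

text \<open>The common source of normal forms and of quantifiers: whatever list \<open>vs\<close>
  presents \<open>P\<close>, all variables outside \<open>us\<close> are projected away at
  once.\<close>

lemma definable_project:
  assumes P: "\<And>\<rho>. P \<rho> \<longleftrightarrow> vals \<rho> vs \<in> B" and B: "B \<in> D (length vs)" and us: "distinct us"
  shows "\<exists>A\<in>D (length us). \<forall>\<rho>. vals \<rho> us \<in> A \<longleftrightarrow>
    (\<exists>\<rho>'. (\<forall>i j. (i, j) \<in> set us \<longrightarrow> \<rho>' i j = \<rho> i j) \<and> P \<rho>')"
proof -
  \<comment> \<open>Each variable to be projected away is listed once, so that a tuple of witnesses
    can be read back as an environment.\<close>
  define ws where "ws = remdups (filter (\<lambda>v. v \<notin> set us) vs)"
  let ?al = "us @ ws"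
  have ws: "distinct ws" "set us \<inter> set ws = {}" and sub: "set vs \<subseteq> set ?al"
    by (auto simp: ws_def)
  have "\<forall>v\<in>set vs. \<exists>k. k < length ?al \<and> ?al ! k = v"
    using sub by (meson in_set_conv_nth subsetD)
  then obtain idx where idx: "\<And>v. v \<in> set vs \<Longrightarrow> idx v < length ?al \<and> ?al ! idx v = v"
    by (metis)
  define A' where "A' = {xs. length xs = length ?al \<and> map ((!) xs) (map idx vs) \<in> B}"
  have A': "A' \<in> D (length us + length ws)"
    unfolding A'_def using D_reindex[OF B, of "map idx vs" "length ?al"] idx
    by (simp add: image_subset_iff)
  have val: "vals \<rho> ?al \<in> A' \<longleftrightarrow> P \<rho>" for \<rho>
  proof -
    have "vals \<rho> ?al ! idx v = (case v of (i, j) \<Rightarrow> \<rho> i j)" if "v \<in> set vs" for v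
      using idx[OF that] unfolding vals_def by (simp only: nth_map)
    then have "map ((!) (vals \<rho> ?al)) (map idx vs) = vals \<rho> vs"
      by (simp add: vals_def[of \<rho> vs])
    then show ?thesis by (simp add: A'_def P)
  qed
  let ?A = "{xs. \<exists>ys. length ys = length ws \<and> xs @ ys \<in> A'}"
  show ?thesis
  proof (rule bexI[OF _ D_proj[OF A']], intro allI iffI)
    fix \<rho> assume "\<exists>\<rho>'. (\<forall>i j. (i, j) \<in> set us \<longrightarrow> \<rho>' i j = \<rho> i j) \<and> P \<rho>'"
    then obtain \<rho>' where \<rho>': "\<And>i j. (i, j) \<in> set us \<Longrightarrow> \<rho>' i j = \<rho> i j" "P \<rho>'" by auto
    have "vals \<rho> us = vals \<rho>' us" by (rule vals_cong) (simp add: \<rho>')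
    then show "vals \<rho> us \<in> ?A"
      using val[of \<rho>'] \<rho>'(2) by (auto simp: vals_append intro!: exI[of _ "vals \<rho>' ws"])
  next
    fix \<rho> assume "vals \<rho> us \<in> ?A"
    then obtain ys where ys: "length ys = length ws" "vals \<rho> us @ ys \<in> A'" by auto
    define \<rho>' where "\<rho>' i j = (case map_of (zip ws ys) (i, j) of None \<Rightarrow> \<rho> i j | Some y \<Rightarrow> y)" for i j
    have agree: "\<rho>' i j = \<rho> i j" if "(i, j) \<in> set us" for i j
    proof -
      have "map_of (zip ws ys) (i, j) = None"
        using ws that by (auto simp: map_of_eq_None_iff dest!: set_zip_leftD)
      then show ?thesis by (simp add: \<rho>'_def)
    qed
    have "vals \<rho>' us = vals \<rho> us" by (rule vals_cong) (simp add: agree)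
    moreover have "vals \<rho>' ws = ys"
    proof (rule nth_equalityI)
      fix k assume k: "k < length (vals \<rho>' ws)"
      obtain i j where ij: "ws ! k = (i, j)" by (cases "ws ! k")
      have "map_of (zip ws ys) (i, j) = Some (ys ! k)"
        using map_of_zip_nth[of ws ys k] ws ys k ij by auto
      then show "vals \<rho>' ws ! k = ys ! k" using k ij by (simp add: vals_def \<rho>'_def)
    qed (simp add: ys)
    ultimately have "P \<rho>'" using val[of \<rho>'] ys by (simp add: vals_append)
    then show "\<exists>\<rho>'. (\<forall>i j. (i, j) \<in> set us \<longrightarrow> \<rho>' i j = \<rho> i j) \<and> P \<rho>'" using agree by blast
  qed
qed

text \<open>When \<open>P\<close> depends only on \<open>us\<close>, the existential quantifier over
  environments in \<open>definable_project\<close> collapses.\<close>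

lemma definable_normal:
  assumes "definable P" "distinct us"
    and ind: "\<And>\<rho> \<rho>'. (\<And>i j. (i, j) \<in> set us \<Longrightarrow> \<rho> i j = \<rho>' i j) \<Longrightarrow> P \<rho> \<Longrightarrow> P \<rho>'"
  shows "\<exists>A\<in>D (length us). \<forall>\<rho>. P \<rho> \<longleftrightarrow> vals \<rho> us \<in> A"
proof -
  obtain vs B where "B \<in> D (length vs)" "\<And>\<rho>. P \<rho> \<longleftrightarrow> vals \<rho> vs \<in> B"
    using assms(1) by (auto simp: definable_def)
  from definable_project[OF this(2,1) assms(2)] obtain A where A: "A \<in> D (length us)"
    "\<And>\<rho>. vals \<rho> us \<in> A \<longleftrightarrow> (\<exists>\<rho>'. (\<forall>i j. (i, j) \<in> set us \<longrightarrow> \<rho>' i j = \<rho> i j) \<and> P \<rho>')"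
    by blast
  have "P \<rho> \<longleftrightarrow> vals \<rho> us \<in> A" for \<rho>
    unfolding A(2) using ind by blast
  then show ?thesis using A(1) by blast
qed

lemma vals_block: "vals \<rho> (map (Pair i) [0..<n]) = block (\<rho> i) n"
  by (simp add: vals_def block_def)

text \<open>The way back from conditions to sets: together with \<open>definable_intros\<close> it
  reduces membership in \<open>D n\<close> to reading off a formula.\<close>

lemma D_of_definable:
  assumes "definable (\<lambda>\<rho>. P (block (\<rho> 0) n))"
  shows "{x. length x = n \<and> P x} \<in> D n"
proof -
  obtain A where A: "A \<in> D n" "\<And>\<rho>. P (block (\<rho> (0::nat)) n) \<longleftrightarrow> block (\<rho> 0) n \<in> A"
  proof -
    have "\<exists>A\<in>D (length (map (Pair (0::nat)) [0..<n])). \<forall>\<rho>. P (block (\<rho> 0) n) \<longleftrightarrow> vals \<rho> (map (Pair 0) [0..<n]) \<in> A"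
    proof (rule definable_normal[OF assms])
      show "distinct (map (Pair (0::nat)) [0..<n])" by (auto simp: distinct_map inj_on_def)
      fix \<rho> \<rho>' :: "nat \<Rightarrow> nat \<Rightarrow> 'a"
      assume "\<And>i j. (i, j) \<in> set (map (Pair 0) [0..<n]) \<Longrightarrow> \<rho> i j = \<rho>' i j" and "P (block (\<rho> 0) n)"
      moreover from this have "block (\<rho> 0) n = block (\<rho>' 0) n" by (auto simp: block_def)
      ultimately show "P (block (\<rho>' 0) n)" by simp
    qed
    then have "\<exists>A\<in>D n. \<forall>\<rho>. P (block (\<rho> (0::nat)) n) \<longleftrightarrow> block (\<rho> 0) n \<in> A"
      by (simp add: vals_block)
    then show ?thesis using that by blast
  qed
  have "P x \<longleftrightarrow> x \<in> A" if "length x = n" for x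
    using A(2)[of "\<lambda>_. (!) x"] block_nth[OF that] by simp
  then have "{x. length x = n \<and> P x} = A" using D_length[OF A(1)] by auto
  then show ?thesis using A(1) by simp
qed

lemma definable_rename:
  assumes "definable P" shows "definable (\<lambda>\<rho>. P (\<lambda>i. \<rho> (f i)))"
proof -
  obtain vs A where A: "A \<in> D (length vs)" "\<And>\<rho>. P \<rho> \<longleftrightarrow> vals \<rho> vs \<in> A"
    using assms by (auto simp: definable_def)
  have "vals (\<lambda>i. \<rho> (f i)) vs = vals \<rho> (map (\<lambda>(i, j). (f i, j)) vs)" for \<rho> :: "nat \<Rightarrow> nat \<Rightarrow> 'a"
    by (auto simp: vals_def)
  then show ?thesis unfolding definable_def
    using A by (intro exI[of _ "map (\<lambda>(i, j). (f i, j)) vs"] bexI[of _ A]) auto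
qed

text \<open>Although \<open>f\<close> is an infinite sequence, \<open>P\<close> inspects only the
  finitely many coordinates in \<open>vs\<close>, so the quantifier amounts to a finite projection.
  Binding a whole block serves variables over M and over M^n alike.\<close>

lemma definable_block_ex:
  assumes "definable P" shows "definable (\<lambda>\<rho>. \<exists>f. P (case_nat f \<rho>))"
proof -
  obtain vs B where B: "B \<in> D (length vs)" "\<And>\<rho>. P \<rho> \<longleftrightarrow> vals \<rho> vs \<in> B"
    using assms by (auto simp: definable_def)
  define us where "us = remdups (filter (\<lambda>v. fst v \<noteq> 0) vs)"
  have us: "distinct us" by (simp add: us_def)
  from definable_project[OF B(2,1) us] obtain A where A: "A \<in> D (length us)"
    "\<And>\<rho>. vals \<rho> us \<in> A \<longleftrightarrow> (\<exists>\<rho>'. (\<forall>i j. (i, j) \<in> set us \<longrightarrow> \<rho>' i j = \<rho> i j) \<and> P \<rho>')"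
    by blast
  let ?ws = "map (\<lambda>(i, j). (i - 1, j)) us"
  have "(\<exists>f. P (case_nat f \<rho>)) \<longleftrightarrow> vals \<rho> ?ws \<in> A" for \<rho>
  proof -
    \<comment> \<open>Block 0 was filtered out of \<open>us\<close>, so \<open>i - 1\<close> really
      inverts the shift and the value \<open>undefined\<close> is never read.\<close>
    have "vals \<rho> ?ws = vals (case_nat undefined \<rho>) us"
      unfolding vals_def us_def by (auto split: nat.splits)
    also have "\<dots> \<in> A \<longleftrightarrow> (\<exists>\<rho>'. (\<forall>i j. (i, j) \<in> set us \<longrightarrow> \<rho>' i j = case_nat undefined \<rho> i j) \<and> P \<rho>')"
      by (rule A(2))
    also have "\<dots> \<longleftrightarrow> (\<exists>f. P (case_nat f \<rho>))"
    proof
      assume "\<exists>\<rho>'. (\<forall>i j. (i, j) \<in> set us \<longrightarrow> \<rho>' i j = case_nat undefined \<rho> i j) \<and> P \<rho>'"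
      then obtain \<rho>' where *: "\<And>i j. (i, j) \<in> set us \<Longrightarrow> \<rho>' i j = case_nat undefined \<rho> i j" "P \<rho>'"
        by blast
      have "vals \<rho>' vs = vals (case_nat (\<rho>' 0) \<rho>) vs"
        by (rule vals_cong) (use *(1) in \<open>auto simp: us_def split: nat.splits\<close>)
      then show "\<exists>f. P (case_nat f \<rho>)" using *(2) B(2) by metis
    next
      assume "\<exists>f. P (case_nat f \<rho>)"
      then obtain f where "P (case_nat f \<rho>)" ..
      then show "\<exists>\<rho>'. (\<forall>i j. (i, j) \<in> set us \<longrightarrow> \<rho>' i j = case_nat undefined \<rho> i j) \<and> P \<rho>'"
        by (intro exI[of _ "case_nat f \<rho>"]) (auto simp: us_def split: nat.splits)
    qed
    finally show ?thesis by simp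
  qed
  then show ?thesis unfolding definable_def using A(1) by (intro exI[of _ ?ws] bexI[of _ A]) auto
qed

lemma definable_not: "definable P \<Longrightarrow> definable (\<lambda>\<rho>. \<not> P \<rho>)"
proof -
  assume "definable P"
  then obtain vs A where A: "A \<in> D (length vs)" "\<And>\<rho>. P \<rho> \<longleftrightarrow> vals \<rho> vs \<in> A"
    by (auto simp: definable_def)
  then show ?thesis unfolding definable_def using D_compl[OF A(1)]
    by (intro exI[of _ vs] bexI[of _ "{xs. length xs = length vs \<and> xs \<notin> A}"]) auto
qed

lemma definable_conj: assumes "definable P" "definable Q" shows "definable (\<lambda>\<rho>. P \<rho> \<and> Q \<rho>)"
proof -
  obtain vs A where A: "A \<in> D (length vs)" "\<And>\<rho>. P \<rho> \<longleftrightarrow> vals \<rho> vs \<in> A"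
    using assms(1) by (auto simp: definable_def)
  obtain ws B where B: "B \<in> D (length ws)" "\<And>\<rho>. Q \<rho> \<longleftrightarrow> vals \<rho> ws \<in> B"
    using assms(2) by (auto simp: definable_def)
  show ?thesis unfolding definable_def using D_prod[OF A(1) B(1)]
    by (intro exI[of _ "vs @ ws"] bexI[of _ "{zs. length zs = length vs + length ws \<and> take (length vs) zs \<in> A \<and> drop (length vs) zs \<in> B}"])
      (auto simp: vals_append A(2) B(2))
qed

lemma definable_disj: assumes "definable P" "definable Q" shows "definable (\<lambda>\<rho>. P \<rho> \<or> Q \<rho>)"
  using definable_not[OF definable_conj[OF definable_not[OF assms(1)] definable_not[OF assms(2)]]] by simp

lemma definable_imp: assumes "definable P" "definable Q" shows "definable (\<lambda>\<rho>. P \<rho> \<longrightarrow> Q \<rho>)"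
  using definable_disj[OF definable_not[OF assms(1)] assms(2)] by simp

lemma definable_const: "definable (\<lambda>\<rho>. b)"
  unfolding definable_def using D_tuples[of 0] D_empty[of 0]
  by (intro exI[of _ "[]"]) (cases b; auto simp: vals_def)

lemma definable_finite_all:
  assumes "\<And>i. i < (k::nat) \<Longrightarrow> definable (P i)" shows "definable (\<lambda>\<rho>. \<forall>i<k. P i \<rho>)"
  using assms
proof (induction k)
  case 0
  then show ?case by (simp add: definable_const)
next
  case (Suc k)
  have "definable (\<lambda>\<rho>. (\<forall>i<k. P i \<rho>) \<and> P k \<rho>)" using Suc by (intro definable_conj) auto
  then show ?case by (rule definable_cong) (auto simp: less_Suc_eq)
qed

lemma definable_ex_list:
  assumes "definable (\<lambda>\<rho>. Q (block (\<rho> 0) n) (\<lambda>k. \<rho> (Suc k)))"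
  shows "definable (\<lambda>\<rho>. \<exists>y. length y = n \<and> Q y \<rho>)"
proof -
  have "(\<exists>f. Q (block (case_nat f \<rho> 0) n) (\<lambda>k. case_nat f \<rho> (Suc k))) \<longleftrightarrow> (\<exists>y. length y = n \<and> Q y \<rho>)" for \<rho>
    by simp (metis block_nth length_block)
  then show ?thesis using definable_block_ex[OF assms] by simp
qed

lemma definable_ex:
  assumes "definable (\<lambda>\<rho>. Q (\<rho> 0 0) (\<lambda>k. \<rho> (Suc k)))"
  shows "definable (\<lambda>\<rho>. \<exists>x. Q x \<rho>)"
proof -
  have "(\<exists>f. Q (case_nat f \<rho> 0 0) (\<lambda>k. case_nat f \<rho> (Suc k))) \<longleftrightarrow> (\<exists>x. Q x \<rho>)" for \<rho>
    by (auto intro: exI[of _ "\<lambda>_. x" for x])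
  then show ?thesis using definable_block_ex[OF assms] by simp
qed

lemma definable_all:
  assumes "definable (\<lambda>\<rho>. Q (\<rho> 0 0) (\<lambda>k. \<rho> (Suc k)))"
  shows "definable (\<lambda>\<rho>. \<forall>x. Q x \<rho>)"
  using definable_not[OF definable_ex[of "\<lambda>x \<rho>. \<not> Q x \<rho>"]] definable_not[OF assms] by simp

lemma definable_block_mem: "X \<in> D n \<Longrightarrow> definable (\<lambda>\<rho>. block (\<rho> i) n \<in> X)"
  unfolding definable_def by (intro exI[of _ "map (Pair i) [0..<n]"] bexI[of _ X]) (auto simp: vals_block)

lemma definable_bex:
  assumes "X \<in> D n" "definable (\<lambda>\<rho>. Q (block (\<rho> 0) n) (\<lambda>k. \<rho> (Suc k)))"
  shows "definable (\<lambda>\<rho>. \<exists>y\<in>X. Q y \<rho>)"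
proof -
  have "definable (\<lambda>\<rho>. \<exists>y. length y = n \<and> y \<in> X \<and> Q y \<rho>)"
    by (intro definable_ex_list definable_conj assms definable_block_mem)
  then show ?thesis by (rule definable_cong) (use D_length[OF assms(1)] in blast)
qed

lemma definable_ball:
  assumes "X \<in> D n" "definable (\<lambda>\<rho>. Q (block (\<rho> 0) n) (\<lambda>k. \<rho> (Suc k)))"
  shows "definable (\<lambda>\<rho>. \<forall>y\<in>X. Q y \<rho>)"
  using definable_not[OF definable_bex[OF assms(1), of "\<lambda>x \<rho>. \<not> Q x \<rho>"]] definable_not[OF assms(2)] by simp

section \<open>Definable terms and substitution\<close>

definition definable_list :: "nat \<Rightarrow> ((nat \<Rightarrow> nat \<Rightarrow> 'a) \<Rightarrow> 'a list) \<Rightarrow> bool" where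
  "definable_list n t \<longleftrightarrow> (\<forall>\<rho>. length (t \<rho>) = n) \<and> definable (\<lambda>\<rho>. block (\<rho> 0) n = t (\<lambda>k. \<rho> (Suc k)))"

text \<open>A term is represented by its graph, with variable 0 holding the value and all other
  blocks shifted; substituting it into a condition is then an existential quantifier over the
  value.\<close>

definition definable_term :: "((nat \<Rightarrow> nat \<Rightarrow> 'a) \<Rightarrow> 'a) \<Rightarrow> bool" where
  "definable_term s \<longleftrightarrow> definable (\<lambda>\<rho>. \<rho> 0 0 = s (\<lambda>k. \<rho> (Suc k)))"

lemma definable_var_eq: "definable (\<lambda>\<rho>. \<rho> i j = \<rho> i' j')"
  unfolding definable_def using D_diag[of 0 2 1]
  by (intro exI[of _ "[(i, j), (i', j')]"] bexI[of _ "{xs. length xs = 2 \<and> xs ! 0 = xs ! 1}"]) (auto simp: vals_def numeral_2_eq_2)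

lemma definable_list_subst:
  assumes "definable_list n t" "definable (\<lambda>\<rho>. Q (block (\<rho> 0) n) (\<lambda>k. \<rho> (Suc k)))"
  shows "definable (\<lambda>\<rho>. Q (t \<rho>) \<rho>)"
proof -
  have "definable (\<lambda>\<rho>. \<exists>y. length y = n \<and> y = t \<rho> \<and> Q y \<rho>)"
    using assms by (intro definable_ex_list definable_conj) (auto simp: definable_list_def)
  then show ?thesis by (rule definable_cong) (use assms(1) in \<open>auto simp: definable_list_def\<close>)
qed

lemma definable_subst:
  assumes "definable_term s" "definable (\<lambda>\<rho>. Q (\<rho> 0 0) (\<lambda>k. \<rho> (Suc k)))"
  shows "definable (\<lambda>\<rho>. Q (s \<rho>) \<rho>)"
proof -
  have "definable (\<lambda>\<rho>. \<exists>y. y = s \<rho> \<and> Q y \<rho>)"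
    using assms by (intro definable_ex definable_conj) (auto simp: definable_term_def)
  then show ?thesis by simp
qed

lemma definable_term_shift: "definable_term s \<Longrightarrow> definable_term (\<lambda>\<rho>. s (\<lambda>k. \<rho> (Suc k)))"
  unfolding definable_term_def by (drule definable_rename[where f = "case_nat 0 (\<lambda>k. Suc (Suc k))"]) simp

lemma definable_list_shift: "definable_list n t \<Longrightarrow> definable_list n (\<lambda>\<rho>. t (\<lambda>k. \<rho> (Suc k)))"
  unfolding definable_list_def
  by (elim conjE, drule definable_rename[where f = "case_nat 0 (\<lambda>k. Suc (Suc k))"]) simp

lemma definable_term_var: "definable_term (\<lambda>\<rho>. \<rho> i 0)"
  unfolding definable_term_def by (rule definable_var_eq)

lemma definable_list_Nil: "definable_list 0 (\<lambda>\<rho>. [])"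
  by (simp add: definable_list_def block_def definable_const)

lemma definable_list_block: "definable_list n (\<lambda>\<rho>. block (\<rho> i) n)"
proof -
  have "definable (\<lambda>\<rho>. \<forall>j<n. \<rho> 0 j = \<rho> (Suc i) j)" by (intro definable_finite_all definable_var_eq)
  then show ?thesis by (simp add: definable_list_def list_eq_iff_nth_eq)
qed

lemma definable_list_Cons:
  assumes "definable_term s" "definable_list n t" shows "definable_list (Suc n) (\<lambda>\<rho>. s \<rho> # t \<rho>)"
proof -
  have "definable (\<lambda>\<rho>. \<rho> (Suc (Suc 0)) 0 = \<rho> (Suc 0) 0 \<and> (\<forall>j<n. \<rho> (Suc (Suc 0)) (Suc j) = \<rho> 0 j))"
    by (intro definable_conj definable_finite_all definable_var_eq)
  then have "definable (\<lambda>\<rho>. block (\<rho> (Suc (Suc 0))) (Suc n) = \<rho> (Suc 0) 0 # block (\<rho> 0) n)"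
    by (rule definable_cong) (auto simp: list_eq_iff_nth_eq nth_Cons less_Suc_eq_0_disj split: nat.splits)
  then have "definable (\<lambda>\<rho>. block (\<rho> (Suc 0)) (Suc n) = \<rho> 0 0 # t (\<lambda>k. \<rho> (Suc (Suc k))))"
    using definable_list_subst[OF definable_list_shift[OF definable_list_shift[OF assms(2)]], of "\<lambda>y \<rho>. block (\<rho> (Suc 0)) (Suc n) = \<rho> 0 0 # y"]
    by simp
  then have "definable (\<lambda>\<rho>. block (\<rho> 0) (Suc n) = s (\<lambda>k. \<rho> (Suc k)) # t (\<lambda>k. \<rho> (Suc k)))"
    using definable_subst[OF definable_term_shift[OF assms(1)], of "\<lambda>x \<rho>. block (\<rho> 0) (Suc n) = x # t (\<lambda>k. \<rho> (Suc k))"] by simp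
  then show ?thesis using assms(2) by (simp add: definable_list_def)
qed

lemma definable_list_append:
  assumes "definable_list m s" "definable_list n t" shows "definable_list (m + n) (\<lambda>\<rho>. s \<rho> @ t \<rho>)"
proof -
  have "definable (\<lambda>\<rho>. (\<forall>j<m. \<rho> (Suc (Suc 0)) j = \<rho> (Suc 0) j) \<and> (\<forall>j<n. \<rho> (Suc (Suc 0)) (m + j) = \<rho> 0 j))"
    by (intro definable_conj definable_finite_all definable_var_eq)
  then have "definable (\<lambda>\<rho>. block (\<rho> (Suc (Suc 0))) (m + n) = block (\<rho> (Suc 0)) m @ block (\<rho> 0) n)"
  proof (rule definable_cong)
    fix \<rho> :: "nat \<Rightarrow> nat \<Rightarrow> 'a"
    have eq: "block (\<rho> (Suc (Suc 0))) (m + n) = block (\<rho> (Suc (Suc 0))) m @ block (\<lambda>j. \<rho> (Suc (Suc 0)) (m + j)) n"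
      by (auto simp: list_eq_iff_nth_eq nth_append)
    show "((\<forall>j<m. \<rho> (Suc (Suc 0)) j = \<rho> (Suc 0) j) \<and> (\<forall>j<n. \<rho> (Suc (Suc 0)) (m + j) = \<rho> 0 j)) =
       (block (\<rho> (Suc (Suc 0))) (m + n) = block (\<rho> (Suc 0)) m @ block (\<rho> 0) n)"
      unfolding eq by (simp add: append_eq_append_conv) (simp add: list_eq_iff_nth_eq)
  qed
  then have "definable (\<lambda>\<rho>. block (\<rho> (Suc 0)) (m + n) = block (\<rho> 0) m @ t (\<lambda>k. \<rho> (Suc (Suc k))))"
    using definable_list_subst[OF definable_list_shift[OF definable_list_shift[OF assms(2)]], of "\<lambda>y \<rho>. block (\<rho> (Suc 0)) (m + n) = block (\<rho> 0) m @ y"]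
    by simp
  then have "definable (\<lambda>\<rho>. block (\<rho> 0) (m + n) = s (\<lambda>k. \<rho> (Suc k)) @ t (\<lambda>k. \<rho> (Suc k)))"
    using definable_list_subst[OF definable_list_shift[OF assms(1)], of "\<lambda>x \<rho>. block (\<rho> 0) (m + n) = x @ t (\<lambda>k. \<rho> (Suc k))"] by simp
  then show ?thesis using assms by (simp add: definable_list_def)
qed

lemma definable_term_nth: assumes "definable_list n t" "j < n" shows "definable_term (\<lambda>\<rho>. t \<rho> ! j)"
proof -
  have "definable (\<lambda>\<rho>. \<rho> (Suc 0) 0 = block (\<rho> 0) n ! j)" using assms(2) by (simp add: definable_var_eq)
  then show ?thesis unfolding definable_term_def
    using definable_list_subst[OF definable_list_shift[OF assms(1)], of "\<lambda>x \<rho>. \<rho> 0 0 = x ! j"] by simp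
qed

lemma definable_mem: "definable_list n t \<Longrightarrow> X \<in> D n' \<Longrightarrow> n' = n \<Longrightarrow> definable (\<lambda>\<rho>. t \<rho> \<in> X)"
  using definable_list_subst[of n t "\<lambda>x \<rho>. x \<in> X"] definable_block_mem by simp

lemma definable_list_eq: assumes "definable_list n s" "definable_list m t" shows "definable (\<lambda>\<rho>. s \<rho> = t \<rho>)"
proof (cases "n = m")
  case True
  then have "definable (\<lambda>\<rho>. block (\<rho> 0) n = t (\<lambda>k. \<rho> (Suc k)))"
    using assms(2) by (simp add: definable_list_def)
  then show ?thesis using definable_list_subst[OF assms(1), of "\<lambda>x \<rho>. x = t \<rho>"] by simp
next
  case False
  then have "s \<rho> \<noteq> t \<rho>" for \<rho> using assms unfolding definable_list_def by metis
  then show ?thesis by (simp add: definable_const)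
qed

lemma definable_eq: assumes "definable_term s" "definable_term t" shows "definable (\<lambda>\<rho>. s \<rho> = t \<rho>)"
  using definable_list_eq[OF definable_list_Cons[OF assms(1) definable_list_Nil] definable_list_Cons[OF assms(2) definable_list_Nil]] by simp

lemma definable_less: assumes "definable_term s" "definable_term t" shows "definable (\<lambda>\<rho>. s \<rho> < t \<rho>)"
proof -
  have "{[x, y] | x y. x < y} \<in> D 2" using expansion by (simp add: expansion_structure_def)
  from definable_mem[OF definable_list_Cons[OF assms(1) definable_list_Cons[OF assms(2) definable_list_Nil]] this] show ?thesis by simp
qed

lemma definable_le: assumes "definable_term s" "definable_term t" shows "definable (\<lambda>\<rho>. s \<rho> \<le> t \<rho>)"
  using definable_not[OF definable_less[OF assms(2,1)]] by (simp add: not_less)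

lemma definable_term_const: "definable_term (\<lambda>\<rho>. a)"
proof -
  have "{[a]} \<in> D 1" using expansion by (simp add: expansion_structure_def)
  from definable_mem[OF definable_list_Cons[OF definable_term_var[of 0] definable_list_Nil] this] show ?thesis by (simp add: definable_term_def)
qed

lemma definable_sum_eq: assumes "definable_term r" "definable_term s" "definable_term t" shows "definable (\<lambda>\<rho>. t \<rho> = r \<rho> + s \<rho>)"
proof -
  have "{[x, y, z] | x y z. z = x + y} \<in> D 3" using expansion by (simp add: expansion_structure_def)
  from definable_mem[OF definable_list_Cons[OF assms(1) definable_list_Cons[OF assms(2) definable_list_Cons[OF assms(3) definable_list_Nil]]] this]
  show ?thesis by simp
qed

lemma definable_term_plus: "definable_term s \<Longrightarrow> definable_term t \<Longrightarrow> definable_term (\<lambda>\<rho>. s \<rho> + t \<rho>)"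
  unfolding definable_term_def[of "\<lambda>\<rho>. s \<rho> + t \<rho>"] by (intro definable_sum_eq definable_term_shift definable_term_var)

lemma definable_term_minus: assumes "definable_term s" "definable_term t" shows "definable_term (\<lambda>\<rho>. s \<rho> - t \<rho>)"
  unfolding definable_term_def[of "\<lambda>\<rho>. s \<rho> - t \<rho>"]
  by (rule definable_cong[OF definable_sum_eq[OF definable_term_var[of 0] definable_term_shift[OF assms(2)] definable_term_shift[OF assms(1)]]])
     (auto simp: algebra_simps)

lemma definable_term_uminus: assumes "definable_term s" shows "definable_term (\<lambda>\<rho>. - s \<rho>)"
  using definable_term_minus[OF definable_term_const[of 0] assms] by simp

lemma definable_list_const: "length xs = n \<Longrightarrow> definable_list n (\<lambda>\<rho>. xs)"
  by (induction xs arbitrary: n) (auto intro: definable_list_Nil definable_list_Cons definable_term_const)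

text \<open>Syntax-directed closure rules: higher-order unification lets them follow the structure
  of a formula written directly in HOL, so that no separate syntax of formulas is involved.\<close>

lemmas definable_intros = definable_not definable_conj definable_disj definable_imp definable_ex definable_all definable_bex definable_ball
  definable_list_eq definable_eq definable_less definable_le definable_mem
  definable_term_var definable_term_const definable_term_plus definable_term_minus definable_term_uminus definable_list_block definable_list_Nil definable_list_Cons definable_list_append definable_list_const

end

subsection \<open>Definable subsets of the line\<close>

definition has_int :: "'a::linorder set \<Rightarrow> bool" where
  "has_int S \<longleftrightarrow> (\<exists>p q. p < q \<and> {p<..<q} \<subseteq> S)"

lemma has_int_mono: "has_int S \<Longrightarrow> S \<subseteq> T \<Longrightarrow> has_int T"
  unfolding has_int_def by blast

lemma has_intI: "p < q \<Longrightarrow> (\<And>x. p < x \<Longrightarrow> x < q \<Longrightarrow> x \<in> S) \<Longrightarrow> has_int S"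
  unfolding has_int_def by fastforce

lemma has_intE:
  assumes "has_int S" obtains p q where "p < q" "\<And>x. p < x \<Longrightarrow> x < q \<Longrightarrow> x \<in> S"
  using assms unfolding has_int_def by (meson greaterThanLessThan_iff subsetD)

text \<open>The one-sided germ form of local o-minimality. Points and intervals have the property
  and finite unions keep it, which carries it over to every definable subset of the line.\<close>

definition right_decided :: "'a::linorder \<Rightarrow> 'a set \<Rightarrow> bool" where
  "right_decided a S \<longleftrightarrow> (\<exists>e>a. {a<..<e} \<subseteq> S \<or> {a<..<e} \<inter> S = {})"

definition left_decided :: "'a::linorder \<Rightarrow> 'a set \<Rightarrow> bool" where
  "left_decided a S \<longleftrightarrow> (\<exists>e<a. {e<..<a} \<subseteq> S \<or> {e<..<a} \<inter> S = {})"

lemma right_decided_Un: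
  assumes "right_decided a S" "right_decided a T" shows "right_decided a (S \<union> T)"
proof -
  obtain e where e: "e > a" "{a<..<e} \<subseteq> S \<or> {a<..<e} \<inter> S = {}"
    using assms(1) unfolding right_decided_def by blast
  obtain f where f: "f > a" "{a<..<f} \<subseteq> T \<or> {a<..<f} \<inter> T = {}"
    using assms(2) unfolding right_decided_def by blast
  have "{a<..<min e f} \<subseteq> {a<..<e}" "{a<..<min e f} \<subseteq> {a<..<f}" by auto
  then have "{a<..<min e f} \<subseteq> S \<union> T \<or> {a<..<min e f} \<inter> (S \<union> T) = {}" using e f by blast
  then show ?thesis using e f unfolding right_decided_def by (intro exI[of _ "min e f"]) auto
qed

lemma left_decided_Un:
  assumes "left_decided a S" "left_decided a T" shows "left_decided a (S \<union> T)"
proof -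
  obtain e where e: "e < a" "{e<..<a} \<subseteq> S \<or> {e<..<a} \<inter> S = {}"
    using assms(1) unfolding left_decided_def by blast
  obtain f where f: "f < a" "{f<..<a} \<subseteq> T \<or> {f<..<a} \<inter> T = {}"
    using assms(2) unfolding left_decided_def by blast
  have "{max e f<..<a} \<subseteq> {e<..<a}" "{max e f<..<a} \<subseteq> {f<..<a}" by auto
  then have "{max e f<..<a} \<subseteq> S \<union> T \<or> {max e f<..<a} \<inter> (S \<union> T) = {}" using e f by blast
  then show ?thesis using e f unfolding left_decided_def by (intro exI[of _ "max e f"]) auto
qed

lemma right_decided_interval: "right_decided (a::'a::{linorder,no_top}) {p<..<q}"
proof -
  obtain b where b: "b > a" using gt_ex by blast
  consider "q \<le> a" | "a < q" "p \<le> a" | "a < p" by fastforce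
  then show ?thesis
  proof cases
    case 1
    then have "{a<..<b} \<inter> {p<..<q} = {}" by auto
    then show ?thesis using b unfolding right_decided_def by blast
  next
    case 2
    then have "{a<..<q} \<subseteq> {p<..<q}" by auto
    then show ?thesis using 2 unfolding right_decided_def by blast
  next
    case 3
    then have "{a<..<p} \<inter> {p<..<q} = {}" by auto
    then show ?thesis using 3 unfolding right_decided_def by blast
  qed
qed

lemma left_decided_interval: "left_decided (a::'a::{linorder,no_bot}) {p<..<q}"
proof -
  obtain b where b: "b < a" using lt_ex by blast
  consider "a \<le> p" | "p < a" "a \<le> q" | "q < a" by fastforce
  then show ?thesis
  proof cases
    case 1
    then have "{b<..<a} \<inter> {p<..<q} = {}" by auto
    then show ?thesis using b unfolding left_decided_def by blast
  next
    case 2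
    then have "{p<..<a} \<subseteq> {p<..<q}" by auto
    then show ?thesis using 2 unfolding left_decided_def by blast
  next
    case 3
    then have "{q<..<a} \<inter> {p<..<q} = {}" by auto
    then show ?thesis using 3 unfolding left_decided_def by blast
  qed
qed

lemma right_decided_finite:
  fixes a :: "'a::{linorder,no_top}"
  assumes "finite P" shows "right_decided a P"
  using assms
proof (induction P rule: finite_induct)
  case empty
  obtain b where b: "b > a" using gt_ex by blast
  then show ?case by (auto simp: right_decided_def)
next
  case (insert p P)
  obtain b where b: "b > a" using gt_ex by blast
  have "right_decided a {p}" unfolding right_decided_def
    by (rule exI[of _ "if a < p then p else b"]) (use b in auto)
  then show ?case using right_decided_Un[of a "{p}" P] insert.IH by simp
qed

lemma left_decided_finite:
  fixes a :: "'a::{linorder,no_bot}"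
  assumes "finite P" shows "left_decided a P"
  using assms
proof (induction P rule: finite_induct)
  case empty
  obtain b where b: "b < a" using lt_ex by blast
  then show ?case by (auto simp: left_decided_def)
next
  case (insert p P)
  obtain b where b: "b < a" using lt_ex by blast
  have "left_decided a {p}" unfolding left_decided_def
    by (rule exI[of _ "if p < a then p else b"]) (use b in auto)
  then show ?case using left_decided_Un[of a "{p}" P] insert.IH by simp
qed

lemma decided_finite_Union:
  fixes a :: "'a::{linorder,no_top,no_bot}"
  assumes "finite J"
  shows "right_decided a (\<Union>(p, q)\<in>J. {p<..<q})" "left_decided a (\<Union>(p, q)\<in>J. {p<..<q})"
  using assms
proof (induction J rule: finite_induct)
  case empty
  { case 1 then show ?case using right_decided_finite[of "{}"] by simp }
  { case 2 then show ?case using left_decided_finite[of "{}"] by simp }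
next
  case (insert j J)
  { case 1 then show ?case using right_decided_Un[OF right_decided_interval insert.IH(1)] by (cases j) simp }
  { case 2 then show ?case using left_decided_Un[OF left_decided_interval insert.IH(2)] by (cases j) simp }
qed

text \<open>Halves need not exist in an ordered group; for \<open>x\<close> strictly between 0 and
  \<open>e\<close>, the smaller of \<open>x\<close> and \<open>e - x\<close> serves instead. Three
  summands are what a chain of three \<open>near\<close> steps consumes.\<close>

lemma ex_triple_le:
  fixes e :: "'a::{linordered_ab_group_add, dense_linorder, no_top}"
  assumes "0 < e" shows "\<exists>d>0. d + d + d \<le> e"
proof -
  have half: "\<exists>d>0. d + d \<le> e" if "0 < e" for e :: 'a
  proof -
    obtain x where x: "0 < x" "x < e" using dense[OF \<open>0 < e\<close>] by blast
    have "min x (e - x) + min x (e - x) \<le> x + (e - x)" by (intro add_mono) auto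
    then show ?thesis using x by (intro exI[of _ "min x (e - x)"]) auto
  qed
  obtain d where d: "0 < d" "d + d \<le> e" using half[OF assms] by blast
  obtain c where c: "0 < c" "c + c \<le> d" using half[OF d(1)] by blast
  have "c \<le> d" using c by (meson add_increasing le_cases less_imp_le order.trans order_refl)
  then have "c + c + c \<le> d + d" using c by (intro add_mono) auto
  then show ?thesis using c d by (meson order.trans)
qed

context definable_structure
begin

definition definable1 :: "('a \<Rightarrow> bool) \<Rightarrow> bool" where
  "definable1 P \<longleftrightarrow> definable (\<lambda>\<rho>. P (\<rho> 0 0))"

definition definable2 :: "('a \<Rightarrow> 'a \<Rightarrow> bool) \<Rightarrow> bool" where
  "definable2 P \<longleftrightarrow> definable (\<lambda>\<rho>. P (\<rho> 0 0) (\<rho> (Suc 0) 0))"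

definition definable_fun :: "('a \<Rightarrow> 'a) \<Rightarrow> bool" where
  "definable_fun f \<longleftrightarrow> definable_term (\<lambda>\<rho>. f (\<rho> 0 0))"

lemma definable1_app: "definable1 P \<Longrightarrow> definable_term s \<Longrightarrow> definable (\<lambda>\<rho>. P (s \<rho>))"
  unfolding definable1_def using definable_subst[of s "\<lambda>x \<rho>. P x"] by simp

lemma definable2_app: assumes "definable2 P" "definable_term s" "definable_term t" shows "definable (\<lambda>\<rho>. P (s \<rho>) (t \<rho>))"
proof -
  have "definable (\<lambda>\<rho>. P (s (\<lambda>k. \<rho> (Suc k))) (\<rho> 0 0))"
    using definable_subst[OF definable_term_shift[OF assms(2)], of "\<lambda>x \<rho>. P x (\<rho> 0 0)"] assms(1) by (simp add: definable2_def)
  then show ?thesis using definable_subst[OF assms(3), of "\<lambda>y \<rho>. P (s \<rho>) y"] by simp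
qed

lemma definable_fun_app: assumes "definable_fun f" "definable_term s" shows "definable_term (\<lambda>\<rho>. f (s \<rho>))"
proof -
  have "definable (\<lambda>\<rho>. \<rho> (Suc 0) 0 = f (\<rho> 0 0))"
    using assms(1) definable_rename[of "\<lambda>\<rho>. \<rho> 0 0 = f (\<rho> (Suc 0) 0)" "\<lambda>i. if i = 0 then 1 else 0"]
    by (simp add: definable_fun_def definable_term_def)
  then show ?thesis unfolding definable_term_def
    using definable_subst[OF definable_term_shift[OF assms(2)], of "\<lambda>x \<rho>. \<rho> 0 0 = f x"] by simp
qed

lemma D_of_definable1: "definable1 P \<Longrightarrow> {x. length x = 1 \<and> P (x ! 0)} \<in> D 1"
  by (rule D_of_definable) (simp add: definable1_def)

lemma definable2_fix1: "definable2 P \<Longrightarrow> definable1 (P a)"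
  unfolding definable1_def using definable2_app[OF _ definable_term_const[of a] definable_term_var] .

lemma definable2_flip: "definable2 P \<Longrightarrow> definable2 (\<lambda>x y. P y x)"
  unfolding definable2_def[of "\<lambda>x y. P y x"] by (rule definable2_app) (assumption | rule definable_term_var)+

end

text \<open>A relation rather than an operator: extrema are guaranteed for definable predicates
  only, and the relation can be written out inside a definable condition.\<close>

definition is_inf :: "('a::linorder \<Rightarrow> bool) \<Rightarrow> 'a \<Rightarrow> bool" where
  "is_inf P m \<longleftrightarrow> (\<forall>x. P x \<longrightarrow> m \<le> x) \<and> (\<forall>b. (\<forall>x. P x \<longrightarrow> b \<le> x) \<longrightarrow> b \<le> m)"

definition is_sup :: "('a::linorder \<Rightarrow> bool) \<Rightarrow> 'a \<Rightarrow> bool" where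
  "is_sup P m \<longleftrightarrow> (\<forall>x. P x \<longrightarrow> x \<le> m) \<and> (\<forall>b. (\<forall>x. P x \<longrightarrow> x \<le> b) \<longrightarrow> m \<le> b)"

lemma is_inf_unique: "is_inf P m \<Longrightarrow> is_inf P m' \<Longrightarrow> m = m'"
  unfolding is_inf_def by (meson order.antisym)

lemma is_sup_unique: "is_sup P m \<Longrightarrow> is_sup P m' \<Longrightarrow> m = m'"
  unfolding is_sup_def by (meson order.antisym)

locale tame_structure = definable_structure D
  for D :: "nat \<Rightarrow> ('a::{linordered_ab_group_add, dense_linorder, no_top, no_bot}) list set set" +
  assumes locally_o_minimal: "locally_o_minimal D"
    and definably_complete: "definably_complete D"
begin

section \<open>Extrema and germs of definable predicates\<close>

lemma ex_inf:
  assumes "definable1 P" "P x" "\<And>x. P x \<Longrightarrow> b \<le> x" shows "\<exists>m. is_inf P m"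
proof -
  have eq: "{y. [y] \<in> {x. length x = 1 \<and> P (x ! 0)}} = Collect P" by auto
  have "Collect P \<noteq> {} \<and> (\<exists>b. \<forall>x\<in>Collect P. b \<le> x) \<longrightarrow>
    (\<exists>s. (\<forall>x\<in>Collect P. s \<le> x) \<and> (\<forall>b. (\<forall>x\<in>Collect P. b \<le> x) \<longrightarrow> b \<le> s))"
    using bspec[OF definably_complete[unfolded definably_complete_def] D_of_definable1[OF assms(1)]]
    unfolding Let_def eq by (rule conjunct2)
  moreover have "Collect P \<noteq> {} \<and> (\<exists>b. \<forall>x\<in>Collect P. b \<le> x)" using assms(2,3) by blast
  ultimately show ?thesis unfolding is_inf_def by auto
qed

lemma ex_sup:
  assumes "definable1 P" "P x" "\<And>x. P x \<Longrightarrow> x \<le> b" shows "\<exists>m. is_sup P m"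
proof -
  have eq: "{y. [y] \<in> {x. length x = 1 \<and> P (x ! 0)}} = Collect P" by auto
  have "Collect P \<noteq> {} \<and> (\<exists>b. \<forall>x\<in>Collect P. x \<le> b) \<longrightarrow>
    (\<exists>s. (\<forall>x\<in>Collect P. x \<le> s) \<and> (\<forall>b. (\<forall>x\<in>Collect P. x \<le> b) \<longrightarrow> s \<le> b))"
    using bspec[OF definably_complete[unfolded definably_complete_def] D_of_definable1[OF assms(1)]]
    unfolding Let_def eq by (rule conjunct1)
  moreover have "Collect P \<noteq> {} \<and> (\<exists>b. \<forall>x\<in>Collect P. x \<le> b)" using assms(2,3) by blast
  ultimately show ?thesis unfolding is_sup_def by auto
qed

lemma decided:
  assumes "definable1 P" shows "right_decided a (Collect P)" "left_decided a (Collect P)"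
proof -
  obtain l u F J where *: "l < a" "a < u" "finite F" "finite J"
    "{x. [x] \<in> {x. length x = 1 \<and> P (x ! 0)}} \<inter> {l<..<u} = F \<union> (\<Union>(p, q)\<in>J. {p<..<q})"
    using locally_o_minimal D_of_definable1[OF assms] unfolding locally_o_minimal_def by meson
  have eq: "Collect P \<inter> {l<..<u} = F \<union> (\<Union>(p, q)\<in>J. {p<..<q})" using *(5) by simp
  have "right_decided a (Collect P \<inter> {l<..<u})" "left_decided a (Collect P \<inter> {l<..<u})"
    unfolding eq using * by (auto intro: right_decided_Un left_decided_Un right_decided_finite
        left_decided_finite decided_finite_Union)
  then obtain e f where e: "e > a" "{a<..<e} \<subseteq> Collect P \<inter> {l<..<u} \<or> {a<..<e} \<inter> (Collect P \<inter> {l<..<u}) = {}"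
    and f: "f < a" "{f<..<a} \<subseteq> Collect P \<inter> {l<..<u} \<or> {f<..<a} \<inter> (Collect P \<inter> {l<..<u}) = {}"
    unfolding right_decided_def left_decided_def by blast
  have "{a<..<min e u} \<subseteq> {a<..<e} \<inter> {l<..<u}" using *(1) by auto
  then have "{a<..<min e u} \<subseteq> Collect P \<or> {a<..<min e u} \<inter> Collect P = {}" using e by blast
  then show "right_decided a (Collect P)" unfolding right_decided_def
    by (intro exI[of _ "min e u"]) (use e * in auto)
  have "{max f l<..<a} \<subseteq> {f<..<a} \<inter> {l<..<u}" using *(2) by auto
  then have "{max f l<..<a} \<subseteq> Collect P \<or> {max f l<..<a} \<inter> Collect P = {}" using f by blast
  then show "left_decided a (Collect P)" unfolding left_decided_def
    by (intro exI[of _ "max f l"]) (use f * in auto)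
qed

lemma right_germ:
  assumes "definable1 P"
  obtains e where "a < e" "\<And>x. a < x \<Longrightarrow> x < e \<Longrightarrow> P x" | e where "a < e" "\<And>x. a < x \<Longrightarrow> x < e \<Longrightarrow> \<not> P x"
proof -
  obtain e where e: "e > a" "{a<..<e} \<subseteq> Collect P \<or> {a<..<e} \<inter> Collect P = {}"
    using decided(1)[OF assms] unfolding right_decided_def by blast
  show ?thesis
  proof (cases "{a<..<e} \<subseteq> Collect P")
    case True
    then have "\<And>x. a < x \<Longrightarrow> x < e \<Longrightarrow> P x" by auto
    then show ?thesis by (rule that(1)[OF e(1)])
  next
    case False
    then have "{a<..<e} \<inter> Collect P = {}" using e(2) by blast
    then have "\<And>x. a < x \<Longrightarrow> x < e \<Longrightarrow> \<not> P x" by auto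
    then show ?thesis by (rule that(2)[OF e(1)])
  qed
qed

text \<open>The germ at a point cannot be full, hence it is empty. With \<open>no_int_left\<close>
  this makes a definable set without an interval closed and discrete.\<close>

lemma no_int_right:
  assumes "definable1 P" "\<not> has_int (Collect P)"
  obtains e where "a < e" "\<And>x. a < x \<Longrightarrow> x < e \<Longrightarrow> \<not> P x"
  by (rule right_germ[OF assms(1), of a]) (use assms(2) in \<open>auto intro: has_intI\<close>)

lemma no_int_left:
  assumes "definable1 P" "\<not> has_int (Collect P)"
  obtains e where "e < a" "\<And>x. e < x \<Longrightarrow> x < a \<Longrightarrow> \<not> P x"
proof -
  obtain e where e: "e < a" "{e<..<a} \<subseteq> Collect P \<or> {e<..<a} \<inter> Collect P = {}"
    using decided(2)[OF assms(1)] unfolding left_decided_def by blast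
  then have "{e<..<a} \<inter> Collect P = {}" using assms(2) unfolding has_int_def by blast
  then have "\<And>x. e < x \<Longrightarrow> x < a \<Longrightarrow> \<not> P x" by auto
  then show ?thesis by (rule that[OF e(1)])
qed

text \<open>Were the infimum \<open>m\<close> not attained, the gap between \<open>m\<close> and
  \<open>e\<close> would make \<open>e\<close> a larger lower bound.\<close>

lemma no_int_inf_attained:
  assumes "definable1 P" "\<not> has_int (Collect P)" "P x" "\<And>x. P x \<Longrightarrow> b \<le> x"
  obtains m where "P m" "\<And>x. P x \<Longrightarrow> m \<le> x"
proof -
  obtain m where m: "is_inf P m" using ex_inf[OF assms(1,3,4)] by blast
  obtain e where e: "m < e" "\<And>x. m < x \<Longrightarrow> x < e \<Longrightarrow> \<not> P x"
    using no_int_right[OF assms(1,2), of m] by blast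
  have "P m"
  proof (rule ccontr)
    assume "\<not> P m"
    then have "e \<le> x" if "P x" for x
      using m that e(2)[of x] unfolding is_inf_def by (metis le_less not_le)
    then show False using m e(1) unfolding is_inf_def by (meson not_le)
  qed
  then show ?thesis using that m unfolding is_inf_def by blast
qed

text \<open>Only the germ of \<open>P\<close> at the left endpoint \<open>p\<close> is inspected; if
  it is empty, \<open>Q\<close> holds on a whole right neighbourhood.\<close>

lemma interval_split:
  assumes "definable1 P" "p < q" "\<And>x. p < x \<Longrightarrow> x < q \<Longrightarrow> P x \<or> Q x"
  shows "\<exists>p' q'. p \<le> p' \<and> p' < q' \<and> q' \<le> q \<and>
    ((\<forall>x. p' < x \<and> x < q' \<longrightarrow> P x) \<or> (\<forall>x. p' < x \<and> x < q' \<longrightarrow> Q x))"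
proof (rule right_germ[OF assms(1), of p])
  fix e assume "p < e" "\<And>x. p < x \<Longrightarrow> x < e \<Longrightarrow> P x"
  then show ?thesis using assms(2) by (intro exI[of _ p] exI[of _ "min e q"]) auto
next
  fix e assume "p < e" "\<And>x. p < x \<Longrightarrow> x < e \<Longrightarrow> \<not> P x"
  then show ?thesis using assms(2,3) by (intro exI[of _ p] exI[of _ "min e q"]) auto
qed

lemma has_int_Un:
  assumes "definable1 P" "has_int {x. P x \<or> Q x}" shows "has_int {x. P x} \<or> has_int {x. Q x}"
proof -
  obtain p q where "p < q" "\<And>x. p < x \<Longrightarrow> x < q \<Longrightarrow> P x \<or> Q x"
    using assms(2) by (auto elim!: has_intE)
  from interval_split[OF assms(1) this] show ?thesis
    by (metis (mono_tags, lifting) has_intI mem_Collect_eq)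
qed

text \<open>
  A Baire property. If no \<open>X d\<close> contains an interval, each of them is closed and discrete, and the
  points that come first in some \<open>X d\<close> to the right of \<open>a\<close> accumulate at \<open>a\<close>. By local
  o-minimality they fill an interval \<open>(a, e)\<close>, on which two neighbouring points contradict each
  other.
\<close>

lemma uniform_parameter:
  assumes X: "definable2 X" and mono: "\<And>d d' y. 0 < d' \<Longrightarrow> d' \<le> d \<Longrightarrow> X d y \<Longrightarrow> X d' y"
    and pq: "p < q" and cov: "\<And>y. p < y \<Longrightarrow> y < q \<Longrightarrow> \<exists>d>0. X d y"
  shows "\<exists>d>0. \<exists>p' q'. p \<le> p' \<and> p' < q' \<and> q' \<le> q \<and> (\<forall>y. p' < y \<and> y < q' \<longrightarrow> X d y)"
proof (rule ccontr)
  assume neg: "\<not> ?thesis"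
  define Y where "Y d y \<longleftrightarrow> X d y \<and> p < y \<and> y < q" for d y
  have Y1: "definable1 (Y d)" for d
    unfolding definable1_def Y_def by (intro definable_intros definable2_app[OF X])
  have Y0: "\<not> has_int (Collect (Y d))" if d: "0 < d" for d
  proof
    assume "has_int (Collect (Y d))"
    then obtain p' q' where *: "p' < q'" "\<And>x. p' < x \<Longrightarrow> x < q' \<Longrightarrow> Y d x" by (auto elim: has_intE)
    then have "{p'<..<q'} \<subseteq> {p<..<q}" by (auto simp: Y_def)
    then have "p \<le> p'" "q' \<le> q" using *(1) greaterThanLessThan_subseteq_greaterThanLessThan by blast+
    then show False using neg d * unfolding Y_def by blast
  qed
  have gap: "\<exists>e>a. \<forall>y. a < y \<and> y < e \<longrightarrow> \<not> Y d y" if "0 < d" for d a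
    using no_int_right[OF Y1 Y0[OF that], of a] by metis
  obtain a where a: "p < a" "a < q" using dense[OF pq] by blast
  define G where "G y \<longleftrightarrow> a < y \<and> y < q \<and> (\<exists>d. 0 < d \<and> X d y \<and> (\<forall>y'. a < y' \<and> y' < y \<longrightarrow> \<not> X d y'))" for y
  have G1: "definable1 G"
    unfolding definable1_def G_def by (intro definable_intros definable2_app[OF X])
  have acc: "\<exists>y. a < y \<and> y < c \<and> G y" if "a < c" for c
  proof -
    obtain y where y: "a < y" "y < min c q" using dense[of a "min c q"] a \<open>a < c\<close> by auto
    then obtain d where d: "0 < d" "X d y" using cov[of y] a order.strict_trans[of p a y] by auto
    \<comment> \<open>A set without an interval attains its infimum, so \<open>X d\<close> has a
      first point in \<open>(a, y]\<close>, and this point satisfies \<open>G\<close>.\<close>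
    let ?P = "\<lambda>z. a < z \<and> z \<le> y \<and> X d z"
    have P1: "definable1 ?P" unfolding definable1_def by (intro definable_intros definable2_app[OF X])
    have sub: "Collect ?P \<subseteq> Collect (Y d)" using y a by (auto simp: Y_def)
    obtain m where m: "?P m" "\<And>z. ?P z \<Longrightarrow> m \<le> z"
      using no_int_inf_attained[OF P1, of y a] sub Y0[OF d(1)] y d has_int_mono by (metis (no_types, lifting) less_imp_le order_refl)
    have "\<not> X d y'" if "a < y'" "y' < m" for y'
      using m(2)[of y'] that m(1) by (meson le_less_trans less_imp_le not_le)
    then have "G m" using m(1) y d unfolding G_def by auto
    then show ?thesis using m(1) y by auto
  qed
  obtain e where e: "a < e" "\<And>x. a < x \<Longrightarrow> x < e \<Longrightarrow> G x"
    using right_germ[OF G1, of a] acc by metis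
  obtain y where y: "a < y" "y < min e q" using dense[of a "min e q"] a e by auto
  obtain d where d: "0 < d" "X d y" using cov[of y] a y order.strict_trans[of p a y] by auto
  obtain f where f: "y < f" "\<And>z. y < z \<Longrightarrow> z < f \<Longrightarrow> \<not> Y d z" using gap[OF d(1), of y] by blast
  obtain z where z: "y < z" "z < min f (min e q)" using dense[of y "min f (min e q)"] y f by auto
  have "G z" using e(2)[of z] y z by auto
  then obtain d' where d': "0 < d'" "X d' z" "\<not> X d' y" using y z unfolding G_def by blast
  \<comment> \<open>The sets grow as the parameter shrinks: \<open>y\<close> lies in
    \<open>X d\<close> but not in \<open>X d'\<close>, which forces \<open>d < d'\<close>. So
    \<open>z\<close> lies in \<open>X d\<close> as well, inside the gap to the right of
    \<open>y\<close>.\<close>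
  have "d < d'" using mono[of d' d y] d d' by (meson not_le)
  then have "X d z" using mono[of d d' z] d d' by auto
  then show False using f(2)[of z] z y a by (auto simp: Y_def)
qed

text \<open>If \<open>f\<close> keeps the value of some point just to its right, that piece is the
  interval. Otherwise, just to the right of each point, the values lie strictly above or strictly
  below the value at the point. One alternative holds throughout a subinterval, and a uniform width
  for it gives strict monotonicity on pieces no longer than that width.\<close>

lemma monotonicity:
  assumes f: "definable_fun f" and pq: "p < q"
  shows "\<exists>p' q'. p \<le> p' \<and> p' < q' \<and> q' \<le> q \<and>
    ((\<exists>c. \<forall>x. p' < x \<and> x < q' \<longrightarrow> f x = c) \<or>
     (\<forall>x y. p' < x \<and> x < y \<and> y < q' \<longrightarrow> f x < f y) \<or>
     (\<forall>x y. p' < x \<and> x < y \<and> y < q' \<longrightarrow> f y < f x))"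
proof (cases "\<exists>y e. p < y \<and> y < q \<and> y < e \<and> (\<forall>z. y < z \<and> z < e \<longrightarrow> f z = f y)")
  case True
  then obtain y e where "p < y" "y < q" "y < e" "\<forall>z. y < z \<and> z < e \<longrightarrow> f z = f y" by blast
  then show ?thesis by (intro exI[of _ y] exI[of _ "min e q"]) auto
next
  case False
  let ?gt = "\<lambda>y. \<exists>e. y < e \<and> (\<forall>z. y < z \<and> z < e \<longrightarrow> f y < f z)"
  let ?lt = "\<lambda>y. \<exists>e. y < e \<and> (\<forall>z. y < z \<and> z < e \<longrightarrow> f z < f y)"
  have cases: "?gt y \<or> ?lt y" if "p < y" "y < q" for y
  proof -
    have 1: "definable1 (\<lambda>z. f y < f z)" and 2: "definable1 (\<lambda>z. f z = f y)"
      unfolding definable1_def by (intro definable_intros definable_fun_app[OF f])+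
    have "?lt y" if ng: "\<not> ?gt y"
    proof -
      obtain e where e: "y < e" "\<And>z. y < z \<Longrightarrow> z < e \<Longrightarrow> \<not> f y < f z"
        using right_germ[OF 1, of y] ng by metis
      obtain e' where e': "y < e'" "\<And>z. y < z \<Longrightarrow> z < e' \<Longrightarrow> \<not> f z = f y"
        using right_germ[OF 2, of y] False that \<open>p < y\<close> \<open>y < q\<close> by metis
      show ?thesis
        by (rule exI[of _ "min e e'"]) (use e e' in \<open>auto simp: not_less le_less\<close>)
    qed
    then show ?thesis by blast
  qed
  have gt1: "definable1 ?gt" unfolding definable1_def by (intro definable_intros definable_fun_app[OF f])
  obtain p1 q1 where 1: "p \<le> p1" "p1 < q1" "q1 \<le> q" 
    "(\<forall>x. p1 < x \<and> x < q1 \<longrightarrow> ?gt x) \<or> (\<forall>x. p1 < x \<and> x < q1 \<longrightarrow> ?lt x)"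
    using interval_split[OF gt1 pq cases] by blast
  from 1(4) show ?thesis
  proof
    assume gt: "\<forall>x. p1 < x \<and> x < q1 \<longrightarrow> ?gt x"
    let ?X = "\<lambda>d y. \<forall>z. y < z \<and> z < y + d \<longrightarrow> f y < f z"
    have X: "definable2 ?X" unfolding definable2_def by (intro definable_intros definable_fun_app[OF f])
    have "\<exists>d>0. ?X d y" if "p1 < y" "y < q1" for y
    proof -
      obtain e where "y < e" "\<forall>z. y < z \<and> z < e \<longrightarrow> f y < f z" using gt \<open>p1 < y\<close> \<open>y < q1\<close> by blast
      then show ?thesis by (intro exI[of _ "e - y"]) auto
    qed
    moreover have "?X d' y" if "0 < d'" "d' \<le> d" "?X d y" for d d' y
      using that by (meson add_left_mono less_le_trans)
    ultimately obtain d p2 q2 where 2: "0 < d" "p1 \<le> p2" "p2 < q2" "q2 \<le> q1" "\<forall>y. p2 < y \<and> y < q2 \<longrightarrow> ?X d y"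
      using uniform_parameter[OF X _ 1(2)] by blast
    \<comment> \<open>On an interval of length at most \<open>d\<close>, every larger point is still
      within reach of \<open>x\<close>.\<close>
    have "f x < f y" if "p2 < x" "x < y" "y < min q2 (p2 + d)" for x y
    proof -
      have "p2 + d < x + d" using that by simp
      then have "y < x + d" using that(3) by (meson less_trans min_less_iff_conj)
      then show ?thesis using 2(5) that by (meson less_trans min_less_iff_conj)
    qed
    moreover have "p \<le> p2" "p2 < min q2 (p2 + d)" "min q2 (p2 + d) \<le> q"
      using 1(1-3) 2(1-4) by (auto intro: order.trans min.coboundedI1)
    ultimately show ?thesis by blast
  next
    assume lt: "\<forall>x. p1 < x \<and> x < q1 \<longrightarrow> ?lt x"
    let ?X = "\<lambda>d y. \<forall>z. y < z \<and> z < y + d \<longrightarrow> f z < f y"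
    have X: "definable2 ?X" unfolding definable2_def by (intro definable_intros definable_fun_app[OF f])
    have "\<exists>d>0. ?X d y" if "p1 < y" "y < q1" for y
    proof -
      obtain e where "y < e" "\<forall>z. y < z \<and> z < e \<longrightarrow> f z < f y" using lt \<open>p1 < y\<close> \<open>y < q1\<close> by blast
      then show ?thesis by (intro exI[of _ "e - y"]) auto
    qed
    moreover have "?X d' y" if "0 < d'" "d' \<le> d" "?X d y" for d d' y
      using that by (meson add_left_mono less_le_trans)
    ultimately obtain d p2 q2 where 2: "0 < d" "p1 \<le> p2" "p2 < q2" "q2 \<le> q1" "\<forall>y. p2 < y \<and> y < q2 \<longrightarrow> ?X d y"
      using uniform_parameter[OF X _ 1(2)] by blast
    have "f y < f x" if "p2 < x" "x < y" "y < min q2 (p2 + d)" for x y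
    proof -
      have "p2 + d < x + d" using that by simp
      then have "y < x + d" using that(3) by (meson less_trans min_less_iff_conj)
      then show ?thesis using 2(5) that by (meson less_trans min_less_iff_conj)
    qed
    moreover have "p \<le> p2" "p2 < min q2 (p2 + d)" "min q2 (p2 + d) \<le> q"
      using 1(1-3) 2(1-4) by (auto intro: order.trans min.coboundedI1)
    ultimately show ?thesis by blast
  qed
qed

text \<open>If the image contained no interval, the values above \<open>f a\<close> would have a
  least one, \<open>f y\<close>; but a point strictly between \<open>a\<close> and \<open>y\<close>
  has a smaller value above \<open>f a\<close>.\<close>

lemma increasing_image_has_int:
  assumes f: "definable_fun f" and pq: "p < q" and inc: "\<And>x y. p < x \<Longrightarrow> x < y \<Longrightarrow> y < q \<Longrightarrow> f x < f y"
  shows "has_int {z. \<exists>x. p < x \<and> x < q \<and> z = f x}"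
proof (rule ccontr)
  let ?S = "\<lambda>z. \<exists>x. p < x \<and> x < q \<and> z = f x"
  assume S: "\<not> has_int (Collect ?S)"
  obtain a where a: "p < a" "a < q" using dense[OF pq] by blast
  obtain b where b: "a < b" "b < q" using dense[OF a(2)] by blast
  let ?P = "\<lambda>z. ?S z \<and> f a < z"
  have P: "definable1 ?P" unfolding definable1_def by (intro definable_intros definable_fun_app[OF f])
  have "Collect ?P \<subseteq> Collect ?S" by blast
  then have nP: "\<not> has_int (Collect ?P)" using S has_int_mono by blast
  have "p < b" using a b by order
  then have Pb: "?P (f b)" using a b inc[of a b] by blast
  obtain m where m: "?P m" "\<And>z. ?P z \<Longrightarrow> m \<le> z"
    by (rule no_int_inf_attained[OF P nP Pb, of "f a"]) (use less_imp_le in blast)+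
  then obtain y where y: "p < y" "y < q" "m = f y" by blast
  have "a < y" using m(1) y a inc[of y a] by (metis less_asym not_less_iff_gr_or_eq)
  then obtain z where z: "a < z" "z < y" using dense by blast
  have "p < z" "z < q" using z a y by order+
  then have "?P (f z)" "f z < m" using inc[of a z] inc[of z y] y a z by blast+
  then show False using m(2)[of "f z"] by auto
qed

lemma definable_fun_uminus: "definable_fun f \<Longrightarrow> definable_fun (\<lambda>x. - f x)"
  unfolding definable_fun_def by (rule definable_term_uminus)

lemma decreasing_image_has_int:
  assumes f: "definable_fun f" and pq: "p < q" and dec: "\<And>x y. p < x \<Longrightarrow> x < y \<Longrightarrow> y < q \<Longrightarrow> f y < f x"
  shows "has_int {z. \<exists>x. p < x \<and> x < q \<and> z = f x}"
proof -
  have "has_int {z. \<exists>x. p < x \<and> x < q \<and> z = - f x}"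
    using increasing_image_has_int[OF definable_fun_uminus[OF f] pq] dec by auto
  then obtain r t where rt: "r < t" "\<And>z. r < z \<Longrightarrow> z < t \<Longrightarrow> \<exists>x. p < x \<and> x < q \<and> z = - f x"
    by (auto elim!: has_intE)
  have "\<exists>x. p < x \<and> x < q \<and> z = f x" if "- t < z" "z < - r" for z
  proof -
    have "r < - z" "- z < t" using that by (auto simp: less_minus_iff minus_less_iff)
    then show ?thesis using rt(2)[of "- z"] by auto
  qed
  then show ?thesis using rt(1) by (intro has_intI[of "- t" "- r"]) auto
qed

text \<open>A stand-in for continuity. The image contains an interval, hence two values less than
  \<open>e\<close> apart; between their preimages an increasing function stays between them.\<close>

lemma increasing_small_oscillation:
  assumes f: "definable_fun f" and pq: "p < q" and inc: "\<And>x y. p < x \<Longrightarrow> x < y \<Longrightarrow> y < q \<Longrightarrow> f x < f y" and e: "0 < e"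
  shows "\<exists>p' q'. p \<le> p' \<and> p' < q' \<and> q' \<le> q \<and> (\<forall>x y. p' < x \<and> x < q' \<and> p' < y \<and> y < q' \<longrightarrow> f x - f y < e)"
proof -
  obtain r t where rt: "r < t" "\<And>z. r < z \<Longrightarrow> z < t \<Longrightarrow> \<exists>x. p < x \<and> x < q \<and> z = f x"
    using increasing_image_has_int[OF f pq inc] by (auto elim!: has_intE)
  obtain c where c: "r < c" "c < t" using dense[OF rt(1)] by blast
  obtain c' where c': "c < c'" "c' < min t (c + e)" using dense[of c "min t (c + e)"] c e by auto
  obtain a where a: "p < a" "a < q" "c = f a" using rt(2)[of c] c by auto
  obtain b where b: "p < b" "b < q" "c' = f b" using rt(2)[of c'] c c' order.strict_trans[of r c c'] by auto
  have "a < b" using inc[of b a] a b c' by (metis less_asym not_less_iff_gr_or_eq)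
  moreover have "f x - f y < e" if "a < x" "x < b" "a < y" "y < b" for x y
  proof -
    have "f x < f b" "f a < f y" using inc[of x b] inc[of a y] that a b by auto
    then have "f x - f y < f b - f a" by (rule diff_strict_mono)
    also have "\<dots> < e" using a b c' by (simp add: algebra_simps)
    finally show ?thesis .
  qed
  ultimately show ?thesis using a b by (intro exI[of _ a] exI[of _ b]) auto
qed

lemma small_oscillation:
  assumes f: "definable_fun f" and pq: "p < q" and e: "0 < e"
  shows "\<exists>p' q'. p \<le> p' \<and> p' < q' \<and> q' \<le> q \<and> (\<forall>x y. p' < x \<and> x < q' \<and> p' < y \<and> y < q' \<longrightarrow> f x - f y < e)"
proof -
  obtain p1 q1 where 1: "p \<le> p1" "p1 < q1" "q1 \<le> q"
    "(\<exists>c. \<forall>x. p1 < x \<and> x < q1 \<longrightarrow> f x = c) \<or>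
     (\<forall>x y. p1 < x \<and> x < y \<and> y < q1 \<longrightarrow> f x < f y) \<or>
     (\<forall>x y. p1 < x \<and> x < y \<and> y < q1 \<longrightarrow> f y < f x)"
    using monotonicity[OF f pq] by blast
  have "\<exists>p' q'. p1 \<le> p' \<and> p' < q' \<and> q' \<le> q1 \<and> (\<forall>x y. p' < x \<and> x < q' \<and> p' < y \<and> y < q' \<longrightarrow> f x - f y < e)"
    using 1(4)
  proof (elim disjE)
    assume "\<exists>c. \<forall>x. p1 < x \<and> x < q1 \<longrightarrow> f x = c"
    then show ?thesis using 1 e by (intro exI[of _ p1] exI[of _ q1]) auto
  next
    assume "\<forall>x y. p1 < x \<and> x < y \<and> y < q1 \<longrightarrow> f x < f y"
    then show ?thesis using increasing_small_oscillation[OF f 1(2) _ e] by blast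
  next
    assume "\<forall>x y. p1 < x \<and> x < y \<and> y < q1 \<longrightarrow> f y < f x"
    then have "\<exists>p' q'. p1 \<le> p' \<and> p' < q' \<and> q' \<le> q1 \<and> (\<forall>x y. p' < x \<and> x < q' \<and> p' < y \<and> y < q' \<longrightarrow> - f x - (- f y) < e)"
      using increasing_small_oscillation[OF definable_fun_uminus[OF f] 1(2) _ e] by simp
    then obtain p' q' where *: "p1 \<le> p'" "p' < q'" "q' \<le> q1"
      "\<And>x y. p' < x \<and> x < q' \<and> p' < y \<and> y < q' \<Longrightarrow> - f x - (- f y) < e" by blast
    have "f x - f y < e" if "p' < x \<and> x < q' \<and> p' < y \<and> y < q'" for x y
      using *(4)[of y x] that by simp
    then show ?thesis using * by blast
  qed
  then obtain p' q' where *: "p1 \<le> p'" "p' < q'" "q' \<le> q1"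
    "\<forall>x y. p' < x \<and> x < q' \<and> p' < y \<and> y < q' \<longrightarrow> f x - f y < e" by blast
  show ?thesis by (rule exI[of _ p'], rule exI[of _ q']) (use * 1 in \<open>auto intro: order.trans\<close>)
qed

end

subsection \<open>Definable choice\<close>

text \<open>
  The infimum \<open>m\<close> if it is attained. Otherwise some \<open>(m, e)\<close> is contained in the set, and the
  supremum of the \<open>x\<close> that lie at most half way into such an interval is an element: this avoids
  division by 2. The bound \<open>u\<close> keeps the supremum finite.
\<close>

definition pick0 :: "'a::linordered_ab_group_add \<Rightarrow> ('a \<Rightarrow> bool) \<Rightarrow> 'a \<Rightarrow> bool" where
  "pick0 u P z \<longleftrightarrow> (\<exists>m. is_inf P m \<and> (P m \<and> z = m \<or>
     \<not> P m \<and> is_sup (\<lambda>x. m < x \<and> x \<le> m + u \<and> (\<forall>y. m < y \<and> y < x + (x - m) \<longrightarrow> P y)) z))"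

text \<open>\<open>pick0\<close> needs a lower bound for the infimum to exist. The non-negative part
  of the set is used when it is nonempty; otherwise the set is reflected at 0.\<close>

definition pick :: "'a::linordered_ab_group_add \<Rightarrow> ('a \<Rightarrow> bool) \<Rightarrow> 'a \<Rightarrow> bool" where
  "pick u P z \<longleftrightarrow> (\<exists>x. 0 \<le> x \<and> P x) \<and> pick0 u (\<lambda>x. P x \<and> 0 \<le> x) z \<or>
     \<not> (\<exists>x. 0 \<le> x \<and> P x) \<and> pick0 u (\<lambda>x. P (- x) \<and> 0 \<le> x) (- z)"

text \<open>Distance less than \<open>e\<close> in the maximum norm; \<open>list_all2\<close> also
  forces equal lengths.\<close>

definition near :: "'a::linordered_ab_group_add \<Rightarrow> 'a list \<Rightarrow> 'a list \<Rightarrow> bool" where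
  "near e = list_all2 (\<lambda>a b. a - b < e \<and> b - a < e)"

lemma near_mono: "near d x y \<Longrightarrow> d \<le> e \<Longrightarrow> near e x y"
  unfolding near_def by (erule list_all2_mono) (auto intro: less_le_trans)

lemma near_sym: "near d x y \<Longrightarrow> near d y x"
  unfolding near_def by (simp add: list_all2_conv_all_nth)

lemma near_trans: "near d x y \<Longrightarrow> near e y z \<Longrightarrow> near (d + e) x z"
proof -
  assume "near d x y" "near e y z"
  then show ?thesis unfolding near_def
  proof (rule list_all2_trans[rotated])
    fix a b c :: 'a assume "a - b < d \<and> b - a < d" "b - c < e \<and> c - b < e"
    then have "(a - b) + (b - c) < d + e" "(c - b) + (b - a) < e + d"
      by (blast intro: add_strict_mono)+
    then show "a - c < d + e \<and> c - a < d + e" by (simp add: add.commute)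
  qed
qed

section \<open>Dimension by fibres\<close>

lemma has_int_iff: "has_int S \<longleftrightarrow> (\<exists>p q. p < q \<and> (\<forall>x. p < x \<and> x < q \<longrightarrow> x \<in> S))"
  unfolding has_int_def by (metis greaterThanLessThan_iff subset_iff)

text \<open>
  \<open>dim_ge n d E\<close> says that \<open>E \<subseteq> M\<^sup>n\<close> has dimension at least \<open>d\<close>; the empty set has no dimension, so
  \<open>dim_ge n 0 E\<close> means nonemptiness.
\<close>

primrec dim_ge :: "nat \<Rightarrow> nat \<Rightarrow> 'a::linorder list set \<Rightarrow> bool" where
  "dim_ge 0 d E \<longleftrightarrow> d = 0 \<and> [] \<in> E"
| "dim_ge (Suc n) d E \<longleftrightarrow> (\<exists>a. dim_ge n d {y. a # y \<in> E}) \<or>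
     0 < d \<and> has_int {a. dim_ge n (d - 1) {y. a # y \<in> E}}"

lemma dim_ge_mono: "dim_ge n d E \<Longrightarrow> E \<subseteq> F \<Longrightarrow> dim_ge n d F"
proof (induction n arbitrary: d E F)
  case 0
  then show ?case by auto
next
  case (Suc n)
  have *: "dim_ge n d' {y. a # y \<in> E} \<Longrightarrow> dim_ge n d' {y. a # y \<in> F}" for a d'
    by (rule Suc.IH) (use Suc.prems in auto)
  have "{a. dim_ge n (d - 1) {y. a # y \<in> E}} \<subseteq> {a. dim_ge n (d - 1) {y. a # y \<in> F}}" using * by blast
  then show ?case using Suc.prems(1) * has_int_mono by (metis dim_ge.simps(2))
qed

lemma dim_ge_antimono:
  "dim_ge n d (E :: 'a::dense_linorder list set) \<Longrightarrow> d' \<le> d \<Longrightarrow> dim_ge n d' E"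
proof (induction n arbitrary: d d' E)
  case 0
  then show ?case by auto
next
  case (Suc n)
  from Suc.prems(1) consider a where "dim_ge n d {y. a # y \<in> E}"
    | "0 < d" "has_int {a. dim_ge n (d - 1) {y. a # y \<in> E}}" by auto
  then show ?case
  proof cases
    case 1
    then show ?thesis using Suc.IH[OF 1 Suc.prems(2)] by auto
  next
    case 2
    show ?thesis
    proof (cases "d' = 0")
      case True
      obtain p q where pq: "p < q" "\<And>x. p < x \<Longrightarrow> x < q \<Longrightarrow> dim_ge n (d - 1) {y. x # y \<in> E}"
        using 2(2) by (auto elim!: has_intE)
      \<comment> \<open>By density an interval of good values contains one good value, so an
        interval direction can be traded for a fixed coordinate.\<close>
      obtain a where "p < a" "a < q" using dense[OF pq(1)] by blast
      then have "dim_ge n d' {y. a # y \<in> E}" using Suc.IH[OF pq(2), of a d'] True by auto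
      then show ?thesis by auto
    next
      case False
      have "{a. dim_ge n (d - 1) {y. a # y \<in> E}} \<subseteq> {a. dim_ge n (d' - 1) {y. a # y \<in> E}}"
        using Suc.IH[of "d - 1" _ "d' - 1"] Suc.prems(2) by auto
      then show ?thesis using has_int_mono[OF 2(2)] False by auto
    qed
  qed
qed

lemma has_int_nonempty: "has_int (S :: 'a::dense_linorder set) \<Longrightarrow> S \<noteq> {}"
  unfolding has_int_def by (metis dense empty_iff greaterThanLessThan_iff subset_empty)

lemma dim_ge_bound: "n < d \<Longrightarrow> \<not> dim_ge n d (E :: 'a::dense_linorder list set)"
proof (induction n arbitrary: d E)
  case (Suc n)
  then have "\<not> dim_ge n d F" "\<not> dim_ge n (d - 1) F" for F :: "'a list set" by auto
  then show ?case using has_int_nonempty[of "{}"] by auto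
qed auto

text \<open>Positive dimension must be gained from an interval at some level of the recursion;
  \<open>i\<close> is the coordinate where this first happens, and the others make up the remaining
  \<open>e\<close>. Slicing along it drives the induction for the frontier inequality.\<close>

lemma dim_ge_good_coordinate:
  "dim_ge (Suc n) (Suc e) X \<Longrightarrow>
   \<exists>i\<le>n. has_int {a. dim_ge n e {y. \<exists>u v. y = u @ v \<and> length u = i \<and> u @ a # v \<in> X}}"
proof (induction n arbitrary: X)
  case 0
  then show ?case by (auto intro!: exI[of _ 0])
next
  case (Suc n)
  from Suc.prems consider a where "dim_ge (Suc n) (Suc e) {y. a # y \<in> X}"
    | "has_int {a. dim_ge (Suc n) e {y. a # y \<in> X}}" by auto
  then show ?case
  proof cases
    case 1
    from Suc.IH[OF this] obtain i where i: "i \<le> n"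
      "has_int {b. dim_ge n e {y. \<exists>u v. y = u @ v \<and> length u = i \<and> u @ b # v \<in> {y. a # y \<in> X}}}" by blast
    \<comment> \<open>Only the slice over the fixed \<open>a\<close> is known to be large;
      prepending a fixed coordinate keeps its dimension.\<close>
    have "dim_ge (Suc n) e {y. \<exists>u v. y = u @ v \<and> length u = Suc i \<and> u @ b # v \<in> X}"
      if "dim_ge n e {y. \<exists>u v. y = u @ v \<and> length u = i \<and> u @ b # v \<in> {y. a # y \<in> X}}" for b
    proof -
      have "{y. \<exists>u v. y = u @ v \<and> length u = i \<and> u @ b # v \<in> {y. a # y \<in> X}} \<subseteq>
        {y. a # y \<in> {y. \<exists>u v. y = u @ v \<and> length u = Suc i \<and> u @ b # v \<in> X}}"
        by clarsimp (metis append_Cons length_Cons)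
      from dim_ge_mono[OF that this] show ?thesis by auto
    qed
    then have "has_int {b. dim_ge (Suc n) e {y. \<exists>u v. y = u @ v \<and> length u = Suc i \<and> u @ b # v \<in> X}}"
      by (intro has_int_mono[OF i(2)] Collect_mono) (rule impI)
    then show ?thesis using i(1) Suc_le_mono by blast
  next
    case 2
    then show ?thesis by (auto intro!: exI[of _ 0])
  qed
qed

section \<open>Definability of the dimension in families\<close>

context definable_structure
begin

lemma definable_near:
  assumes "definable_term e" "definable_list n x" "definable_list n y" shows "definable (\<lambda>\<rho>. near (e \<rho>) (x \<rho>) (y \<rho>))"
proof -
  have "definable (\<lambda>\<rho>. \<forall>i<n. x \<rho> ! i - y \<rho> ! i < e \<rho> \<and> y \<rho> ! i - x \<rho> ! i < e \<rho>)"
    by (rule definable_finite_all definable_intros definable_term_nth assms | assumption)+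
  then show ?thesis
    by (rule definable_cong) (use assms in \<open>auto simp: near_def list_all2_conv_all_nth definable_list_def\<close>)
qed

lemma D_fiber: "E \<in> D (Suc n) \<Longrightarrow> {y. a # y \<in> E} \<in> D n"
proof -
  assume E: "E \<in> D (Suc n)"
  have "{y. length y = n \<and> a # y \<in> E} \<in> D n"
    by (rule D_of_definable) (rule definable_intros E refl | simp)+
  also have "{y. length y = n \<and> a # y \<in> E} = {y. a # y \<in> E}" using D_length[OF E] by fastforce
  finally show ?thesis .
qed

text \<open>For fixed \<open>n\<close> and \<open>d\<close> the recursion unwinds to a formula,
  since containing an interval is expressed by quantifiers over its endpoints and its points. The
  coordinates already read join the parameters, so the induction lets \<open>m\<close> grow.\<close>

lemma D_dim_ge:
  "E \<in> D (m + n) \<Longrightarrow> {x. length x = m \<and> dim_ge n d {y. x @ y \<in> E}} \<in> D m"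
proof (induction n arbitrary: m d)
  case 0
  have "{x. length x = m \<and> dim_ge 0 d {y. x @ y \<in> E}} = (if d = 0 then E else {})"
    using D_length[OF 0] by auto
  then show ?case using 0 D_empty by auto
next
  case (Suc n)
  define G where "G d = {z. length z = Suc m \<and> dim_ge n d {y. z @ y \<in> E}}" for d
  have G: "G d \<in> D (Suc m)" for d unfolding G_def using Suc.IH[of "Suc m"] Suc.prems by simp
  have eq: "dim_ge n d {y. x @ a # y \<in> E} \<longleftrightarrow> x @ [a] \<in> G d" if "length x = m" for x a d
    using that by (simp add: G_def)
  have "{x. length x = m \<and> ((\<exists>a. x @ [a] \<in> G d) \<or> (0 < d \<and> has_int {a. x @ [a] \<in> G (d - 1)}))} \<in> D m"
  proof (rule D_of_definable, cases "0 < d")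
    case True
    have "definable (\<lambda>\<rho>. (\<exists>a. block (\<rho> 0) m @ [a] \<in> G d) \<or>
      (\<exists>p q. p < q \<and> (\<forall>a. p < a \<and> a < q \<longrightarrow> block (\<rho> 0) m @ [a] \<in> G (d - 1))))"
      by (rule definable_intros G refl | simp)+
    then show "definable (\<lambda>\<rho>. (\<exists>a. block (\<rho> 0) m @ [a] \<in> G d) \<or> (0 < d \<and> has_int {a. block (\<rho> 0) m @ [a] \<in> G (d - 1)}))"
      using True by (simp add: has_int_iff)
  next
    case False
    have "definable (\<lambda>\<rho>. (\<exists>a. block (\<rho> 0) m @ [a] \<in> G d))"
      by (rule definable_intros G refl | simp)+
    then show "definable (\<lambda>\<rho>. (\<exists>a. block (\<rho> 0) m @ [a] \<in> G d) \<or> (0 < d \<and> has_int {a. block (\<rho> 0) m @ [a] \<in> G (d - 1)}))"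
      using False by simp
  qed
  also have "{x. length x = m \<and> ((\<exists>a. x @ [a] \<in> G d) \<or> (0 < d \<and> has_int {a. x @ [a] \<in> G (d - 1)}))} =
     {x. length x = m \<and> dim_ge (Suc n) d {y. x @ y \<in> E}}"
    using eq by (auto cong: conj_cong)
  finally show ?case .
qed

lemma definable_dim_ge:
  assumes "definable_list m t" "E \<in> D k" "k = m + n"
  shows "definable (\<lambda>\<rho>. dim_ge n d {y. t \<rho> @ y \<in> E})"
proof -
  have "definable (\<lambda>\<rho>. t \<rho> \<in> {x. length x = m \<and> dim_ge n d {y. x @ y \<in> E}})"
    using assms by (intro definable_mem[OF assms(1) D_dim_ge]) auto
  then show ?thesis by (rule definable_cong) (use assms(1) in \<open>simp add: definable_list_def\<close>)
qed

lemma definable1_dim_ge: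
  assumes "E \<in> D (Suc n)" shows "definable1 (\<lambda>a. dim_ge n d {y. a # y \<in> E})"
  unfolding definable1_def
  using definable_dim_ge[OF definable_list_Cons[OF definable_term_var[of 0] definable_list_Nil] assms, of n d] by simp

lemma definable2_dim_ge:
  assumes "E \<in> D (Suc (Suc n))" shows "definable2 (\<lambda>a b. dim_ge n d {y. a # b # y \<in> E})"
  unfolding definable2_def
  using definable_dim_ge[OF definable_list_Cons[OF definable_term_var[of 0] definable_list_Cons[OF definable_term_var[of "Suc 0"] definable_list_Nil]] assms, of n d] by simp

lemma dim_ge_0_iff: "E \<in> D n \<Longrightarrow> dim_ge n 0 E \<longleftrightarrow> E \<noteq> {}"
proof (induction n arbitrary: E)
  case 0
  then show ?case using D_length by fastforce
next
  case (Suc n)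
  have "dim_ge (Suc n) 0 E \<longleftrightarrow> (\<exists>a. {y. a # y \<in> E} \<noteq> {})"
    using Suc.IH[OF D_fiber[OF Suc.prems]] by simp
  also have "\<dots> \<longleftrightarrow> E \<noteq> {}"
    using D_length[OF Suc.prems] by (auto) (metis length_Suc_conv)
  finally show ?case .
qed

end

section \<open>Existence of definable selections and their behaviour on the line\<close>

context tame_structure
begin

lemma pick0_ex1:
  assumes u: "0 < u" and P: "definable1 P" and x0: "P x0" and P0: "\<And>x. P x \<Longrightarrow> 0 \<le> x"
  shows "\<exists>z. pick0 u P z \<and> P z \<and> (\<forall>z'. pick0 u P z' \<longrightarrow> z' = z)"
proof -
  obtain m where m: "is_inf P m" using ex_inf[OF P x0 P0] by blast
  show ?thesis
  proof (cases "P m")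
    case True
    then show ?thesis using m is_inf_unique unfolding pick0_def by metis
  next
    case False
    let ?Q = "\<lambda>x. m < x \<and> x \<le> m + u \<and> (\<forall>y. m < y \<and> y < x + (x - m) \<longrightarrow> P y)"
    have Q: "definable1 ?Q" unfolding definable1_def by (intro definable_intros definable1_app[OF P])
    have gtm: "m < x" if "P x" for x using m that False unfolding is_inf_def by (metis le_less)
    obtain e where e: "m < e" "\<And>x. m < x \<Longrightarrow> x < e \<Longrightarrow> P x"
    proof (rule right_germ[OF P, of m])
      fix e assume "m < e" "\<And>x. m < x \<Longrightarrow> x < e \<Longrightarrow> P x"
      then show thesis by (rule that)
    next
      fix e assume e: "m < e" "\<And>x. m < x \<Longrightarrow> x < e \<Longrightarrow> \<not> P x"
      then have "e \<le> x" if "P x" for x using gtm that by (meson not_le)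
      then have "e \<le> m" using m unfolding is_inf_def by blast
      then show thesis using e(1) by simp
    qed
    \<comment> \<open>The point \<open>m + d\<close> lies at most half way into the interval from
      \<open>m\<close> to \<open>e\<close> and within the bound \<open>u\<close>, so the set under
      the supremum is nonempty.\<close>
    obtain d where d: "0 < d" "d + d + d \<le> min (e - m) u"
      using ex_triple_le[of "min (e - m) u"] e u by auto
    have "d \<le> d + d" "d + d \<le> d + d + d" using d(1) by simp_all
    moreover have "d + d + d \<le> e - m" "d + d + d \<le> u" using d(2) by auto
    ultimately have "d + d \<le> e - m" "d \<le> u" by order+
    have Qd: "?Q (m + d)"
    proof -
      have "m + d + (m + d - m) \<le> e" using \<open>d + d \<le> e - m\<close> by (simp add: algebra_simps)
      then show ?thesis using d(1) \<open>d \<le> u\<close> e(2) by (auto intro: less_le_trans)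
    qed
    obtain c where c: "is_sup ?Q c" using ex_sup[OF Q Qd, of "m + u"] by blast
    have "P c"
    proof -
      have "\<not> (\<forall>x. ?Q x \<longrightarrow> x \<le> c - d)" 
      proof
        assume "\<forall>x. ?Q x \<longrightarrow> x \<le> c - d"
        then have "c \<le> c - d" using c unfolding is_sup_def by blast
        then show False using d(1) by simp
      qed
      then obtain x where x: "?Q x" "c - d < x" by (auto simp: not_le)
      \<comment> \<open>As \<open>x'\<close> is less than \<open>d\<close> below the supremum
        \<open>c\<close> and at least \<open>d\<close> beyond \<open>m\<close>, doubling its
        distance from \<open>m\<close> passes \<open>c\<close>. So \<open>c\<close> lies in an
        interval on which \<open>P\<close> is known.\<close>
      define x' where "x' = max x (m + d)"
      have x': "?Q x'" "c - d < x'" "m + d \<le> x'" using x Qd by (auto simp: x'_def max_def)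
      have "c < x' + d" using x'(2) by (simp add: algebra_simps)
      also have "x' + d \<le> x' + (x' - m)" using x'(3) by (simp add: algebra_simps)
      finally have "c < x' + (x' - m)" .
      moreover have "m < c" using Qd c unfolding is_sup_def by (meson less_le_trans)
      ultimately show ?thesis using x'(1) by blast
    qed
    moreover have "pick0 u P c" unfolding pick0_def using m False c by blast
    moreover have "z' = c" if "pick0 u P z'" for z'
    proof -
      obtain m' where m': "is_inf P m'" "P m' \<and> z' = m' \<or>
         \<not> P m' \<and> is_sup (\<lambda>x. m' < x \<and> x \<le> m' + u \<and> (\<forall>y. m' < y \<and> y < x + (x - m') \<longrightarrow> P y)) z'"
        using \<open>pick0 u P z'\<close> unfolding pick0_def by blast
      then have "m' = m" using m is_inf_unique by blast
      then show ?thesis using m'(2) False c is_sup_unique by blast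
    qed
    ultimately show ?thesis by blast
  qed
qed

lemma pick_ex1:
  assumes u: "0 < u" and P: "definable1 P" and x0: "P x0"
  shows "\<exists>z. pick u P z \<and> P z \<and> (\<forall>z'. pick u P z' \<longrightarrow> z' = z)"
proof (cases "\<exists>x. 0 \<le> x \<and> P x")
  case True
  then obtain x where x: "P x \<and> 0 \<le> x" by blast
  have "definable1 (\<lambda>x. P x \<and> 0 \<le> x)" unfolding definable1_def by (intro definable_intros definable1_app[OF P])
  from pick0_ex1[OF u this x] show ?thesis using True unfolding pick_def by blast
next
  case False
  then have x: "P (- (- x0)) \<and> 0 \<le> - x0" using x0 by (metis add.inverse_inverse le_cases neg_0_le_iff_le)
  have "definable1 (\<lambda>x. P (- x) \<and> 0 \<le> x)" unfolding definable1_def by (intro definable_intros definable1_app[OF P])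
  from pick0_ex1[OF u this x] obtain z where z: "pick0 u (\<lambda>x. P (- x) \<and> 0 \<le> x) z" "P (- z)"
    "\<And>z'. pick0 u (\<lambda>x. P (- x) \<and> 0 \<le> x) z' \<Longrightarrow> z' = z" by blast
  have "pick u P (- z)" unfolding pick_def using False z(1) by simp
  moreover have "z' = - z" if "pick u P z'" for z'
    using that z(3)[of "- z'"] False unfolding pick_def by (metis add.inverse_inverse)
  ultimately show ?thesis using z(2) by blast
qed

text \<open>\<open>pick\<close> is a first-order formula in its predicate, so it selects uniformly
  in \<open>a\<close>; the value 0 over empty fibres makes the function total.\<close>

lemma ex_definable_fun_choice:
  assumes Q: "definable2 Q" shows "\<exists>f. definable_fun f \<and> (\<forall>a. (\<exists>b. Q a b) \<longrightarrow> Q a (f a))"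
proof -
  obtain u :: 'a where u: "0 < u" using gt_ex by blast
  define f where "f a = (if \<exists>b. Q a b then THE b. pick u (Q a) b else 0)" for a
  have f: "pick u (Q a) (f a) \<and> Q a (f a) \<and> (\<forall>z. pick u (Q a) z \<longrightarrow> z = f a)" if ex: "\<exists>b. Q a b" for a
  proof -
    obtain b where "Q a b" using ex by blast
    from pick_ex1[OF u definable2_fix1[OF Q] this] obtain z where z: "pick u (Q a) z" "Q a z"
      "\<And>z'. pick u (Q a) z' \<Longrightarrow> z' = z" by blast
    have "f a = (THE b. pick u (Q a) b)" using ex by (simp add: f_def)
    also have "\<dots> = z" by (rule the_equality) (fact z)+
    finally have fz: "f a = z" .
    show ?thesis unfolding fz using z by blast
  qed
  have "definable (\<lambda>\<rho>. (\<exists>b. Q (\<rho> (Suc 0) 0) b) \<and> pick u (\<lambda>b. Q (\<rho> (Suc 0) 0) b) (\<rho> 0 0) \<or>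
      \<not> (\<exists>b. Q (\<rho> (Suc 0) 0) b) \<and> \<rho> 0 0 = 0)"
    unfolding pick_def pick0_def is_inf_def is_sup_def
    by (intro definable_intros definable2_app[OF Q])
  then have "definable_fun f" unfolding definable_fun_def definable_term_def
  proof (rule definable_cong)
    fix \<rho> :: "nat \<Rightarrow> nat \<Rightarrow> 'a"
    show "((\<exists>b. Q (\<rho> (Suc 0) 0) b) \<and> pick u (\<lambda>b. Q (\<rho> (Suc 0) 0) b) (\<rho> 0 0) \<or>
      \<not> (\<exists>b. Q (\<rho> (Suc 0) 0) b) \<and> \<rho> 0 0 = 0) \<longleftrightarrow> \<rho> 0 0 = f (\<rho> (Suc 0) 0)"
    proof (cases "\<exists>b. Q (\<rho> (Suc 0) 0) b")
      case True
      have "pick u (\<lambda>b. Q (\<rho> (Suc 0) 0) b) z \<longleftrightarrow> z = f (\<rho> (Suc 0) 0)" for z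
        using f[OF True] by metis
      then show ?thesis using True by simp
    next
      case False
      then show ?thesis by (simp add: f_def)
    qed
  qed
  then show ?thesis using f by blast
qed

lemma D_choice_last:
  assumes E: "E \<in> D (Suc m)"
  shows "\<exists>F\<in>D (Suc m). F \<subseteq> E \<and> (\<forall>x. (\<exists>b. x @ [b] \<in> E) \<longrightarrow> (\<exists>!b. x @ [b] \<in> F))"
proof -
  obtain u :: 'a where u: "0 < u" using gt_ex by blast
  let ?R = "\<lambda>z. \<exists>x\<in>{xs. length xs = m}. \<exists>b. z = x @ [b] \<and> (\<exists>b. x @ [b] \<in> E) \<and> pick u (\<lambda>b. x @ [b] \<in> E) b"
  let ?F = "{z. length z = Suc m \<and> ?R z}"
  have "?F \<in> D (Suc m)"
    unfolding pick_def pick0_def is_inf_def is_sup_def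
    by (rule D_of_definable) (rule definable_intros E D_tuples refl | simp)+
  have ex1: "\<exists>z. pick u (\<lambda>b. x @ [b] \<in> E) z \<and> x @ [z] \<in> E \<and> (\<forall>z'. pick u (\<lambda>b. x @ [b] \<in> E) z' \<longrightarrow> z' = z)"
    if "x @ [b] \<in> E" for x b
  proof -
    have "length x = m" using D_length[OF E that] by simp
    then have "definable1 (\<lambda>b. x @ [b] \<in> E)" unfolding definable1_def by - (rule definable_intros E refl | simp)+
    from pick_ex1[OF u this that] show ?thesis .
  qed
  have "?F \<subseteq> E" using ex1 by fastforce
  moreover have "\<exists>!b. x @ [b] \<in> ?F" if ex: "\<exists>b. x @ [b] \<in> E" for x
  proof -
    obtain b where b: "x @ [b] \<in> E" using ex by blast
    obtain z where z: "pick u (\<lambda>b. x @ [b] \<in> E) z" "\<And>z'. pick u (\<lambda>b. x @ [b] \<in> E) z' \<Longrightarrow> z' = z"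
      using ex1[OF b] by blast
    show ?thesis
    proof (rule ex1I[of _ z])
      show "x @ [z] \<in> ?F" using z(1) ex D_length[OF E b] by auto
      fix c assume "x @ [c] \<in> ?F"
      then have "pick u (\<lambda>b. x @ [b] \<in> E) c" by auto
      then show "c = z" by (rule z(2))
    qed
  qed
  ultimately show ?thesis using \<open>?F \<in> D (Suc m)\<close> by blast
qed

text \<open>Induction on the number of chosen coordinates: all but the last are chosen from the
  projection \<open>E1\<close>, the last one by \<open>D_choice_last\<close>.\<close>

lemma D_choice:
  "E \<in> D (m + n) \<Longrightarrow> \<exists>F\<in>D (m + n). F \<subseteq> E \<and>
     (\<forall>x. length x = m \<and> (\<exists>y. x @ y \<in> E) \<longrightarrow> (\<exists>!y. x @ y \<in> F))"
proof (induction n arbitrary: E)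
  case 0
  have "y = []" if "length x = m" "x @ y \<in> E" for x y
    using D_length[OF 0 that(2)] that(1) by simp
  then show ?case using 0 by (intro bexI[of _ E]) blast+
next
  case (Suc n)
  define E1 where "E1 = {x. length x = m + n \<and> (\<exists>b. x @ [b] \<in> E)}"
  have E: "E \<in> D (Suc (m + n))" using Suc.prems by simp
  have "E1 \<in> D (m + n)" unfolding E1_def by (rule D_of_definable) (rule definable_intros E refl | simp)+
  from Suc.IH[OF this] obtain F1 where F1: "F1 \<in> D (m + n)" "F1 \<subseteq> E1"
    "\<And>x. length x = m \<Longrightarrow> \<exists>y. x @ y \<in> E1 \<Longrightarrow> \<exists>!y. x @ y \<in> F1" by blast
  from D_choice_last[OF E] obtain F2 where F2: "F2 \<in> D (Suc (m + n))" "F2 \<subseteq> E"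
    "\<And>x. \<exists>b. x @ [b] \<in> E \<Longrightarrow> \<exists>!b. x @ [b] \<in> F2" by blast
  let ?F = "{z. length z = Suc (m + n) \<and> z \<in> F2 \<and> (\<exists>x\<in>F1. \<exists>b. z = x @ [b])}"
  have "?F \<in> D (Suc (m + n))" by (rule D_of_definable) (rule definable_intros F1(1) F2(1) refl | simp)+
  moreover have "?F \<subseteq> E" using F2 by auto
  moreover have "\<exists>!y. x @ y \<in> ?F" if x: "length x = m" "\<exists>y. x @ y \<in> E" for x
  proof -
    obtain y where y: "x @ y \<in> E" using x by blast
    then have "length y = Suc n" using D_length[OF E y] x by simp
    then obtain y' b where yb: "y = y' @ [b]" "length y' = n"
      by (metis append_butlast_last_id length_0_conv length_butlast diff_Suc_1 nat.distinct(1))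
    then have "x @ y' \<in> E1" using y x by (auto simp: E1_def)
    then obtain w where w: "x @ w \<in> F1" "\<And>w'. x @ w' \<in> F1 \<Longrightarrow> w' = w" using F1(3)[OF x(1)] by blast
    have "\<exists>b. (x @ w) @ [b] \<in> E" using F1(2) w(1) unfolding E1_def by blast
    from F2(3)[OF this] obtain c where c: "(x @ w) @ [c] \<in> F2" "\<And>c'. (x @ w) @ [c'] \<in> F2 \<Longrightarrow> c' = c" by blast
    show ?thesis
    proof (rule ex1I[of _ "w @ [c]"])
      show "x @ (w @ [c]) \<in> ?F" using c(1) w(1) D_length[OF F2(1) c(1)] by auto
    next
      fix v assume v: "x @ v \<in> ?F"
      then obtain z b where zb: "z \<in> F1" "x @ v = z @ [b]" "x @ v \<in> F2" "length z = m + n"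
        using D_length[OF F1(1)] by auto
      have "length v = Suc n" using arg_cong[OF zb(2), of length] zb(4) x(1) by simp
      then obtain v' b' where vb: "v = v' @ [b']" by (metis append_butlast_last_id length_0_conv nat.distinct(1))
      then have "x @ v' = z" "b' = b" using zb(2) by auto
      then have "v' = w" using w(2) zb(1) by auto
      then show "v = w @ [c]" using c(2)[of b'] zb(3) vb by simp
    qed
  qed
  ultimately show ?case by (metis (no_types, lifting) add_Suc_right)
qed

text \<open>Choose \<open>f b\<close> with \<open>Q (f b) b\<close> and apply monotonicity: a
  constant piece puts an interval into one fibre \<open>Q c\<close>, a strictly monotone piece puts
  one into the projection to the first coordinate.\<close>

lemma no_int_projection:
  assumes Q: "definable2 Q" and 1: "\<not> has_int {a. \<exists>b. Q a b}" and 2: "\<And>a. \<not> has_int {b. Q a b}"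
  shows "\<not> has_int {b. \<exists>a. Q a b}"
proof
  assume "has_int {b. \<exists>a. Q a b}"
  then obtain p q where pq: "p < q" "\<And>b. p < b \<Longrightarrow> b < q \<Longrightarrow> \<exists>a. Q a b" by (auto elim!: has_intE)
  obtain f where f: "definable_fun f" "\<And>b. \<exists>a. Q a b \<Longrightarrow> Q (f b) b"
    using ex_definable_fun_choice[OF definable2_flip[OF Q]] by blast
  obtain p1 q1 where 3: "p \<le> p1" "p1 < q1" "q1 \<le> q"
    "(\<exists>c. \<forall>x. p1 < x \<and> x < q1 \<longrightarrow> f x = c) \<or>
     (\<forall>x y. p1 < x \<and> x < y \<and> y < q1 \<longrightarrow> f x < f y) \<or>
     (\<forall>x y. p1 < x \<and> x < y \<and> y < q1 \<longrightarrow> f y < f x)"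
    using monotonicity[OF f(1) pq(1)] by blast
  have Qf: "Q (f b) b" if "p1 < b" "b < q1" for b
  proof -
    have "p < b" "b < q" using that 3 by order+
    then show ?thesis using pq(2) f(2) by blast
  qed
  have sub: "{z. \<exists>x. p1 < x \<and> x < q1 \<and> z = f x} \<subseteq> {a. \<exists>b. Q a b}" using Qf by blast
  from 3(4) show False
  proof (elim disjE)
    assume "\<exists>c. \<forall>x. p1 < x \<and> x < q1 \<longrightarrow> f x = c"
    then obtain c where "\<And>x. p1 < x \<Longrightarrow> x < q1 \<Longrightarrow> f x = c" by blast
    then have "has_int {b. Q c b}" using Qf 3(2) by (intro has_intI[of p1 q1]) auto
    then show False using 2 by blast
  next
    assume "\<forall>x y. p1 < x \<and> x < y \<and> y < q1 \<longrightarrow> f x < f y"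
    then show False using increasing_image_has_int[OF f(1) 3(2)] has_int_mono[OF _ sub] 1 by blast
  next
    assume "\<forall>x y. p1 < x \<and> x < y \<and> y < q1 \<longrightarrow> f y < f x"
    then show False using decreasing_image_has_int[OF f(1) 3(2)] has_int_mono[OF _ sub] 1 by blast
  qed
qed

text \<open>Replaces a continuous selection. One coordinate is selected and held nearly constant on
  a subinterval by \<open>small_oscillation\<close>; the set is cut down to points whose coordinate
  is close to that value, and the remaining coordinates are treated on a smaller interval.\<close>

lemma near_constant_selection:
  assumes "T \<in> D (Suc n)" "p < q" "\<And>a. p < a \<Longrightarrow> a < q \<Longrightarrow> \<exists>x. a # x \<in> T" "0 < e"
  shows "\<exists>p' q' c. p \<le> p' \<and> p' < q' \<and> q' \<le> q \<and> (\<forall>a. p' < a \<and> a < q' \<longrightarrow> (\<exists>x. a # x \<in> T \<and> near e x c))"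
  using assms
proof (induction n arbitrary: T p q)
  case 0
  have "x = []" if "a # x \<in> T" for a x using D_length[OF 0(1) that] by simp
  then have "near e x []" if "a # x \<in> T" for a x using that by (auto simp: near_def)
  then show ?case using 0 by (intro exI[of _ p] exI[of _ q] exI[of _ "[]"]) (blast intro: order_refl)
next
  case (Suc n)
  note T = Suc.prems(1)
  have lenT: "length z = n" if "a # b # z \<in> T" for a b z using D_length[OF T that] by simp
  let ?Q = "\<lambda>a b. \<exists>z\<in>{xs. length xs = n}. a # b # z \<in> T"
  have Q: "definable2 ?Q" unfolding definable2_def by (rule definable_intros D_tuples T refl | simp)+
  obtain f where f: "definable_fun f" "\<And>a. \<exists>b. ?Q a b \<Longrightarrow> ?Q a (f a)" using ex_definable_fun_choice[OF Q] by blast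
  obtain p1 q1 where 1: "p \<le> p1" "p1 < q1" "q1 \<le> q"
    "\<And>x y. p1 < x \<and> x < q1 \<and> p1 < y \<and> y < q1 \<Longrightarrow> f x - f y < e"
    using small_oscillation[OF f(1) Suc.prems(2,4)] by blast
  obtain a0 where a0: "p1 < a0" "a0 < q1" using dense[OF 1(2)] by blast
  \<comment> \<open>The coordinate \<open>b\<close> is projected away but remembered as close to
    \<open>f a0\<close>. It need not equal \<open>f a\<close>, because the tail \<open>z\<close> is
    selected anew by the induction.\<close>
  let ?R = "\<lambda>z'. \<exists>a. \<exists>z\<in>{xs. length xs = n}. z' = a # z \<and> (\<exists>b. b - f a0 < e \<and> f a0 - b < e \<and> a # b # z \<in> T)"
  let ?T = "{z'. length z' = Suc n \<and> ?R z'}"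
  have T': "?T \<in> D (Suc n)" by (rule D_of_definable) (rule definable_intros D_tuples T refl | simp)+
  have "\<exists>x. a # x \<in> ?T" if a: "p1 < a" "a < q1" for a
  proof -
    have "p < a" "a < q" using a 1 by order+
    then obtain x where x: "a # x \<in> T" using Suc.prems(3) by blast
    then obtain b z where "x = b # z" using D_length[OF T x] by (cases x) auto
    then have "?Q a b" using x lenT by auto
    then have "?Q a (f a)" using f(2) by blast
    then obtain z where z: "length z = n" "a # f a # z \<in> T" by auto
    moreover have "f a - f a0 < e" "f a0 - f a < e" using 1(4) a a0 by blast+
    ultimately show ?thesis by auto
  qed
  from Suc.IH[OF T' 1(2) this Suc.prems(4)] obtain p' q' c where 2: "p1 \<le> p'" "p' < q'" "q' \<le> q1"
    "\<And>a. p' < a \<Longrightarrow> a < q' \<Longrightarrow> \<exists>x. a # x \<in> ?T \<and> near e x c" by blast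
  have "\<exists>x. a # x \<in> T \<and> near e x (f a0 # c)" if a: "p' < a" "a < q'" for a
  proof -
    obtain x where x: "a # x \<in> ?T" "near e x c" using 2(4)[OF a] by blast
    then obtain b where "b - f a0 < e" "f a0 - b < e" "a # b # x \<in> T" by auto
    then show ?thesis using x(2) by (intro exI[of _ "b # x"]) (auto simp: near_def)
  qed
  moreover have "p \<le> p'" "q' \<le> q" using 1 2 by order+
  ultimately show ?case using 2(2) by blast
qed

text \<open>The set contains a rectangle. Once the intervals in the fibres have a uniform radius
  \<open>d\<close>, their centres can be taken within \<open>d'\<close> of one \<open>c0\<close> on
  a smaller interval, and \<open>d' + d' \<le> d\<close> leaves a common interval around
  \<open>c0\<close>.\<close>

lemma has_int_swap:
  assumes Q: "definable2 Q" and "has_int {a. has_int {b. Q a b}}" shows "has_int {b. has_int {a. Q a b}}"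
proof -
  obtain p q where pq: "p < q" "\<And>a. p < a \<Longrightarrow> a < q \<Longrightarrow> has_int {b. Q a b}"
    using assms(2) by (auto elim!: has_intE)
  let ?X = "\<lambda>d a. \<exists>c. \<forall>b. c - d < b \<and> b < c + d \<longrightarrow> Q a b"
  have X: "definable2 ?X" unfolding definable2_def by (intro definable_intros definable2_app[OF Q])
  have "\<exists>d>0. ?X d a" if a: "p < a" "a < q" for a
  proof -
    obtain r t where rt: "r < t" "\<And>b. r < b \<Longrightarrow> b < t \<Longrightarrow> Q a b" using pq(2)[OF a] by (auto elim!: has_intE)
    obtain c where c: "r < c" "c < t" using dense[OF rt(1)] by blast
    define d where "d = min (c - r) (t - c)"
    have "d \<le> c - r" "d \<le> t - c" by (auto simp: d_def)
    then have "r \<le> c - d" "c + d \<le> t" by (auto simp: algebra_simps)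
    then have "\<forall>b. c - d < b \<and> b < c + d \<longrightarrow> Q a b" using rt(2) by (meson le_less_trans less_le_trans)
    moreover have "0 < d" using c by (simp add: d_def)
    ultimately show ?thesis by blast
  qed
  moreover have "?X d' a" if "0 < d'" "d' \<le> d" and d: "?X d a" for d d' a
  proof -
    obtain c where c: "\<And>b. c - d < b \<Longrightarrow> b < c + d \<Longrightarrow> Q a b" using d by blast
    have "c - d \<le> c - d'" "c + d' \<le> c + d" using that(2) by auto
    then have "\<forall>b. c - d' < b \<and> b < c + d' \<longrightarrow> Q a b" using c by (meson le_less_trans less_le_trans)
    then show ?thesis by blast
  qed
  ultimately obtain d p1 q1 where 1: "0 < d" "p \<le> p1" "p1 < q1" "q1 \<le> q" "\<And>a. p1 < a \<Longrightarrow> a < q1 \<Longrightarrow> ?X d a"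
    using uniform_parameter[OF X _ pq(1)] by blast
  obtain d' where d': "0 < d'" "d' + d' + d' \<le> d" using ex_triple_le[OF 1(1)] by blast
  have d2: "d' + d' \<le> d" using d' by (meson add_increasing2 less_imp_le order.trans order_refl)
  let ?R = "\<lambda>z. \<exists>a c. z = [a, c] \<and> (\<forall>b. c - d < b \<and> b < c + d \<longrightarrow> Q a b)"
  have T: "{z. length z = Suc (Suc 0) \<and> ?R z} \<in> D (Suc (Suc 0))" (is "?T \<in> _")
    by (rule D_of_definable) (rule definable_intros definable2_app[OF Q] refl | simp)+
  have "\<exists>x. a # x \<in> ?T" if a: "p1 < a" "a < q1" for a
  proof -
    obtain c where "\<forall>b. c - d < b \<and> b < c + d \<longrightarrow> Q a b" using 1(5)[OF a] by blast
    then show ?thesis by (intro exI[of _ "[c]"]) simp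
  qed
  from near_constant_selection[OF T 1(3) this d'(1)] obtain p2 q2 cc where 2: "p2 < q2"
    "\<And>a. p2 < a \<Longrightarrow> a < q2 \<Longrightarrow> \<exists>x. a # x \<in> ?T \<and> near d' x cc" by blast
  obtain a0 where "p2 < a0" "a0 < q2" using dense[OF 2(1)] by blast
  then obtain c0 where c0: "cc = [c0]" using 2(2)[of a0] by (auto simp: near_def list_all2_Cons1)
  have "Q a b" if a: "p2 < a" "a < q2" and b: "c0 - d' < b" "b < c0 + d'" for a b
  proof -
    obtain c where c: "\<And>b. c - d < b \<Longrightarrow> b < c + d \<Longrightarrow> Q a b" "c - c0 < d'" "c0 - c < d'"
      using 2(2)[OF a] by (auto simp: near_def c0)
    have "c - b < d' + d'" using add_strict_mono[OF c(2), of "c0 - b" d'] b by (simp add: algebra_simps)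
    moreover have "b - c < d' + d'" using add_strict_mono[OF c(3), of "b - c0" d'] b by (simp add: algebra_simps)
    ultimately have "c - b < d" "b - c < d" using d2 by order+
    then show ?thesis using c(1)[of b] by (simp add: algebra_simps)
  qed
  then have "has_int {a. Q a b}" if "c0 - d' < b" "b < c0 + d'" for b
    using that 2(1) by (intro has_intI[of p2 q2]) auto
  moreover have "c0 - d' < c0 + d'" using d'(1) by (meson add_strict_increasing diff_less_eq less_add_same_cancel1 less_trans order_refl)
  ultimately show ?thesis by (intro has_intI[of "c0 - d'" "c0 + d'"]) auto
qed

end

subsection \<open>Dimension\<close>

definition swap_front :: "'a list set \<Rightarrow> 'a list set" where
  "swap_front E = {z. \<exists>a b y. z = b # a # y \<and> a # b # y \<in> E}"

definition move_front :: "nat \<Rightarrow> 'a list set \<Rightarrow> 'a list set" where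
  "move_front i E = {z. \<exists>a u v. z = a # u @ v \<and> length u = i \<and> u @ a # v \<in> E}"

lemma fiber_swap_front: "{y. b # a # y \<in> swap_front E} = {y. a # b # y \<in> E}"
  by (simp add: swap_front_def)

lemma fiber_move_front: "{y. a # y \<in> move_front i E} = {y. \<exists>u v. y = u @ v \<and> length u = i \<and> u @ a # v \<in> E}"
  by (simp add: move_front_def)

text \<open>Moving past \<open>Suc i\<close> coordinates means moving past \<open>i\<close> of them
  inside the fibres and then swapping in front; this is the inductive step of
  \<open>dim_ge_move_front\<close>.\<close>

lemma fiber_move_front_Suc: "{y. a # b # y \<in> move_front (Suc i) E} = {y. a # y \<in> move_front i {y. b # y \<in> E}}"
proof -
  have "(\<exists>u v. b # y = u @ v \<and> length u = Suc i \<and> u @ a # v \<in> E) \<longleftrightarrow>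
      (\<exists>u v. y = u @ v \<and> length u = i \<and> b # u @ a # v \<in> E)" for y
  proof
    assume "\<exists>u v. b # y = u @ v \<and> length u = Suc i \<and> u @ a # v \<in> E"
    then obtain u v where uv: "b # y = u @ v" "length u = Suc i" "u @ a # v \<in> E" by blast
    then obtain u' where "u = b # u'" by (cases u) auto
    then show "\<exists>u v. y = u @ v \<and> length u = i \<and> b # u @ a # v \<in> E" using uv by auto
  next
    assume "\<exists>u v. y = u @ v \<and> length u = i \<and> b # u @ a # v \<in> E"
    then obtain u v where "y = u @ v" "length u = i" "b # u @ a # v \<in> E" by blast
    then show "\<exists>u v. b # y = u @ v \<and> length u = Suc i \<and> u @ a # v \<in> E"
      by (intro exI[of _ "b # u"] exI[of _ v]) auto
  qed
  then show ?thesis by (simp add: move_front_def)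
qed

lemma near_insert_coordinate:
  assumes "near d (u @ a # v) z"
  shows "\<exists>u' b v'. z = u' @ b # v' \<and> length u' = length u \<and> a - b < d \<and> b - a < d \<and> near d (u @ v) (u' @ v')"
proof -
  obtain u' w where w: "z = u' @ w" "near d u u'" "near d (a # v) w"
    using assms unfolding near_def list_all2_append1 by blast
  then obtain b v' where "w = b # v'" "a - b < d" "b - a < d" "near d v v'"
    unfolding near_def by (auto simp: list_all2_Cons1)
  moreover have "length u' = length u" using list_all2_lengthD[OF w(2)[unfolded near_def]] by simp
  moreover have "near d (u @ v) (u' @ v')"
    using w(2) \<open>near d v v'\<close> unfolding near_def by (rule list_all2_appendI)
  ultimately show ?thesis using w(1) by blast
qed

section \<open>Invariance of the dimension under permutations of coordinates\<close>

context tame_structure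
begin

lemma has_int_finite_Union:
  assumes "\<And>k. k \<le> N \<Longrightarrow> definable1 (P k)" "has_int {a. \<exists>k\<le>N. P (k::nat) a}"
  shows "\<exists>k\<le>N. has_int {a. P k a}"
  using assms
proof (induction N)
  case 0
  then show ?case by simp
next
  case (Suc N)
  have "{a. \<exists>k\<le>Suc N. P k a} = {a. P (Suc N) a \<or> (\<exists>k\<le>N. P k a)}" by (auto simp: le_Suc_eq)
  then have "has_int {a. P (Suc N) a} \<or> has_int {a. \<exists>k\<le>N. P k a}"
    using has_int_Un[of "P (Suc N)"] Suc.prems by simp
  then show ?case using Suc.IH Suc.prems(1) by (meson le_SucI order_refl)
qed

text \<open>The plane in dimension 1: hypothesis and conclusion are \<open>dim_ge\<close> unfolded
  with the coordinates in either order. When the conclusion fails, \<open>no_int_projection\<close>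
  with exchanged coordinates refutes the hypothesis.\<close>

lemma planar_dim1_swap:
  assumes Q: "definable2 Q" and "(\<exists>a. has_int {b. Q a b}) \<or> has_int {a. \<exists>b. Q a b}"
  shows "(\<exists>b. has_int {a. Q a b}) \<or> has_int {b. \<exists>a. Q a b}"
proof (rule ccontr)
  assume *: "\<not> ?thesis"
  then have "\<not> has_int {a. \<exists>b. Q a b}"
    using no_int_projection[OF definable2_flip[OF Q]] by blast
  moreover have "\<not> has_int {b. Q a b}" for a
    using * has_int_mono[of "{b. Q a b}" "{b. \<exists>a. Q a b}"] by blast
  ultimately show False using assms(2) by blast
qed

text \<open>The first two coordinates contribute 0, 1 or 2 to the dimension: \<open>F d\<close>
  holds at a point, \<open>F (d - 1)\<close> on a planar set of dimension 1, or
  \<open>F (d - 1 - 1)\<close> on one of dimension 2. The three cases are symmetric by logic, by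
  \<open>planar_dim1_swap\<close> and by \<open>has_int_swap\<close>.\<close>

lemma dim_ge_swap_front_imp:
  assumes E: "E \<in> D (Suc (Suc n))" and d: "dim_ge (Suc (Suc n)) d E"
  shows "dim_ge (Suc (Suc n)) d (swap_front E)"
proof -
  define F where "F j a b \<longleftrightarrow> dim_ge n j {y. a # b # y \<in> E}" for j a b
  have F: "definable2 (F j)" for j unfolding F_def using definable2_dim_ge[OF E] .
  have goal: "dim_ge (Suc (Suc n)) d (swap_front E) \<longleftrightarrow>
     (\<exists>b. (\<exists>a. F d a b) \<or> 0 < d \<and> has_int {a. F (d - 1) a b}) \<or>
     0 < d \<and> has_int {b. (\<exists>a. F (d - 1) a b) \<or> 0 < d - 1 \<and> has_int {a. F (d - 1 - 1) a b}}"
    by (simp add: F_def fiber_swap_front)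
  have hyp: "(\<exists>a. (\<exists>b. F d a b) \<or> 0 < d \<and> has_int {b. F (d - 1) a b}) \<or>
     0 < d \<and> has_int {a. (\<exists>b. F (d - 1) a b) \<or> 0 < d - 1 \<and> has_int {b. F (d - 1 - 1) a b}}"
    using d by (simp add: F_def)
  have P: "definable1 (\<lambda>a. \<exists>b. F (d - 1) a b)" unfolding definable1_def by (intro definable_intros definable2_app[OF F])
  have planar: "dim_ge (Suc (Suc n)) d (swap_front E)"
    if "0 < d" "(\<exists>a. has_int {b. F (d - 1) a b}) \<or> has_int {a. \<exists>b. F (d - 1) a b}"
  proof -
    have "has_int {b. \<exists>a. F (d - 1) a b} \<Longrightarrow>
      has_int {b. (\<exists>a. F (d - 1) a b) \<or> 0 < d - 1 \<and> has_int {a. F (d - 1 - 1) a b}}"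
      by (erule has_int_mono) blast
    then show ?thesis unfolding goal using planar_dim1_swap[OF F that(2)] that(1) by blast
  qed
  consider a b where "F d a b" | a where "0 < d" "has_int {b. F (d - 1) a b}"
    | "0 < d" "has_int {a. (\<exists>b. F (d - 1) a b) \<or> 0 < d - 1 \<and> has_int {b. F (d - 1 - 1) a b}}"
    using hyp by blast
  then show ?thesis
  proof cases
    case 1
    then show ?thesis unfolding goal by blast
  next
    case 2
    then show ?thesis using planar by blast
  next
    case 3
    \<comment> \<open>The interval of first coordinates mixes contributions 1 and 2; some interval
      carries only one of them.\<close>
    from has_int_Un[OF P 3(2)] show ?thesis
    proof
      assume "has_int {a. \<exists>b. F (d - 1) a b}"
      then show ?thesis using planar 3(1) by blast
    next
      assume i: "has_int {a. 0 < d - 1 \<and> has_int {b. F (d - 1 - 1) a b}}"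
      then have "0 < d - 1" using has_int_nonempty by blast
      then have "has_int {b. has_int {a. F (d - 1 - 1) a b}}"
        using i has_int_swap[OF F] by simp
      then have "has_int {b. (\<exists>a. F (d - 1) a b) \<or> 0 < d - 1 \<and> has_int {a. F (d - 1 - 1) a b}}"
        by (rule has_int_mono) (use \<open>0 < d - 1\<close> in blast)
      then show ?thesis unfolding goal using 3(1) by blast
    qed
  qed
qed

lemma D_move_front:
  assumes E: "E \<in> D (Suc n)" and "i \<le> n" shows "move_front i E \<in> D (Suc n)"
proof -
  have "{z. length z = Suc n \<and> (\<exists>a. \<exists>u\<in>{xs. length xs = i}. \<exists>v\<in>{xs. length xs = n - i}. z = a # u @ v \<and> u @ a # v \<in> E)} \<in> D (Suc n)"
    by (rule D_of_definable) (rule definable_intros E D_tuples refl | simp add: \<open>i \<le> n\<close>)+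
  also have "{z. length z = Suc n \<and> (\<exists>a. \<exists>u\<in>{xs. length xs = i}. \<exists>v\<in>{xs. length xs = n - i}. z = a # u @ v \<and> u @ a # v \<in> E)} = move_front i E"
    unfolding move_front_def using D_length[OF E] \<open>i \<le> n\<close> by fastforce
  finally show ?thesis .
qed

lemma D_swap_front:
  assumes E: "E \<in> D (Suc (Suc n))" shows "swap_front E \<in> D (Suc (Suc n))"
proof -
  have "{z. length z = Suc (Suc n) \<and> (\<exists>a b. \<exists>y\<in>{xs. length xs = n}. z = b # a # y \<and> a # b # y \<in> E)} \<in> D (Suc (Suc n))"
    by (rule D_of_definable) (rule definable_intros E D_tuples refl | simp)+
  also have "{z. length z = Suc (Suc n) \<and> (\<exists>a b. \<exists>y\<in>{xs. length xs = n}. z = b # a # y \<and> a # b # y \<in> E)} = swap_front E"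
    unfolding swap_front_def using D_length[OF E] by fastforce
  finally show ?thesis .
qed

lemma dim_ge_cong_fibers:
  assumes "\<And>a d. dim_ge n d {y. a # y \<in> E} \<longleftrightarrow> dim_ge n d {y. a # y \<in> F}"
  shows "dim_ge (Suc n) d E \<longleftrightarrow> dim_ge (Suc n) d F"
  using assms by simp

lemma dim_ge_swap_front:
  assumes E: "E \<in> D (Suc (Suc n))"
  shows "dim_ge (Suc (Suc n)) d (swap_front E) \<longleftrightarrow> dim_ge (Suc (Suc n)) d E"
proof
  assume "dim_ge (Suc (Suc n)) d (swap_front E)"
  from dim_ge_swap_front_imp[OF D_swap_front[OF E] this] show "dim_ge (Suc (Suc n)) d E"
    by (rule dim_ge_mono) (auto simp: swap_front_def)
qed (rule dim_ge_swap_front_imp[OF E])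

text \<open>A chain of adjacent swaps: on the fibres the induction hypothesis moves the coordinate
  to second place, and \<open>dim_ge_swap_front\<close> brings it to the front.\<close>

lemma dim_ge_move_front: "E \<in> D (Suc n) \<Longrightarrow> i \<le> n \<Longrightarrow> dim_ge (Suc n) d (move_front i E) \<longleftrightarrow> dim_ge (Suc n) d E"
proof (induction i arbitrary: n d E)
  case 0
  show ?case by (rule dim_ge_cong_fibers) (simp add: move_front_def)
next
  case (Suc i)
  then obtain n' where n: "n = Suc n'" "i \<le> n'" by (cases n) auto
  have E: "E \<in> D (Suc (Suc n'))" using Suc.prems n by simp
  have M: "move_front (Suc i) E \<in> D (Suc (Suc n'))" using D_move_front[OF Suc.prems] n by simp
  have "dim_ge (Suc n') d' {y. b # y \<in> swap_front (move_front (Suc i) E)} \<longleftrightarrow> dim_ge (Suc n') d' {y. b # y \<in> E}" for b d'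
  proof -
    have "dim_ge (Suc n') d' {y. b # y \<in> swap_front (move_front (Suc i) E)} \<longleftrightarrow> dim_ge (Suc n') d' (move_front i {y. b # y \<in> E})"
      by (rule dim_ge_cong_fibers) (simp only: mem_Collect_eq fiber_swap_front fiber_move_front_Suc)
    also have "\<dots> \<longleftrightarrow> dim_ge (Suc n') d' {y. b # y \<in> E}"
      by (rule Suc.IH[OF D_fiber[OF E] n(2)])
    finally show ?thesis .
  qed
  then have "dim_ge (Suc (Suc n')) d (swap_front (move_front (Suc i) E)) \<longleftrightarrow> dim_ge (Suc (Suc n')) d E"
    by (rule dim_ge_cong_fibers)
  then show ?case using dim_ge_swap_front[OF M] n by simp
qed

text \<open>The coordinates of the second block are brought before the first block one at a time,
  each by \<open>move_front m\<close>.\<close>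

lemma dim_ge_block_swap:
  "E \<in> D (m + n) \<Longrightarrow> dim_ge (n + m) d {z. \<exists>x y. z = y @ x \<and> length x = m \<and> x @ y \<in> E} \<longleftrightarrow> dim_ge (m + n) d E"
proof (induction n arbitrary: d E)
  case 0
  have "{z. \<exists>x y. z = y @ x \<and> length x = m \<and> x @ y \<in> E} = E"
  proof (intro set_eqI iffI)
    fix z assume "z \<in> {z. \<exists>x y. z = y @ x \<and> length x = m \<and> x @ y \<in> E}"
    then obtain x y where xy: "z = y @ x" "length x = m" "x @ y \<in> E" by blast
    then have "y = []" using D_length[OF 0 xy(3)] by simp
    then show "z \<in> E" using xy by simp
  next
    fix z assume "z \<in> E"
    then show "z \<in> {z. \<exists>x y. z = y @ x \<and> length x = m \<and> x @ y \<in> E}" using D_length[OF 0] by fastforce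
  qed
  then show ?case by simp
next
  case (Suc n)
  have E: "E \<in> D (Suc (m + n))" using Suc.prems by simp
  let ?S = "\<lambda>E. {z. \<exists>x y. z = y @ x \<and> length x = m \<and> x @ y \<in> E}"
  have "dim_ge (n + m) d' {w. b # w \<in> ?S E} \<longleftrightarrow> dim_ge (m + n) d' {w. b # w \<in> move_front m E}" for b d'
  proof -
    have "{w. b # w \<in> ?S E} = ?S {w. b # w \<in> move_front m E}"
    proof (intro set_eqI iffI)
      fix w assume "w \<in> {w. b # w \<in> ?S E}"
      then obtain x y where xy: "b # w = y @ x" "length x = m" "x @ y \<in> E" by blast
      have "length y = Suc n" using D_length[OF E xy(3)] xy(2) by simp
      then obtain y' where "y = b # y'" using xy(1) by (cases y) auto
      then show "w \<in> ?S {w. b # w \<in> move_front m E}" using xy unfolding move_front_def by auto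
    next
      fix w assume "w \<in> ?S {w. b # w \<in> move_front m E}"
      then obtain x y u v where xy: "w = y @ x" "length x = m" "x @ y = u @ v" "length u = m" "u @ b # v \<in> E"
        unfolding move_front_def by auto
      then have "x = u" "y = v" by auto
      then have "b # w = (b # y) @ x \<and> length x = m \<and> x @ (b # y) \<in> E" using xy by simp
      then show "w \<in> {w. b # w \<in> ?S E}" by blast
    qed
    then show ?thesis using Suc.IH[OF D_fiber[OF D_move_front[OF E]], of m] by simp
  qed
  then have "dim_ge (Suc n + m) d (?S E) \<longleftrightarrow> dim_ge (Suc (m + n)) d (move_front m E)" by simp
  also have "\<dots> \<longleftrightarrow> dim_ge (m + Suc n) d E" using dim_ge_move_front[OF E] by simp
  finally show ?case .
qed

section \<open>Additivity of the dimension\<close>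

lemma dim_ge_add_ge:
  "dim_ge m e {x. length x = m \<and> dim_ge n k {y. x @ y \<in> E}} \<Longrightarrow> dim_ge (m + n) (e + k) E"
proof (induction m arbitrary: e E)
  case 0
  then show ?case by simp
next
  case (Suc m)
  let ?G = "{x. length x = Suc m \<and> dim_ge n k {y. x @ y \<in> E}}"
  have fib: "{x. a # x \<in> ?G} = {x. length x = m \<and> dim_ge n k {y. x @ y \<in> {y. a # y \<in> E}}}" for a by simp
  from Suc.prems consider a where "dim_ge m e {x. a # x \<in> ?G}"
    | "0 < e" "has_int {a. dim_ge m (e - 1) {x. a # x \<in> ?G}}" by auto
  then show ?case
  proof cases
    case 1
    then show ?thesis using Suc.IH[of e "{y. a # y \<in> E}"] unfolding fib by auto
  next
    case 2
    have "has_int {a. dim_ge (m + n) (e - 1 + k) {y. a # y \<in> E}}"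
      by (rule has_int_mono[OF 2(2)]) (use Suc.IH in \<open>auto simp: fib\<close>)
    then show ?thesis using 2(1) by simp
  qed
qed

text \<open>The split between base and fibre may vary with the first coordinate, but only finitely
  many \<open>k\<close> occur, so one of them serves for an interval of first coordinates.\<close>

lemma dim_ge_add_le:
  "E \<in> D (m + n) \<Longrightarrow> dim_ge (m + n) d E \<Longrightarrow>
   \<exists>k\<le>d. dim_ge m (d - k) {x. length x = m \<and> dim_ge n k {y. x @ y \<in> E}}"
proof (induction m arbitrary: d E)
  case 0
  then show ?case by (intro exI[of _ d]) simp
next
  case (Suc m)
  let ?G = "\<lambda>k. {x. length x = Suc m \<and> dim_ge n k {y. x @ y \<in> E}}"
  have fib: "{x. a # x \<in> ?G k} = {x. length x = m \<and> dim_ge n k {y. x @ y \<in> {y. a # y \<in> E}}}" for a k by simp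
  have E: "E \<in> D (Suc (m + n))" using Suc.prems(1) by simp
  have G: "?G k \<in> D (Suc m)" for k by (rule D_dim_ge[OF Suc.prems(1)])
  from Suc.prems(2) consider a where "dim_ge (m + n) d {y. a # y \<in> E}"
    | "0 < d" "has_int {a. dim_ge (m + n) (d - 1) {y. a # y \<in> E}}" by auto
  then show ?case
  proof cases
    case 1
    from Suc.IH[OF D_fiber[OF E] 1] show ?thesis unfolding fib[symmetric] by auto
  next
    case 2
    have "{a. dim_ge (m + n) (d - 1) {y. a # y \<in> E}} \<subseteq> {a. \<exists>k\<le>d - 1. dim_ge m (d - 1 - k) {x. a # x \<in> ?G k}}"
      using Suc.IH[OF D_fiber[OF E]] unfolding fib by blast
    from has_int_mono[OF 2(2) this] obtain k where k: "k \<le> d - 1" "has_int {a. dim_ge m (d - 1 - k) {x. a # x \<in> ?G k}}"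
      using has_int_finite_Union[of "d - 1" "\<lambda>k a. dim_ge m (d - 1 - k) {x. a # x \<in> ?G k}"] definable1_dim_ge[OF G] by blast
    \<comment> \<open>Subtraction is truncated: \<open>k < d\<close> makes \<open>d - k\<close> the
      successor of \<open>d - 1 - k\<close>, which accounts for the interval direction.\<close>
    have "k < d" using k(1) 2(1) by linarith
    then have "dim_ge (Suc m) (d - k) (?G k)"
      using k by (simp only: dim_ge.simps) (simp add: diff_right_commute)
    then show ?thesis using k(1) by (intro exI[of _ k]) auto
  qed
qed

text \<open>The first coordinates form a set without an interval, so near the first coordinate of
  \<open>x\<close> only that value can occur, and the fibre over it is handled by induction. As
  \<open>x\<close> may lie outside \<open>Y\<close>, the set is closed as well as discrete.\<close>

lemma dim0_isolated:
  "Y \<in> D n \<Longrightarrow> \<not> dim_ge n 1 Y \<Longrightarrow> length x = n \<Longrightarrow> \<exists>e>0. \<forall>y\<in>Y. near e x y \<longrightarrow> y = x"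
proof (induction n arbitrary: Y x)
  case 0
  obtain u :: 'a where "0 < u" using gt_ex by blast
  then show ?case using 0 D_length[OF 0(1)] by auto
next
  case (Suc n)
  obtain a z where x: "x = a # z" "length z = n" using Suc.prems(3) by (cases x) auto
  have ni: "\<not> has_int (Collect (\<lambda>a. dim_ge n 0 {y. a # y \<in> Y}))" using Suc.prems(2) by simp
  have P: "definable1 (\<lambda>a. dim_ge n 0 {y. a # y \<in> Y})" by (rule definable1_dim_ge[OF Suc.prems(1)])
  obtain r where r: "a < r" "\<And>b. a < b \<Longrightarrow> b < r \<Longrightarrow> \<not> dim_ge n 0 {y. b # y \<in> Y}"
    using no_int_right[OF P ni, of a] by blast
  obtain l where l: "l < a" "\<And>b. l < b \<Longrightarrow> b < a \<Longrightarrow> \<not> dim_ge n 0 {y. b # y \<in> Y}"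
    using no_int_left[OF P ni, of a] by blast
  have "\<not> dim_ge n 1 {y. a # y \<in> Y}" using Suc.prems(2) by auto
  from Suc.IH[OF D_fiber[OF Suc.prems(1)] this x(2)] obtain e where e: "0 < e"
    "\<And>y. a # y \<in> Y \<Longrightarrow> near e z y \<Longrightarrow> y = z" by auto
  define d where "d = min e (min (r - a) (a - l))"
  have d: "0 < d" "d \<le> e" "d \<le> r - a" "d \<le> a - l" using e(1) r(1) l(1) by (auto simp: d_def min_le_iff_disj)
  have "y = x" if y: "y \<in> Y" "near d x y" for y
  proof -
    obtain b w where bw: "y = b # w" "a - b < d" "b - a < d" "near d z w"
      using y(2) unfolding x near_def by (auto simp: list_all2_Cons1)
    have "b - a < r - a" "a - b < a - l" using bw d by order+
    then have br: "b < r" "l < b" by simp_all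
    have "dim_ge n 0 {y. b # y \<in> Y}" using dim_ge_0_iff[OF D_fiber[OF Suc.prems(1)]] y bw by auto
    then have "b = a" using r(2)[of b] l(2)[of b] br by (metis not_less_iff_gr_or_eq)
    then show ?thesis using e(2)[of w] y bw x near_mono[OF bw(4) d(2)] by auto
  qed
  then show ?case using d(1) by blast
qed

text \<open>Induction over slices along a good coordinate yields a point and a radius in each slice;
  with a uniform radius and nearly constant points, one box avoids \<open>Y\<close> in all
  neighbouring slices. Applied to the frontier of \<open>Y\<close>, this says that the frontier has
  smaller dimension.\<close>

lemma frontier_small:
  "X \<in> D n \<Longrightarrow> Y \<in> D n \<Longrightarrow> X \<inter> Y = {} \<Longrightarrow> dim_ge n e X \<Longrightarrow> \<not> dim_ge n (Suc e) Y \<Longrightarrow>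
   \<exists>x\<in>X. \<exists>r>0. \<forall>y\<in>Y. \<not> near r x y"
proof (induction n arbitrary: e X Y)
  case 0
  obtain u :: 'a where "0 < u" using gt_ex by blast
  moreover have "[] \<in> X" using 0(4) by simp
  moreover have "Y = {}" using 0(3) \<open>[] \<in> X\<close> D_length[OF 0(2)] by fastforce
  ultimately show ?case by blast
next
  case (Suc n)
  note X = Suc.prems(1) and Y = Suc.prems(2)
  show ?case
  proof (cases e)
    case 0
    have "X \<noteq> {}" using Suc.prems(4) dim_ge_0_iff[OF X] 0 by simp
    then obtain x where x: "x \<in> X" by blast
    obtain r where "0 < r" "\<forall>y\<in>Y. near r x y \<longrightarrow> y = x"
      using dim0_isolated[OF Y _ D_length[OF X x]] Suc.prems(5) 0 by auto
    then show ?thesis using x Suc.prems(3) by blast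
  next
    case (Suc e')
    obtain i where i: "i \<le> n" "has_int {a. dim_ge n e' {y. a # y \<in> move_front i X}}"
      using dim_ge_good_coordinate[of n e' X] Suc.prems(4) Suc unfolding fiber_move_front by blast
    define X' where "X' = move_front i X"
    define Y' where "Y' = move_front i Y"
    have X': "X' \<in> D (Suc n)" and Y': "Y' \<in> D (Suc n)" unfolding X'_def Y'_def using D_move_front X Y i(1) by blast+
    have "\<not> dim_ge (Suc n) (Suc e) Y'" unfolding Y'_def using dim_ge_move_front[OF Y i(1)] Suc.prems(5) by blast
    \<comment> \<open>An interval of slices of dimension \<open>e\<close> would give
      \<open>Y'\<close> dimension \<open>Suc e\<close>. Hence just to the right of \<open>p\<close>
      the slices of \<open>Y'\<close> have dimension at most \<open>e'\<close>, as the induction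
      hypothesis requires.\<close>
    then have nY: "\<not> has_int (Collect (\<lambda>a. dim_ge n e {y. a # y \<in> Y'}))" by simp
    obtain p q where pq: "p < q" "\<And>a. p < a \<Longrightarrow> a < q \<Longrightarrow> dim_ge n e' {y. a # y \<in> X'}"
      using i(2) unfolding X'_def by (auto elim!: has_intE)
    obtain q' where q': "p < q'" "\<And>a. p < a \<Longrightarrow> a < q' \<Longrightarrow> \<not> dim_ge n e {y. a # y \<in> Y'}"
      using no_int_right[OF definable1_dim_ge[OF Y'] nY, of p] by blast
    let ?Z = "\<lambda>r a. \<exists>x\<in>{xs. length xs = n}. a # x \<in> X' \<and> (\<forall>y\<in>{xs. length xs = n}. a # y \<in> Y' \<longrightarrow> \<not> near r x y)"
    have Z: "definable2 ?Z" unfolding definable2_def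
      by (rule definable_intros definable_near X' Y' D_tuples refl | simp)+
    have disj: "x \<notin> {y. a # y \<in> Y'}" if xX: "x \<in> {y. a # y \<in> X'}" for a x
    proof
      assume "x \<in> {y. a # y \<in> Y'}"
      then obtain u' v' where 2: "x = u' @ v'" "length u' = i" "u' @ a # v' \<in> Y"
        unfolding Y'_def move_front_def by auto
      obtain u v where 1: "x = u @ v" "length u = i" "u @ a # v \<in> X"
        using xX unfolding X'_def move_front_def by auto
      have "u @ v = u' @ v'" "length u = length u'" using 1 2 by simp_all
      then have "u = u' \<and> v = v'" by (simp add: append_eq_append_conv)
      then show False using 1(3) 2(3) Suc.prems(3) by blast
    qed
    have ex: "\<exists>r>0. ?Z r a" if a: "p < a" "a < min q q'" for a
    proof -
      have "dim_ge n e' {y. a # y \<in> X'}" "\<not> dim_ge n (Suc e') {y. a # y \<in> Y'}"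
        using pq(2) q'(2) a Suc by auto
      from Suc.IH[OF D_fiber[OF X'] D_fiber[OF Y'] _ this] disj obtain x r where
        "a # x \<in> X'" "0 < r" "\<And>y. a # y \<in> Y' \<Longrightarrow> \<not> near r x y" by blast
      moreover have "length x = n" using D_length[OF X' \<open>a # x \<in> X'\<close>] by simp
      ultimately show ?thesis by blast
    qed
    have mono: "?Z r' a" if "0 < r'" "r' \<le> r" "?Z r a" for r r' a
      using that near_mono by blast
    have "p < min q q'" using pq q' by simp
    then have "\<exists>r>0. \<exists>p1 q1. p \<le> p1 \<and> p1 < q1 \<and> q1 \<le> min q q' \<and> (\<forall>a. p1 < a \<and> a < q1 \<longrightarrow> ?Z r a)"
      by (intro uniform_parameter[OF Z]) (assumption | erule (2) mono | erule (1) ex)+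
    then obtain r p1 q1 where
      1: "0 < r" "p1 < q1" "\<And>a. p1 < a \<Longrightarrow> a < q1 \<Longrightarrow> ?Z r a" by blast
    let ?R = "\<lambda>z. z \<in> X' \<and> (\<exists>a. \<exists>x\<in>{xs. length xs = n}. z = a # x \<and> (\<forall>y\<in>{xs. length xs = n}. a # y \<in> Y' \<longrightarrow> \<not> near r x y))"
    let ?T = "{z. length z = Suc n \<and> ?R z}"
    have T: "?T \<in> D (Suc n)"
      by (rule D_of_definable) (rule definable_intros definable_near X' Y' D_tuples refl | simp)+
    have Tex: "\<exists>x. a # x \<in> ?T" if a: "p1 < a" "a < q1" for a
      using 1(3)[OF a] by auto
    \<comment> \<open>Three errors add up: from the point of a slice to \<open>c\<close>, from
      \<open>c\<close> to \<open>x1\<close>, and from \<open>x1\<close> to the point of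
      \<open>Y\<close> under test.\<close>
    obtain d where d: "0 < d" "d + d + d \<le> r" using ex_triple_le[OF 1(1)] by blast
    from near_constant_selection[OF T 1(2) Tex d(1)] obtain p2 q2 c where 2: "p2 < q2"
      "\<And>a. p2 < a \<Longrightarrow> a < q2 \<Longrightarrow> \<exists>x. a # x \<in> ?T \<and> near d x c" by blast
    obtain a0 where a0: "p2 < a0" "a0 < q2" using dense[OF 2(1)] by blast
    obtain x1 where x1: "a0 # x1 \<in> ?T" "near d x1 c" using 2(2)[OF a0] by blast
    then obtain u v where uv: "x1 = u @ v" "length u = i" "u @ a0 # v \<in> X" unfolding X'_def move_front_def by auto
    \<comment> \<open>The bound \<open>d\<close> covers the third error; the other two keep the
      moved coordinate between \<open>p2\<close> and \<open>q2\<close>, where each slice has a point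
      of \<open>?T\<close> close to \<open>c\<close>.\<close>
    define s where "s = min d (min (a0 - p2) (q2 - a0))"
    have s: "0 < s" "s \<le> d" "s \<le> a0 - p2" "s \<le> q2 - a0" using d(1) a0 by (auto simp: s_def min_le_iff_disj)
    have "\<not> near s (u @ a0 # v) y" if y: "y \<in> Y" for y
    proof
      assume "near s (u @ a0 # v) y"
      from near_insert_coordinate[OF this] obtain u' b v' where b: "y = u' @ b # v'" "length u' = i"
        "a0 - b < s" "b - a0 < s" "near s x1 (u' @ v')" using uv by auto
      have "a0 - b < a0 - p2" "b - a0 < q2 - a0" using b s by order+
      then have "p2 < b" "b < q2" by simp_all
      from 2(2)[OF this] obtain x where x: "b # x \<in> ?T" "near d x c" by blast
      have "near (d + d + d) x (u' @ v')"
        using near_trans[OF near_trans[OF x(2) near_sym[OF x1(2)]] near_mono[OF b(5) s(2)]] .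
      then have "near r x (u' @ v')" using d(2) near_mono by blast
      moreover have bY: "b # u' @ v' \<in> Y'" using b y unfolding Y'_def move_front_def by auto
      moreover have "length (u' @ v') = n" using D_length[OF Y' bY] by simp
      ultimately show False using x(1) by auto
    qed
    then show ?thesis using uv(3) s(1) by blast
  qed
qed

end

lemma append_eq_append_mem_iff:
  assumes "length v = n" "\<And>x. x \<in> A \<Longrightarrow> length x = n"
  shows "(\<exists>x\<in>A. \<exists>y\<in>B. v @ u = x @ y \<and> Q x y) \<longleftrightarrow> v \<in> A \<and> u \<in> B \<and> Q v u"
proof
  assume "\<exists>x\<in>A. \<exists>y\<in>B. v @ u = x @ y \<and> Q x y"
  then obtain x y where xy: "x \<in> A" "y \<in> B" "v @ u = x @ y" "Q x y" by blast
  have "v = x \<and> u = y" using xy(3) assms(1) assms(2)[OF xy(1)] by (simp add: append_eq_append_conv)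
  then show "v \<in> A \<and> u \<in> B \<and> Q v u" using xy by simp
qed blast

subsection \<open>Definable directed sets\<close>

lemma ex_list_bound:
  fixes x :: "'a::{linordered_ab_group_add, no_top} list"
  shows "\<exists>t>0. \<forall>i<length x. - t \<le> x ! i \<and> x ! i \<le> t"
proof -
  obtain u :: 'a where u: "0 < u" using gt_ex by blast
  let ?S = "insert u (set x \<union> uminus ` set x)"
  have fin: "finite ?S" by simp
  have "- Max ?S \<le> x ! i \<and> x ! i \<le> Max ?S" if "i < length x" for i
  proof -
    have "x ! i \<in> ?S" "- x ! i \<in> ?S" using that by auto
    then have "x ! i \<le> Max ?S" "- x ! i \<le> Max ?S" using Max_ge[OF fin] by blast+
    then show ?thesis by (metis minus_le_iff)
  qed
  moreover have "u \<le> Max ?S" using Max_ge[OF fin] by blast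
  then have "0 < Max ?S" using u by order
  ultimately show ?thesis by blast
qed

section \<open>Definable compactness\<close>

context tame_structure
begin

text \<open>A cluster point is built one coordinate at a time: each is the lower limit of that
  coordinate along the directed family, restricted to points already close to \<open>c\<close> in
  the earlier coordinates. The sets need not be closed, so \<open>c\<close> is only approximated by
  them.\<close>

lemma definable_compactness:
  assumes V: "V \<in> D k" "V \<noteq> {}" and C: "C \<in> D (k + n)"
    and ne: "\<And>v. v \<in> V \<Longrightarrow> \<exists>x. v @ x \<in> C"
    and dir: "\<And>v v'. v \<in> V \<Longrightarrow> v' \<in> V \<Longrightarrow> \<exists>w\<in>V. \<forall>x. w @ x \<in> C \<longrightarrow> v @ x \<in> C \<and> v' @ x \<in> C"
    and bd: "\<And>v x i. v \<in> V \<Longrightarrow> v @ x \<in> C \<Longrightarrow> i < n \<Longrightarrow> - t \<le> x ! i \<and> x ! i \<le> t"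
  shows "\<exists>c. length c = n \<and> (\<forall>v\<in>V. \<forall>e>0. \<exists>x. v @ x \<in> C \<and> near e x c)"
proof -
  have len: "length x = n" if "v \<in> V" "v @ x \<in> C" for v x
    using D_length[OF C that(2)] D_length[OF V(1) that(1)] by simp
  have "j \<le> n \<Longrightarrow> \<exists>c. \<forall>v\<in>V. \<forall>e>0. \<exists>x. v @ x \<in> C \<and> (\<forall>i<j. x ! i - c i < e \<and> c i - x ! i < e)" for j
  proof (induction j)
    case 0
    then show ?case using ne by simp
  next
    case (Suc j)
    then obtain c where c: "\<And>v e. v \<in> V \<Longrightarrow> 0 < e \<Longrightarrow> \<exists>x. v @ x \<in> C \<and> (\<forall>i<j. x ! i - c i < e \<and> c i - x ! i < e)"
      by (metis Suc_leD)
    have j: "j < n" using Suc.prems by simp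
    define N where "N e x \<longleftrightarrow> (\<forall>i<j. x ! i - c i < e \<and> c i - x ! i < e)" for e x
    \<comment> \<open>\<open>b\<close> is eventually a lower bound for coordinate \<open>j\<close>;
      the supremum \<open>m\<close> of all such \<open>b\<close> is the lower limit.\<close>
    let ?L = "\<lambda>b. \<exists>v\<in>V. \<exists>e. 0 < e \<and> (\<forall>x\<in>{xs. length xs = n}. v @ x \<in> C \<longrightarrow> N e x \<longrightarrow> b \<le> x ! j)"
    have L: "definable1 ?L" unfolding definable1_def N_def
      by (rule definable_intros definable_finite_all definable_term_nth[OF definable_list_block] V(1) C D_tuples refl | simp add: j | use j in simp)+
    obtain u :: 'a where u: "0 < u" using gt_ex by blast
    obtain v0 where v0: "v0 \<in> V" using V(2) by blast
    have Lt: "?L (- t)" using v0 u bd[OF v0 _ j] by blast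
    have "b \<le> t" if Lb: "?L b" for b
    proof -
      obtain v e where ve: "v \<in> V" "0 < e" "\<And>x. length x = n \<Longrightarrow> v @ x \<in> C \<Longrightarrow> N e x \<Longrightarrow> b \<le> x ! j"
        using Lb by blast
      obtain x where x: "v @ x \<in> C" "N e x" using c[OF ve(1,2)] unfolding N_def by blast
      have "b \<le> x ! j" "x ! j \<le> t" using ve(3)[OF len[OF ve(1) x(1)] x] bd[OF ve(1) x(1) j] by auto
      then show ?thesis by order
    qed
    from ex_sup[OF L Lt this] obtain m where m: "\<And>b. ?L b \<Longrightarrow> b \<le> m" "\<And>b. (\<And>x. ?L x \<Longrightarrow> x \<le> b) \<Longrightarrow> m \<le> b"
      unfolding is_sup_def by blast
    have "\<exists>x. v @ x \<in> C \<and> (\<forall>i<Suc j. x ! i - (c(j := m)) i < e \<and> (c(j := m)) i - x ! i < e)"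
      if v: "v \<in> V" and e: "0 < e" for v e
    proof -
      have "\<not> m \<le> m - e" using e by simp
      then obtain b where b: "?L b" "m - e < b" using m(2)[of "m - e"] by (meson not_le)
      obtain v1 e1 where 1: "v1 \<in> V" "0 < e1" "\<And>x. length x = n \<Longrightarrow> v1 @ x \<in> C \<Longrightarrow> N e1 x \<Longrightarrow> b \<le> x ! j"
        using b(1) by blast
      \<comment> \<open>In a member below \<open>v\<close> and \<open>v1\<close>, points close
        enough to \<open>c\<close> have coordinate \<open>j\<close> at least \<open>b\<close>. Since
        \<open>m + e\<close> is not an eventual lower bound, one of them has this coordinate below
        \<open>m + e\<close>.\<close>
      obtain v2 where 2: "v2 \<in> V" "\<And>x. v2 @ x \<in> C \<Longrightarrow> v @ x \<in> C \<and> v1 @ x \<in> C" using dir[OF v 1(1)] by blast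
      have "\<not> m + e \<le> m" using e by simp
      then have "\<not> ?L (m + e)" using m(1) by blast
      moreover have "0 < min e e1" using e 1(2) by simp
      ultimately obtain x where x: "v2 @ x \<in> C" "N (min e e1) x" "\<not> m + e \<le> x ! j" using 2(1) by blast
      have N: "N e x" "N e1 x" using x(2) unfolding N_def by auto
      have "b \<le> x ! j" using 1(3)[OF len[OF 2(1) x(1)]] 2(2)[OF x(1)] N by blast
      then have "m - e < x ! j" using b(2) by order
      moreover have "x ! j < m + e" using x(3) by simp
      ultimately have "x ! j - m < e" "m - x ! j < e" by (simp_all add: algebra_simps)
      then show ?thesis using 2(2)[OF x(1)] N(1) unfolding N_def by (intro exI[of _ x]) (auto simp: less_Suc_eq)
    qed
    then show ?case by blast
  qed
  from this[of n] obtain c where c: "\<And>v e. v \<in> V \<Longrightarrow> 0 < e \<Longrightarrow>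
      \<exists>x. v @ x \<in> C \<and> (\<forall>i<n. x ! i - c i < e \<and> c i - x ! i < e)" by blast
  have "\<exists>x. v @ x \<in> C \<and> near e x (map c [0..<n])" if v: "v \<in> V" "0 < e" for v e
  proof -
    obtain x where x: "v @ x \<in> C" "\<forall>i<n. x ! i - c i < e \<and> c i - x ! i < e" using c[OF v] by blast
    then have "near e x (map c [0..<n])" using len[OF v(1) x(1)] by (simp add: near_def list_all2_conv_all_nth)
    then show ?thesis using x(1) by blast
  qed
  then show ?thesis by (intro exI[of _ "map c [0..<n]"]) simp
qed

end

section \<open>Cones of a directed set and their dimension\<close>

locale tame_directed_set = tame_structure D
  for D :: "nat \<Rightarrow> ('a::{linordered_ab_group_add, dense_linorder, no_top, no_bot}) list set set" +
  fixes n :: nat and \<Omega> :: "'a list set" and R :: "'a list \<Rightarrow> 'a list \<Rightarrow> bool"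
  assumes directed: "definable_directed_set D n \<Omega> R"
begin

definition graph_R :: "'a list set" where
  "graph_R = {xs @ ys | xs ys. xs \<in> \<Omega> \<and> ys \<in> \<Omega> \<and> R xs ys}"

definition low :: "'a list \<Rightarrow> 'a list set" where
  "low u = {v \<in> \<Omega>. R v u}"

lemma Omega: "\<Omega> \<in> D n" "\<Omega> \<noteq> {}"
  and graph_R: "graph_R \<in> D (n + n)"
  and R_refl: "u \<in> \<Omega> \<Longrightarrow> R u u"
  using directed unfolding definable_directed_set_def graph_R_def by simp_all

lemma R_trans:
  assumes "u \<in> \<Omega>" "v \<in> \<Omega>" "w \<in> \<Omega>" "R u v" "R v w" shows "R u w"
proof -
  have "\<forall>u\<in>\<Omega>. \<forall>v\<in>\<Omega>. \<forall>w\<in>\<Omega>. R u v \<longrightarrow> R v w \<longrightarrow> R u w"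
    using directed unfolding definable_directed_set_def by (elim conjE)
  then show ?thesis using assms by blast
qed

lemma R_directed:
  assumes "u \<in> \<Omega>" "v \<in> \<Omega>" shows "\<exists>w\<in>\<Omega>. R w u \<and> R w v"
proof -
  have "\<forall>F. finite F \<longrightarrow> F \<subseteq> \<Omega> \<longrightarrow> (\<exists>v\<in>\<Omega>. \<forall>u\<in>F. R v u)"
    using directed unfolding definable_directed_set_def by (elim conjE)
  from this[rule_format, of "{u, v}"] have "\<exists>w\<in>\<Omega>. \<forall>x\<in>{u, v}. R w x" using assms by simp
  then show ?thesis by blast
qed

lemma graph_R_iff: "length v = n \<Longrightarrow> v @ u \<in> graph_R \<longleftrightarrow> v \<in> \<Omega> \<and> u \<in> \<Omega> \<and> R v u"
  using append_eq_append_mem_iff[where A = \<Omega> and B = \<Omega> and Q = R and v = v and u = u,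
      OF _ D_length[OF Omega(1)]] unfolding graph_R_def by blast

text \<open>Nothing is known about \<open>R\<close> outside \<open>\<Omega>\<close>, so the
  definable atom carries both memberships; later set definitions repeat them for this
  reason.\<close>

lemma definable_R:
  assumes "definable_list n s" "definable_list n t" shows "definable (\<lambda>\<rho>. s \<rho> \<in> \<Omega> \<and> t \<rho> \<in> \<Omega> \<and> R (s \<rho>) (t \<rho>))"
proof -
  have "definable (\<lambda>\<rho>. s \<rho> @ t \<rho> \<in> graph_R)" by (rule definable_intros assms graph_R refl)+
  then show ?thesis by (rule definable_cong) (use graph_R_iff assms in \<open>auto simp: definable_list_def\<close>)
qed

lemma D_low: "u \<in> \<Omega> \<Longrightarrow> low u \<in> D n"
proof -
  assume u: "u \<in> \<Omega>"
  have "{v. length v = n \<and> (v \<in> \<Omega> \<and> u \<in> \<Omega> \<and> R v u)} \<in> D n"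
    by (rule D_of_definable) (rule definable_R definable_intros D_length[OF Omega(1) u])+
  also have "{v. length v = n \<and> (v \<in> \<Omega> \<and> u \<in> \<Omega> \<and> R v u)} = low u"
    unfolding low_def using u D_length[OF Omega(1)] by auto
  finally show ?thesis .
qed

text \<open>\<open>d\<close> is the least dimension of a cone. When it is 0, the lower bound only
  says that cones are nonempty, which is reflexivity.\<close>

lemma ex_minimal_low:
  "\<exists>u0\<in>\<Omega>. \<exists>d. \<not> dim_ge n (Suc d) (low u0) \<and> (\<forall>u\<in>\<Omega>. dim_ge n d (low u))"
proof -
  define Q where "Q d \<longleftrightarrow> (\<exists>u\<in>\<Omega>. \<not> dim_ge n (Suc d) (low u))" for d
  have "Q n" unfolding Q_def using Omega(2) dim_ge_bound[of n "Suc n"] by blast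
  then have least: "Q (Least Q)" by (rule LeastI)
  then obtain u0 where u0: "u0 \<in> \<Omega>" "\<not> dim_ge n (Suc (Least Q)) (low u0)" unfolding Q_def by blast
  have "dim_ge n (Least Q) (low u)" if u: "u \<in> \<Omega>" for u
  proof (cases "Least Q")
    case 0
    have "low u \<noteq> {}" using u R_refl unfolding low_def by blast
    then show ?thesis using dim_ge_0_iff[OF D_low[OF u]] 0 by simp
  next
    case (Suc d)
    then have "\<not> Q d" using not_less_Least[of d Q] by simp
    then show ?thesis using u Suc unfolding Q_def by simp
  qed
  then show ?thesis using u0 by blast
qed

definition bounded_below :: "'a list set \<Rightarrow> 'a list set \<Rightarrow> bool" where
  "bounded_below A S \<longleftrightarrow> (\<exists>v\<in>A. \<forall>u\<in>S. R v u)"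

text \<open>Counted over \<open>u\<close>, the pairs have dimension at least \<open>e + d\<close>,
  because transitivity puts the whole cone below \<open>u\<close> inside \<open>low u0\<close>.
  Counted over \<open>v\<close>, this splits into \<open>k\<close> for the fibres and
  \<open>e + d - k\<close> for the base. For \<open>k < e\<close> the base would be a subset of
  \<open>low u0\<close> of dimension above \<open>d\<close>, so \<open>e \<le> k\<close>.\<close>

lemma ex_large_cone:
  assumes u0: "u0 \<in> \<Omega>" "\<not> dim_ge n (Suc d) (low u0)" "\<And>u. u \<in> \<Omega> \<Longrightarrow> dim_ge n d (low u)"
    and B: "B \<in> D n" "B \<subseteq> low u0" "dim_ge n e B"
  shows "\<exists>v\<in>low u0. dim_ge n e {u \<in> B. R v u}"
proof (rule ccontr)
  assume neg: "\<not> ?thesis"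
  note A = D_low[OF u0(1)]
  define E where "E = {z. length z = n + n \<and> (\<exists>v\<in>low u0. \<exists>u\<in>B. z = v @ u \<and> (v \<in> \<Omega> \<and> u \<in> \<Omega> \<and> R v u))}"
  have E: "E \<in> D (n + n)" unfolding E_def
    by (rule D_of_definable) (rule definable_bex[OF A] definable_bex[OF B(1)] definable_R definable_list_eq definable_conj definable_list_append definable_list_block)+
  have E_iff: "v @ u \<in> E \<longleftrightarrow> v \<in> low u0 \<and> u \<in> B \<and> R v u" if "length v = n" for v u
  proof -
    have "v @ u \<in> E \<longleftrightarrow> length (v @ u) = n + n \<and> (v \<in> low u0 \<and> u \<in> B \<and> v \<in> \<Omega> \<and> u \<in> \<Omega> \<and> R v u)"
      unfolding E_def mem_Collect_eq
      by (rule conj_cong[OF refl append_eq_append_mem_iff[OF that D_length[OF A]]])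
    moreover have "length (v @ u) = n + n" if "u \<in> B" using D_length[OF B(1) that] \<open>length v = n\<close> by simp
    ultimately show ?thesis using B(2) unfolding low_def by blast
  qed
  let ?E' = "{z. \<exists>x y. z = y @ x \<and> length x = n \<and> x @ y \<in> E}"
  have "B \<subseteq> {u. length u = n \<and> dim_ge n d {v. u @ v \<in> ?E'}}"
  proof
    fix u assume u: "u \<in> B"
    have "u \<in> \<Omega>" "R u u0" using u B(2) unfolding low_def by auto
    have "low u \<subseteq> {v. u @ v \<in> ?E'}"
    proof
      fix v assume "v \<in> low u"
      then have v: "v \<in> \<Omega>" "R v u" unfolding low_def by auto
      have "v \<in> low u0" using R_trans[OF v(1) \<open>u \<in> \<Omega>\<close> u0(1) v(2) \<open>R u u0\<close>] v(1) unfolding low_def by blast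
      then have "v @ u \<in> E" using E_iff[OF D_length[OF Omega(1) v(1)]] u v(2) by blast
      then show "v \<in> {v. u @ v \<in> ?E'}" using D_length[OF Omega(1) v(1)] by blast
    qed
    then have "dim_ge n d {v. u @ v \<in> ?E'}" using u0(3)[OF \<open>u \<in> \<Omega>\<close>] dim_ge_mono by blast
    then show "u \<in> {u. length u = n \<and> dim_ge n d {v. u @ v \<in> ?E'}}" using D_length[OF B(1) u] by blast
  qed
  then have "dim_ge (n + n) (e + d) ?E'" using dim_ge_add_ge dim_ge_mono[OF B(3)] by blast
  then have "dim_ge (n + n) (e + d) E" using dim_ge_block_swap[OF E] by simp
  from dim_ge_add_le[OF E this] obtain k where k: "k \<le> e + d"
    "dim_ge n (e + d - k) {v. length v = n \<and> dim_ge n k {u. v @ u \<in> E}}" by blast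
  let ?S = "{v. length v = n \<and> dim_ge n k {u. v @ u \<in> E}}"
  have S: "?S \<in> D n" by (rule D_dim_ge[OF E])
  have "?S \<noteq> {}" using k(2) dim_ge_antimono[of n _ ?S 0] dim_ge_0_iff[OF S] by blast
  then obtain v where v: "length v = n" "dim_ge n k {u. v @ u \<in> E}" by blast
  have fib: "v \<in> low u0 \<and> dim_ge n k {u \<in> B. R v u}" if "v \<in> ?S" for v
  proof -
    have v: "length v = n" "dim_ge n k {u. v @ u \<in> E}" using that by auto
    have "{u. v @ u \<in> E} \<noteq> {}"
      using v(2) dim_ge_antimono[OF v(2), of 0] dim_ge_mono[of n 0 "{}"] dim_ge_0_iff[OF D_empty] by (metis le0)
    then have vl: "v \<in> low u0" using E_iff[OF v(1)] by blast
    have "{u. v @ u \<in> E} \<subseteq> {u \<in> B. R v u}" using E_iff[OF v(1)] by blast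
    then show ?thesis using vl dim_ge_mono[OF v(2)] by blast
  qed
  show False
  proof (cases "e \<le> k")
    case True
    then show False using fib[of v] v neg dim_ge_antimono by blast
  next
    case False
    then have "Suc d \<le> e + d - k" by simp
    then have "dim_ge n (Suc d) ?S" using dim_ge_antimono[OF k(2)] by blast
    moreover have "?S \<subseteq> low u0" using fib by blast
    ultimately show False using dim_ge_mono u0(2) by blast
  qed
qed

text \<open>The family \<open>K(s, t)\<close> is stored as one definable set with its parameters in
  the first two coordinates. It grows as \<open>s\<close> decreases and \<open>t\<close> increases,
  which is the direction in which cofinality is tested.\<close>

definition bounded_exhaustion :: "'a list set \<Rightarrow> 'a list set \<Rightarrow> 'a list set \<Rightarrow> bool" where
  "bounded_exhaustion A B K \<longleftrightarrow> (\<forall>s t x. s # t # x \<in> K \<longrightarrow> x \<in> B) \<and>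
      (\<forall>s t s' t' x. s # t # x \<in> K \<longrightarrow> 0 < s' \<longrightarrow> s' \<le> s \<longrightarrow> t \<le> t' \<longrightarrow> s' # t' # x \<in> K) \<and>
      (\<forall>x\<in>B. \<exists>s t. 0 < s \<and> 0 < t \<and> s # t # x \<in> K) \<and>
      (\<forall>s t. 0 < s \<longrightarrow> bounded_below A {x. s # t # x \<in> K})"

lemma bounded_exhaustionD:
  assumes "bounded_exhaustion A B K"
  shows "s # t # x \<in> K \<Longrightarrow> x \<in> B"
    and "s # t # x \<in> K \<Longrightarrow> 0 < s' \<Longrightarrow> s' \<le> s \<Longrightarrow> t \<le> t' \<Longrightarrow> s' # t' # x \<in> K"
    and "x \<in> B \<Longrightarrow> \<exists>s t. 0 < s \<and> 0 < t \<and> s # t # x \<in> K"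
    and "0 < s \<Longrightarrow> bounded_below A {x. s # t # x \<in> K}"
proof -
  note * = assms[unfolded bounded_exhaustion_def]
  show "s # t # x \<in> K \<Longrightarrow> x \<in> B" using *[THEN conjunct1] by blast
  show "s # t # x \<in> K \<Longrightarrow> 0 < s' \<Longrightarrow> s' \<le> s \<Longrightarrow> t \<le> t' \<Longrightarrow> s' # t' # x \<in> K"
    using *[THEN conjunct2, THEN conjunct1] by blast
  show "x \<in> B \<Longrightarrow> \<exists>s t. 0 < s \<and> 0 < t \<and> s # t # x \<in> K"
    using *[THEN conjunct2, THEN conjunct2, THEN conjunct1] by blast
  show "0 < s \<Longrightarrow> bounded_below A {x. s # t # x \<in> K}"
    using *[THEN conjunct2, THEN conjunct2, THEN conjunct2] by blast
qed

text \<open>\<open>e\<close> is a strict bound for the dimension: the induction starts at the empty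
  set, and for \<open>e = Suc n\<close> the bound holds for every set of
  \<open>n\<close>-tuples.\<close>

lemma ex_bounded_exhaustion:
  assumes u0: "u0 \<in> \<Omega>" "\<not> dim_ge n (Suc d) (low u0)" "\<And>u. u \<in> \<Omega> \<Longrightarrow> dim_ge n d (low u)"
  shows "B \<in> D n \<Longrightarrow> B \<subseteq> low u0 \<Longrightarrow> \<not> dim_ge n e B \<Longrightarrow>
    \<exists>K\<in>D (Suc (Suc n)). bounded_exhaustion (low u0) B K"
proof (induction e arbitrary: B)
  case 0
  then have "B = {}" using dim_ge_0_iff by blast
  moreover have "u0 \<in> low u0" using u0(1) R_refl unfolding low_def by blast
  ultimately show ?case using D_empty by (intro bexI[of _ "{}"]) (auto simp: bounded_below_def bounded_exhaustion_def)
next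
  case (Suc e)
  note A = D_low[OF u0(1)] and B = Suc.prems(1,2)
  have AO: "low u0 \<subseteq> \<Omega>" unfolding low_def by blast
  have lenB: "length x = n" if "x \<in> B" for x using D_length[OF B(1) that] .
  have dirA: "\<exists>w\<in>low u0. R w v \<and> R w v'" if v: "v \<in> low u0" "v' \<in> low u0" for v v'
  proof -
    have vO: "v \<in> \<Omega>" "v' \<in> \<Omega>" "R v u0" using v unfolding low_def by auto
    obtain w where w: "w \<in> \<Omega>" "R w v" "R w v'" using R_directed[OF vO(1,2)] by blast
    then show ?thesis using R_trans[OF w(1) vO(1) u0(1) w(2) vO(3)] unfolding low_def by blast
  qed
  define P where "P s x \<longleftrightarrow> bounded_below (low u0) {y \<in> B. near s x y}" for s x
  have P_iff: "P s x \<longleftrightarrow> (\<exists>v\<in>low u0. \<forall>y\<in>B. near s x y \<longrightarrow> v \<in> \<Omega> \<and> y \<in> \<Omega> \<and> R v y)" for s x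
    unfolding P_def bounded_below_def using AO B(2) by blast
  have definableP: "definable (\<lambda>\<rho>. P (\<rho> i 0) (block (\<rho> j) n))" for i j unfolding P_iff
    by (rule definable_bex[OF A] definable_ball[OF B(1)] definable_imp definable_near definable_R definable_list_block definable_term_var)+
  have P_mono: "P s' x" if "P s x" "s' \<le> s" for s s' x
    using that near_mono unfolding P_def bounded_below_def by blast
  define B' where "B' = {x. length x = n \<and> (x \<in> B \<and> (\<forall>s. 0 < s \<longrightarrow> \<not> P s x))}"
  have B': "B' \<in> D n" unfolding B'_def
    by (rule D_of_definable) (rule definableP definable_intros B(1) refl)+
  have "\<not> dim_ge n e B'"
  proof
    assume dB': "dim_ge n e B'"
    have sub: "B' \<subseteq> low u0" using B(2) unfolding B'_def by blast
    from ex_large_cone[OF u0 B' sub dB'] obtain v where v: "v \<in> low u0" "dim_ge n e {u \<in> B'. R v u}" by blast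
    have vO: "v \<in> \<Omega>" "length v = n" using v(1) AO D_length[OF Omega(1)] by blast+
    \<comment> \<open>\<open>X\<close> is the large part of \<open>B'\<close> above
      \<open>v\<close>, \<open>Y\<close> the part of \<open>B\<close> not above \<open>v\<close>. A
      point of \<open>X\<close> with a box free of \<open>Y\<close> has all nearby points of
      \<open>B\<close> above \<open>v\<close>, contrary to its membership in
      \<open>B'\<close>.\<close>
    define X where "X = {u. length u = n \<and> (u \<in> B' \<and> (v \<in> \<Omega> \<and> u \<in> \<Omega> \<and> R v u))}"
    define Y where "Y = {u. length u = n \<and> (u \<in> B \<and> \<not> (v \<in> \<Omega> \<and> u \<in> \<Omega> \<and> R v u))}"
    have X: "X \<in> D n" unfolding X_def by (rule D_of_definable) (rule definable_R definable_intros B' refl vO(2))+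
    have Y: "Y \<in> D n" unfolding Y_def by (rule D_of_definable) (rule definable_not definable_R definable_intros B(1) refl vO(2))+
    have "{u \<in> B'. R v u} \<subseteq> X" unfolding X_def B'_def using vO B(2) AO by blast
    then have "dim_ge n e X" using dim_ge_mono[OF v(2)] by blast
    moreover have "\<not> dim_ge n (Suc e) Y" using Suc.prems(3) dim_ge_mono[of n "Suc e" Y B] unfolding Y_def by blast
    moreover have "X \<inter> Y = {}" unfolding X_def Y_def by blast
    ultimately obtain x r where x: "x \<in> X" "0 < r" "\<And>y. y \<in> Y \<Longrightarrow> \<not> near r x y"
      using frontier_small[OF X Y] by blast
    have "P r x" unfolding P_def bounded_below_def
      using x(3) v(1) lenB unfolding Y_def by blast
    then show False using x(1,2) unfolding X_def B'_def by blast
  qed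
  moreover have "B' \<subseteq> low u0" using B(2) unfolding B'_def by blast
  ultimately obtain K' where K'_ex: "K' \<in> D (Suc (Suc n))" "bounded_exhaustion (low u0) B' K'"
    using Suc.IH[OF B'] by blast
  note K' = K'_ex(1) bounded_exhaustionD[OF K'_ex(2)]
  define C where "C s t = {x. length x = n \<and> (x \<in> B \<and> (\<forall>i<n. - t \<le> x ! i \<and> x ! i \<le> t) \<and> P s x)}" for s t
  define K where "K = {z. length z = Suc (Suc n) \<and> (z \<in> K' \<or> (\<exists>s t. \<exists>x\<in>B. z = s # t # x \<and>
    (\<forall>i<n. - t \<le> x ! i \<and> x ! i \<le> t) \<and> P s x))}"
  have K: "K \<in> D (Suc (Suc n))" unfolding K_def
    by (rule D_of_definable) (rule definableP definable_bex[OF B(1)] definable_intros definable_finite_all definable_term_nth[OF definable_list_block] K'(1) refl | assumption)+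
  have K_iff: "s # t # x \<in> K \<longleftrightarrow> s # t # x \<in> K' \<or> x \<in> C s t" for s t x
    using D_length[OF K'(1), of "s # t # x"] lenB unfolding K_def C_def by auto
  have C_bounded: "bounded_below (low u0) (C s t)" if s: "0 < s" for s t
  proof (rule ccontr)
    assume nb: "\<not> ?thesis"
    \<comment> \<open>Without a common lower bound, the points of \<open>C s t\<close> not above
      \<open>v\<close> form a directed family of nonempty bounded sets, indexed by \<open>v\<close>.
      The detour \<open>s' = s\<close> turns the constant into a variable, as
      \<open>definableP\<close> speaks about variables.\<close>
    define F where "F = {z. length z = n + n \<and> (\<exists>v\<in>low u0. \<exists>x\<in>B. z = v @ x \<and>
      ((\<forall>i<n. - t \<le> x ! i \<and> x ! i \<le> t) \<and> (\<exists>s'. s' = s \<and> P s' x) \<and> \<not> (v \<in> \<Omega> \<and> x \<in> \<Omega> \<and> R v x)))}"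
    have F: "F \<in> D (n + n)" unfolding F_def
      by (rule D_of_definable) (rule definableP definable_R definable_bex[OF A] definable_bex[OF B(1)] definable_intros definable_finite_all definable_term_nth[OF definable_list_block] | assumption)+
    have F_iff: "v @ x \<in> F \<longleftrightarrow> x \<in> C s t \<and> \<not> R v x" if v: "v \<in> low u0" for v x
    proof -
      have "length v = n" using D_length[OF A v] .
      then have "v @ x \<in> F \<longleftrightarrow> length (v @ x) = n + n \<and> (v \<in> low u0 \<and> x \<in> B \<and>
          ((\<forall>i<n. - t \<le> x ! i \<and> x ! i \<le> t) \<and> (\<exists>s'. s' = s \<and> P s' x) \<and> \<not> (v \<in> \<Omega> \<and> x \<in> \<Omega> \<and> R v x)))"
        unfolding F_def mem_Collect_eq
        by (intro conj_cong[OF refl append_eq_append_mem_iff[OF _ D_length[OF A]]])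
      moreover have "length (v @ x) = n + n" if "x \<in> B" using lenB[OF that] \<open>length v = n\<close> by simp
      ultimately show ?thesis using v lenB AO B(2) unfolding C_def by blast
    qed
    have ne: "\<exists>x. v @ x \<in> F" if v: "v \<in> low u0" for v
      using nb v F_iff[OF v] unfolding bounded_below_def by blast
    have CO: "x \<in> \<Omega>" if "x \<in> C s t" for x using that B(2) AO unfolding C_def by blast
    have dir: "\<exists>w\<in>low u0. \<forall>x. w @ x \<in> F \<longrightarrow> v @ x \<in> F \<and> v' @ x \<in> F" if v: "v \<in> low u0" "v' \<in> low u0" for v v'
    proof -
      obtain w where w: "w \<in> low u0" "R w v" "R w v'" using dirA[OF v] by blast
      have "v @ x \<in> F \<and> v' @ x \<in> F" if "w @ x \<in> F" for x
      proof -
        have x: "x \<in> C s t" "\<not> R w x" using that F_iff[OF w(1)] by auto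
        have "\<not> R v x" "\<not> R v' x"
          using R_trans[of w v x] R_trans[of w v' x] w x v AO CO[OF x(1)] by blast+
        then show ?thesis using F_iff v x(1) by blast
      qed
      then show ?thesis using w(1) by blast
    qed
    have bd: "- t \<le> x ! i \<and> x ! i \<le> t" if "v \<in> low u0" "v @ x \<in> F" "i < n" for v x i
      using that F_iff[OF that(1)] unfolding C_def by blast
    have "low u0 \<noteq> {}" using u0(1) R_refl unfolding low_def by blast
    then have "\<exists>c. length c = n \<and> (\<forall>v\<in>low u0. \<forall>e>0. \<exists>x. v @ x \<in> F \<and> near e x c)"
      by (rule definable_compactness[OF A _ F]) (erule ne | erule (1) dir | erule (2) bd)+
    then obtain c where
      c: "\<And>v e. v \<in> low u0 \<Longrightarrow> 0 < e \<Longrightarrow> \<exists>x. v @ x \<in> F \<and> near e x c" by blast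
    \<comment> \<open>The cluster point \<open>c\<close> need not lie in \<open>B\<close>. Two
      points within \<open>r\<close> of it are within \<open>s\<close> of each other, so the lower
      bound \<open>w\<close> for the box around \<open>x\<close> applies to \<open>y\<close>,
      although \<open>y\<close> is chosen not above \<open>w\<close>. This is where the radius
      \<open>s\<close> must be the same on all of \<open>C s t\<close>.\<close>
    obtain r where r: "0 < r" "r + r + r \<le> s" using ex_triple_le[OF s] by blast
    have "r + r \<le> r + r + r" using r(1) by simp
    then have r2: "r + r \<le> s" using r(2) by order
    obtain v where v: "v \<in> low u0" using \<open>low u0 \<noteq> {}\<close> by blast
    obtain x where x: "v @ x \<in> F" "near r x c" using c[OF v r(1)] by blast
    then have "P s x" using F_iff[OF v] unfolding C_def by blast
    then obtain w where w: "w \<in> low u0" "\<And>y. y \<in> B \<Longrightarrow> near s x y \<Longrightarrow> R w y"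
      unfolding P_def bounded_below_def by blast
    obtain y where y: "w @ y \<in> F" "near r y c" using c[OF w(1) r(1)] by blast
    have "near s x y" using near_mono[OF near_trans[OF x(2) near_sym[OF y(2)]] r2] .
    moreover have "y \<in> B" "\<not> R w y" using y(1) F_iff[OF w(1)] unfolding C_def by auto
    ultimately show False using w(2) by blast
  qed
  have K1: "x \<in> B" if "s # t # x \<in> K" for s t x
    using that K'(2) unfolding K_iff C_def B'_def by blast
  have K2: "s' # t' # x \<in> K" if k: "s # t # x \<in> K" and "0 < s'" "s' \<le> s" "t \<le> t'" for s t s' t' x
  proof -
    have "x \<in> C s' t'" if x: "x \<in> C s t"
    proof -
      have t': "- t' \<le> - t" using \<open>t \<le> t'\<close> by simp
      have "- t' \<le> x ! i \<and> x ! i \<le> t'" if "i < n" for i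
      proof -
        have "- t \<le> x ! i" "x ! i \<le> t" using x that unfolding C_def by blast+
        then show ?thesis using t' \<open>t \<le> t'\<close> by (meson order.trans)
      qed
      then show ?thesis using x P_mono \<open>s' \<le> s\<close> unfolding C_def by blast
    qed
    then show ?thesis using k K'(3) that unfolding K_iff by blast
  qed
  have K3: "\<exists>s t. 0 < s \<and> 0 < t \<and> s # t # x \<in> K" if x: "x \<in> B" for x
  proof (cases "x \<in> B'")
    case True
    then show ?thesis using K'(4) unfolding K_iff by blast
  next
    case False
    then obtain s where s: "0 < s" "P s x" using x lenB unfolding B'_def by blast
    obtain t where "0 < t" "\<forall>i<length x. - t \<le> x ! i \<and> x ! i \<le> t" using ex_list_bound by blast
    then have "0 < t" "x \<in> C s t" using x lenB s unfolding C_def by auto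
    then show ?thesis using s(1) unfolding K_iff by blast
  qed
  have K4: "bounded_below (low u0) {x. s # t # x \<in> K}" if s: "0 < s" for s t
  proof -
    obtain v where v: "v \<in> low u0" "\<And>x. s # t # x \<in> K' \<Longrightarrow> R v x"
      using K'(5)[OF s] unfolding bounded_below_def by blast
    obtain v' where v': "v' \<in> low u0" "\<And>x. x \<in> C s t \<Longrightarrow> R v' x"
      using C_bounded[OF s] unfolding bounded_below_def by blast
    obtain w where w: "w \<in> low u0" "R w v" "R w v'" using dirA[OF v(1) v'(1)] by blast
    have "R w x" if k: "s # t # x \<in> K" for x
    proof -
      have "x \<in> B" using k K'(2) unfolding K_iff C_def B'_def by blast
      then have "x \<in> \<Omega>" using B(2) AO by blast
      then show ?thesis
        using k v v' w R_trans[of w v x] R_trans[of w v' x] AO unfolding K_iff by blast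
    qed
    then show ?thesis using w(1) unfolding bounded_below_def by blast
  qed
  have "bounded_exhaustion (low u0) B K"
    unfolding bounded_exhaustion_def
    by (intro conjI allI impI ballI) (erule K1, erule (3) K2, erule K3, erule K4)
  then show ?case using K by blast
qed

text \<open>A lower bound of a set containing an element below \<open>u\<close> is itself below
  \<open>u\<close>. That element stays in the set when the parameters move down from
  \<open>(s, t)\<close>, so the selected bounds stay below \<open>u\<close>.\<close>

lemma ex_cofinal_map:
  "\<exists>\<gamma> :: 'a \<times> 'a \<Rightarrow> 'a list.
     (\<forall>s t. 0 < s \<longrightarrow> 0 < t \<longrightarrow> \<gamma> (s, t) \<in> \<Omega>) \<and>
     {[s, t] @ \<gamma> (s, t) | s t. 0 < s \<and> 0 < t} \<in> D (2 + n) \<and>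
     (\<forall>u\<in>\<Omega>. \<exists>v. 0 < fst v \<and> 0 < snd v \<and>
        (\<forall>w. 0 < fst w \<longrightarrow> 0 < snd w \<longrightarrow> tri_le w v \<longrightarrow> R (\<gamma> w) u))"
proof -
  obtain u0 d where u0: "u0 \<in> \<Omega>" "\<not> dim_ge n (Suc d) (low u0)" "\<And>u. u \<in> \<Omega> \<Longrightarrow> dim_ge n d (low u)"
    using ex_minimal_low by blast
  note A = D_low[OF u0(1)]
  have AO: "low u0 \<subseteq> \<Omega>" unfolding low_def by blast
  have lenA: "length v = n" if "v \<in> low u0" for v using D_length[OF A that] .
  have "\<not> dim_ge n (Suc n) (low u0)" by (rule dim_ge_bound) simp
  then obtain K where K_ex: "K \<in> D (Suc (Suc n))" "bounded_exhaustion (low u0) (low u0) K"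
    using ex_bounded_exhaustion[OF u0 A order_refl] by blast
  note K = K_ex(1) bounded_exhaustionD[OF K_ex(2)]
  define E where "E = {z. length z = 2 + n \<and> (\<exists>s t. \<exists>v\<in>low u0. z = [s, t] @ v \<and> 0 < s \<and> 0 < t \<and>
    (\<forall>x\<in>low u0. s # t # x \<in> K \<longrightarrow> v \<in> \<Omega> \<and> x \<in> \<Omega> \<and> R v x))}"
  have E: "E \<in> D (2 + n)" unfolding E_def
    by (rule D_of_definable) (rule definable_R definable_bex[OF A] definable_ball[OF A] definable_intros K(1) refl)+
  have E_iff: "[s, t] @ v \<in> E \<longleftrightarrow> v \<in> low u0 \<and> 0 < s \<and> 0 < t \<and> (\<forall>x. s # t # x \<in> K \<longrightarrow> R v x)" for s t v
  proof -
    have "[s, t] @ v \<in> E \<longleftrightarrow> length v = n \<and> v \<in> low u0 \<and> 0 < s \<and> 0 < t \<and>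
        (\<forall>x\<in>low u0. s # t # x \<in> K \<longrightarrow> v \<in> \<Omega> \<and> x \<in> \<Omega> \<and> R v x)"
      unfolding E_def by simp
    then show ?thesis using lenA AO K(2) by blast
  qed
  have Eex: "\<exists>v. [s, t] @ v \<in> E" if "0 < s" "0 < t" for s t
    using K(5)[OF that(1), of t] that unfolding E_iff bounded_below_def by blast
  obtain F where F: "F \<in> D (2 + n)" "F \<subseteq> E"
    "\<And>x. length x = 2 \<Longrightarrow> \<exists>y. x @ y \<in> E \<Longrightarrow> \<exists>!y. x @ y \<in> F" using D_choice[OF E] by blast
  define \<gamma> where "\<gamma> p = (THE y. [fst p, snd p] @ y \<in> F)" for p
  have ex1: "\<exists>!y. [s, t] @ y \<in> F" if "0 < s" "0 < t" for s t
    by (rule F(3)) (use Eex[OF that] in auto)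
  have \<gamma>F: "[s, t] @ \<gamma> (s, t) \<in> F" if "0 < s" "0 < t" for s t
    using theI'[OF ex1[OF that]] unfolding \<gamma>_def by simp
  have \<gamma>E: "\<gamma> (s, t) \<in> low u0" "\<And>x. s # t # x \<in> K \<Longrightarrow> R (\<gamma> (s, t)) x" if "0 < s" "0 < t" for s t
    using \<gamma>F[OF that] F(2) E_iff by blast+
  \<comment> \<open>\<open>E\<close> contains positive parameters only, so the selection
    \<open>F\<close> is exactly the graph of \<open>\<gamma>\<close>, which makes the map
    definable.\<close>
  have "{[s, t] @ \<gamma> (s, t) | s t. 0 < s \<and> 0 < t} = F"
  proof (intro set_eqI iffI)
    fix z assume "z \<in> {[s, t] @ \<gamma> (s, t) | s t. 0 < s \<and> 0 < t}"
    then show "z \<in> F" using \<gamma>F by blast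
  next
    fix z assume z: "z \<in> F"
    then have "z \<in> E" using F(2) by blast
    then obtain s t v where v: "z = [s, t] @ v" "0 < s" "0 < t" unfolding E_def by blast
    have "v = \<gamma> (s, t)" using ex1[OF v(2,3)] \<gamma>F[OF v(2,3)] z v(1) by blast
    then show "z \<in> {[s, t] @ \<gamma> (s, t) | s t. 0 < s \<and> 0 < t}" using v by blast
  qed
  then have "{[s, t] @ \<gamma> (s, t) | s t. 0 < s \<and> 0 < t} \<in> D (2 + n)" using F(1) by simp
  moreover have "\<exists>v. 0 < fst v \<and> 0 < snd v \<and> (\<forall>w. 0 < fst w \<longrightarrow> 0 < snd w \<longrightarrow> tri_le w v \<longrightarrow> R (\<gamma> w) u)"
    if u: "u \<in> \<Omega>" for u
  proof -
    \<comment> \<open>Only elements of \<open>low u0\<close> are covered by \<open>K\<close>;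
      directedness replaces \<open>u\<close> by an element below both \<open>u\<close> and
      \<open>u0\<close>.\<close>
    obtain x where x: "x \<in> \<Omega>" "R x u" "R x u0" using R_directed[OF u u0(1)] by blast
    then have "x \<in> low u0" unfolding low_def by blast
    then obtain s t where st: "0 < s" "0 < t" "s # t # x \<in> K" using K(4) by blast
    have "R (\<gamma> w) u" if w: "0 < fst w" "0 < snd w" "tri_le w (s, t)" for w
    proof -
      have "fst w # snd w # x \<in> K" using K(3)[OF st(3) w(1)] w(3) unfolding tri_le_def by simp
      then have "R (\<gamma> w) x" "\<gamma> w \<in> \<Omega>" using \<gamma>E[OF w(1,2)] AO by auto
      then show ?thesis using R_trans x u by blast
    qed
    then show ?thesis using st by (intro exI[of _ "(s, t)"]) simp
  qed
  ultimately show ?thesis using \<gamma>E(1) AO by (intro exI[of _ \<gamma>]) blast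
qed

end

theorem theorem3p15:
  fixes D :: "nat \<Rightarrow> ('a::{linordered_ab_group_add, dense_linorder, no_top, no_bot}) list set set"
    and n :: nat and \<Omega> :: "'a list set" and R :: "'a list \<Rightarrow> 'a list \<Rightarrow> bool"
  assumes "expansion_structure D"
    and "locally_o_minimal D"
    and "definably_complete D"
    and "definable_directed_set D n \<Omega> R"
  shows "\<exists>\<gamma> :: 'a \<times> 'a \<Rightarrow> 'a list.
           (\<forall>s t. 0 < s \<longrightarrow> 0 < t \<longrightarrow> \<gamma> (s, t) \<in> \<Omega>) \<and>
           {[s, t] @ \<gamma> (s, t) | s t. 0 < s \<and> 0 < t} \<in> D (2 + n) \<and>
           (\<forall>u\<in>\<Omega>. \<exists>v. 0 < fst v \<and> 0 < snd v \<and>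
              (\<forall>w. 0 < fst w \<longrightarrow> 0 < snd w \<longrightarrow> tri_le w v \<longrightarrow> R (\<gamma> w) u))"
proof -
  interpret tame_directed_set D n \<Omega> R
    by unfold_locales (fact assms)+
  show ?thesis by (rule ex_cofinal_map)
qed

end
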